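(* For any $R>0$ there exist constants $\delta_0\in(0,1)$ and $C>0$ such that the following holds. Let $\Omega_0\subset\mathbb{R}^2$ be a bounded measurable set with $$\Omega_0\subset B_R\quad\text{and}\quad |D\triangle\Omega_0|<\delta_0,$$ and denote $\delta:=|D\triangle\Omega_0|$. Let $u$, $\phi_x$ and $N_x$ be the velocity, the particle trajectories and the winding numbers around the origin associated with the vortex patch solution of the 2D Euler equation with initial vorticity $\mathbf{1}_{\Omega_0}$. Then: (i) For any $T>0$ there exists a (measurable) set $H_T\subset\Omega_0$ such that $$|H_T|\ge|\Omega_0|-C\delta^{1/12}$$ and, for every $x\in H_T$, the winding number $N_x(T)$ is defined (i.e. $\phi_x(t)\neq 0$ for all $t\in[0,T]$) and $$\left|\frac{N_x(T)}{T}-\frac{1}{4\pi}\right|\le C\delta^{1/12}.$$ (ii) There exists a (measurable) set $H\subset\Omega_0$ such that $$|H|\ge|\Omega_0|-C\delta^{1/12}$$ and, for every $x\in H$, the winding number $N_x(t)$ is defined for all $t>0$ (i.e. $\phi_x(t)\neq0$ for all $t\ge0$) and $$\liminf_{t\to\infty}\left|\frac{N_x(t)}{t}-\frac{1}{4\pi}\right|\le C\delta^{1/12}.$$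
   Context: Notation: $B_r:=\{x\in\mathbb{R}^2: |x|<r\}$, $D:=B_1$ is the unit disc, $|\cdot|$ of a set is Lebesgue measure, $A\triangle B:=(A\setminus B)\cup(B\setminus A)$, and $x^\perp:=(-x_2,x_1)$ for $x=(x_1,x_2)$. Euler equation in vorticity form: $\partial_t\omega+u\cdot\nabla\omega=0$ on $\mathbb{R}^2$ for $t>0$, $\omega|_{t=0}=\omega_0$, with $u=K*\omega$, $K(x):=\frac{1}{2\pi}\frac{x^\perp}{|x|^2}$. For $\omega_0\in L^1\cap L^\infty(\mathbb{R}^2)$ there is a unique global-in-time (Yudovich) weak solution; its velocity is bounded and log-Lipschitz in space uniformly in time, so the flow $\phi_x(\cdot)$, the solution of $\frac{d}{dt}\phi_x(t)=u(t,\phi_x(t))$ for $t>0$, $\phi_x(0)=x$, is uniquely defined for each $x\in\mathbb{R}^2$. Vortex patch: if $\omega_0=\mathbf{1}_{\Omega_0}$ with $\Omega_0\subset\mathbb{R}^2$ bounded and measurable, the solution is $\omega(t)=\mathbf{1}_{\Omega_t}$ with $\Omega_t=\{\phi_x(t): x\in\Omega_0\}$. Tangential velocity: for $x\ne0$ write $u=u_{rad}\frac{x}{|x|}+u_{tan}\frac{x^\perp}{|x|}$, i.e. $u_{tan}(t,x)=u(t,x)\cdot\frac{x^\perp}{|x|}$. Winding number: for a point $x\in\mathbb{R}^2\setminus\{0\}$ whose trajectory does not hit the origin, the winding number of $x$ around the origin up to time $t>0$ is $$N_x(t):=\frac{1}{2\pi}\int_0^t\frac{u_{tan}(s,\phi_x(s))}{|\phi_x(s)|}\,ds.$$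 For $N_x(t)$ to make sense it suffices that $\phi_x(s)\ne0$ for all $s\in[0,t]$. *)

theory Defs
  imports "HOL-Analysis.Analysis"
begin

definition perp :: "real^2 \<Rightarrow> real^2" where
  "perp x = vector [- x$2, x$1]"

definition biot_savart_kernel :: "real^2 \<Rightarrow> real^2" where
  "biot_savart_kernel x = (1 / (2 * pi)) *\<^sub>R ((1 / (norm x)\<^sup>2) *\<^sub>R perp x)"

text \<open>The convolution \<open>K * w\<close>.  The Bochner integral exists for every
  \<open>w\<close> in \<open>L\<^sup>1 \<inter> L\<^sup>\<infinity>\<close>, because \<open>K\<close> is locally integrable and bounded away from the origin.\<close>

definition biot_savart :: "(real^2 \<Rightarrow> real) \<Rightarrow> real^2 \<Rightarrow> real^2" where
  "biot_savart w x = (LINT y|lebesgue. w y *\<^sub>R biot_savart_kernel (x - y))"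

text \<open>Space-time test functions: \<open>C\<^sup>1\<close>, with support in a fixed bounded set of the space variable.\<close>

definition test_function :: "(real \<times> (real^2) \<Rightarrow> real) \<Rightarrow> bool" where
  "test_function \<psi> \<longleftrightarrow>
     (\<forall>p. \<psi> differentiable (at p)) \<and>
     (\<forall>h. continuous_on UNIV (\<lambda>p. frechet_derivative \<psi> (at p) h)) \<and>
     (\<exists>r. \<forall>t x. norm x > r \<longrightarrow> \<psi> (t, x) = 0)"

text \<open>Global Yudovich weak solution of the vorticity equation with initial vorticity \<open>w0\<close>,
  in the Majda--Bertozzi form: the vorticity is in \<open>L\<^sup>\<infinity>([0,T]; L\<^sup>1 \<inter> L\<^sup>\<infinity>)\<close> for all \<open>T\<close>, the velocity is
  \<open>u = K * w\<close>, and the equation is tested on every time interval \<open>[0,T]\<close>.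
  The derivative of \<open>\<psi>\<close> at \<open>(t,x)\<close> in the direction \<open>(1, u(t,x))\<close> is the material derivative
  \<open>\<partial>\<^sub>t \<psi> + u \<cdot> \<nabla>\<psi>\<close>.  Values at negative times are irrelevant.\<close>

definition yudovich_solution ::
  "(real^2 \<Rightarrow> real) \<Rightarrow> (real \<Rightarrow> real^2 \<Rightarrow> real) \<Rightarrow> (real \<Rightarrow> real^2 \<Rightarrow> real^2) \<Rightarrow> bool" where
  "yudovich_solution w0 w u \<longleftrightarrow>
     (\<lambda>(t, x). w t x) \<in> borel_measurable (lebesgue_on ({0..} \<times> UNIV)) \<and>
     (\<forall>T>0. \<exists>M. \<forall>t\<in>{0..T}.
        integrable lebesgue (w t) \<and> (LINT x|lebesgue. \<bar>w t x\<bar>) \<le> M \<and>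
        (AE x in lebesgue. \<bar>w t x\<bar> \<le> M)) \<and>
     (\<forall>t\<ge>0. \<forall>x. u t x = biot_savart (w t) x) \<and>
     (\<forall>\<psi>. test_function \<psi> \<longrightarrow> (\<forall>T>0.
        (LINT x|lebesgue. \<psi> (T, x) * w T x) - (LINT x|lebesgue. \<psi> (0, x) * w0 x) =
        (LINT t:{0..T}|lebesgue. LINT x|lebesgue.
            frechet_derivative \<psi> (at (t, x)) (1, u t x) * w t x)))"

text \<open>\<open>\<phi> x t\<close> is the position at time \<open>t\<close> of the particle that starts at \<open>x\<close>.\<close>

definition is_flow :: "(real \<Rightarrow> real^2 \<Rightarrow> real^2) \<Rightarrow> (real^2 \<Rightarrow> real \<Rightarrow> real^2) \<Rightarrow> bool" where
  "is_flow u \<phi> \<longleftrightarrow>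
     (\<forall>x. \<phi> x 0 = x \<and> continuous_on {0..} (\<phi> x) \<and>
          (\<forall>t>0. (\<phi> x has_vector_derivative u t (\<phi> x t)) (at t)))"

text \<open>A weak solution fixes \<open>w t\<close> only up to null sets; the last clause selects
  the representative given by the indicator of the image of \<open>\<Omega>0\<close> under the flow at time \<open>t\<close>.\<close>

definition vortex_patch_solution ::
  "(real^2) set \<Rightarrow> (real \<Rightarrow> real^2 \<Rightarrow> real) \<Rightarrow> (real \<Rightarrow> real^2 \<Rightarrow> real^2) \<Rightarrow>
   (real^2 \<Rightarrow> real \<Rightarrow> real^2) \<Rightarrow> bool" where
  "vortex_patch_solution \<Omega>0 w u \<phi> \<longleftrightarrow>
     yudovich_solution (indicat_real \<Omega>0) w u \<and>
     is_flow u \<phi> \<and>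
     (\<forall>t\<ge>0. w t = indicat_real ((\<lambda>x. \<phi> x t) ` \<Omega>0))"

definition tangential_velocity :: "(real \<Rightarrow> real^2 \<Rightarrow> real^2) \<Rightarrow> real \<Rightarrow> real^2 \<Rightarrow> real" where
  "tangential_velocity u t x = u t x \<bullet> ((1 / norm x) *\<^sub>R perp x)"

text \<open>Meaningful only if the trajectory of \<open>x\<close> avoids the origin on \<open>[0,t]\<close>.\<close>

definition winding_up_to ::
  "(real \<Rightarrow> real^2 \<Rightarrow> real^2) \<Rightarrow> (real^2 \<Rightarrow> real \<Rightarrow> real^2) \<Rightarrow> real^2 \<Rightarrow> real \<Rightarrow> real" where
  "winding_up_to u \<phi> x t =
     1 / (2 * pi) * integral {0..t} (\<lambda>s. tangential_velocity u s (\<phi> x s) / norm (\<phi> x s))"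

end

theory Submission
  imports Defs
begin

text \<open>
  Write \<open>\<Omega> t\<close> for the patch at time \<open>t\<close>, \<open>D\<close> for the unit disc and \<open>\<delta>\<close> for the area of
  \<open>sym_diff D (\<Omega> 0)\<close>.  The velocity of the disc itself is \<open>perp x / 2\<close> inside \<open>D\<close>
  (\<open>biot_savart_disc\<close>), so a particle in \<open>D\<close> would turn with angular velocity \<open>1/2\<close>, that is with
  winding rate \<open>1 / (4 pi)\<close>.  Three facts make this persist on average for all times.

  First, \<open>\<Omega> t\<close> stays close to \<open>D\<close> in area.  Area and the second moment of the patch are conserved,
  and the integral of \<open>||x|^2 - 1|\<close> over \<open>sym_diff D (\<Omega> t)\<close> is a linear combination of these two
  numbers and a constant (\<open>sym_diff_weight\<close>).  It is therefore conserved, at most of order \<open>\<delta>\<close>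
  initially, and it controls the square of the area of the symmetric difference
  (\<open>measure_le_sqrt_weighted\<close>).  Since the kernel is of size \<open>1 / |x|\<close>, the velocity of a set of
  area \<open>a\<close> is bounded by a multiple of \<open>sqrt a\<close>, and the velocity differs from rigid rotation on \<open>D\<close>
  by a multiple of \<open>\<delta> powr (1/4)\<close> (\<open>u_close_to_rotation\<close>), uniformly in time.

  Second, the flow does not enlarge preimages of open sets (\<open>area_nonincreasing_all\<close>).  The proof compares the
  trajectories with an explicit Euler scheme for a mollified velocity.  Each Euler step of a
  divergence-free smooth field changes area only to second order in the step.  At mollification scale
  \<open>2 ^ (-p)\<close> the Lipschitz constant of the velocity is of order \<open>p\<close>, so over a short time the growth factor
  \<open>exp (C p t)\<close> of the error loses against the mollification error \<open>2 ^ (-p/2)\<close>.  Short times are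
  concatenated by restarting the scheme on the true trajectories.

  Third, an average over particles.  Along a trajectory the error of the angular velocity is at most a multiple of
  \<open>\<delta> powr (1/4) / |x|\<close> inside \<open>D\<close> and bounded outside.  At a fixed time the positions of the particles have
  density at most one, so the mean of \<open>1 / |x|\<close> over particles is bounded, and the particles outside \<open>D\<close> have
  area of order \<open>\<delta> powr (1/2)\<close>.  Tonelli's theorem bounds the mean over all particles of the time
  average of the error by a multiple of \<open>\<delta> powr (1/4)\<close> (\<open>total_error_average\<close>).  By Chebyshev's
  inequality the time average exceeds a multiple of \<open>\<delta> powr (1/8)\<close> only on a set of area of the same order, and
  \<open>\<delta> powr (1/8) \<le> \<delta> powr (1/12)\<close>.  For the second assertion the exceptional set consists of the
  particles that are exceptional at all late integer times; it is an increasing union of small sets.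
  Trajectories through the origin form a null set (\<open>origin_hitting_negligible\<close>).
\<close>

section \<open>The Biot-Savart integral of a bounded set\<close>

abbreviation area :: "(real^2) set \<Rightarrow> real" where "area \<equiv> measure lebesgue"

lemma emeasure_ball_plane:
  assumes "r \<ge> 0" shows "emeasure lebesgue (ball (x::real^2) r) = ennreal (pi * r\<^sup>2)"
proof -
  have "emeasure lborel (ball x r) = ennreal (pi * r\<^sup>2)"
    using assms by (simp add: emeasure_ball unit_ball_vol_2)
  then show ?thesis by (simp)
qed

text \<open>The singular function is replaced by a sum of multiples of indicators of shrinking discs, so that
  its integral is estimated by the areas of discs alone.\<close>

lemma inverse_le_dyadic_sum:
  fixes r d :: real
  assumes "r > 0" "d \<ge> r / 2 ^ p"
  shows "1 / d \<le> 1 / r + (\<Sum>k<p. (2 ^ (k + 1) / r) * indicat_real {..<r / 2 ^ k} d)"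
  using assms(2)
proof (induction p)
  case 0
  then show ?case using assms(1) by (simp add: frac_le)
next
  case (Suc p)
  have pos: "0 \<le> (\<Sum>k<p. (2 ^ (k + 1) / r) * indicat_real {..<r / 2 ^ k} d)"
    using assms by (intro sum_nonneg) auto
  show ?case
  proof (cases "d \<ge> r / 2 ^ p")
    case True
    then show ?thesis using Suc.IH[OF True] by (simp add: indicator_def)
  next
    case False
    have "1 / d \<le> 1 / (r / 2 ^ Suc p)"
      by (intro frac_le) (use Suc.prems assms(1) in simp_all)
    also have "\<dots> = 2 ^ (p + 1) / r" by simp
    finally have "1 / d \<le> 2 ^ (p + 1) / r" .
    moreover have "0 < 1 / r" using assms(1) by simp
    moreover have eq: "indicat_real {..<r / 2 ^ p} d = 1" using False by simp
    ultimately show ?thesis using pos unfolding sum.lessThan_Suc eq mult_1_right by linarith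
  qed
qed

text \<open>Only the sizes of the sublevel sets enter, so the bound holds both for \<open>|x - y|\<close> as a function of
  \<open>y\<close> and for the distance of transported particles from the origin.  Where \<open>f \<ge> sqrt m\<close> the integrand
  is at most \<open>1 / sqrt m\<close>; the rest is a geometric series over dyadic shells.  The set where \<open>f\<close>
  vanishes, and the integrand is infinite, is null by the same hypothesis.\<close>

lemma nn_integral_inverse_le:
  fixes f :: "'a \<Rightarrow> real"
  assumes f [measurable]: "f \<in> borel_measurable M"
    and nn: "\<And>x. x \<in> space M \<Longrightarrow> f x \<ge> 0"
    and small: "\<And>r. r > 0 \<Longrightarrow> emeasure M {x \<in> space M. f x < r} \<le> ennreal (pi * r\<^sup>2)"
    and total: "emeasure M (space M) \<le> ennreal m" "m \<ge> 0"
  shows "(\<integral>\<^sup>+x. inverse (ennreal (f x)) \<partial>M) \<le> ennreal ((1 + 4 * pi) * sqrt m)"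
proof (cases "m = 0")
  case True
  then have "emeasure M (space M) = 0" using total by simp
  then have "AE x in M. False" by (intro AE_I[of _ _ "space M"]) auto
  then have "(\<integral>\<^sup>+x. inverse (ennreal (f x)) \<partial>M) = (\<integral>\<^sup>+x. 0 \<partial>M)"
    by (intro nn_integral_cong_AE) auto
  then show ?thesis by simp
next
  case False
  define r where "r = sqrt m"
  have r: "r > 0" "r\<^sup>2 = m" using False total by (auto simp: r_def)
  have null: "emeasure M {x \<in> space M. f x = 0} \<le> ennreal e" if "e > 0" for e
  proof -
    have "emeasure M {x \<in> space M. f x = 0} \<le> emeasure M {x \<in> space M. f x < sqrt (e / pi)}"
      using that by (intro emeasure_mono) auto
    also have "\<dots> \<le> ennreal (pi * (sqrt (e / pi))\<^sup>2)"
      using that by (intro small) simp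
    also have "pi * (sqrt (e / pi))\<^sup>2 = e" using that by simp
    finally show ?thesis .
  qed
  have "emeasure M {x \<in> space M. f x = 0} \<le> 0"
    by (rule ennreal_le_epsilon) (simp add: null)
  then have ae: "AE x in M. f x \<noteq> 0"
    by (intro AE_I[of _ _ "{x \<in> space M. f x = 0}"]) auto
  have "(\<integral>\<^sup>+x. inverse (ennreal (f x)) \<partial>M) \<le>
     (\<integral>\<^sup>+x. ennreal (1 / r) + (\<Sum>k. ennreal (2 ^ (k + 1) / r) * indicator {x \<in> space M. f x < r / 2 ^ k} x) \<partial>M)"
  proof (rule nn_integral_mono_AE, rule AE_mp[OF ae], rule AE_I2, rule impI)
    fix x assume x: "x \<in> space M" "f x \<noteq> 0"
    then have pos: "f x > 0" using nn[OF x(1)] by simp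
    obtain p where p: "r / f x < 2 ^ p" using real_arch_pow[of 2 "r / f x"] by auto
    have p': "f x \<ge> r / 2 ^ p" using p pos by (simp add: field_simps)
    have "inverse (ennreal (f x)) = ennreal (1 / f x)"
      using pos by (simp add: inverse_ennreal divide_inverse)
    also have "\<dots> \<le> ennreal (1 / r + (\<Sum>k<p. (2 ^ (k + 1) / r) * indicat_real {..<r / 2 ^ k} (f x)))"
      by (intro ennreal_leI inverse_le_dyadic_sum r p')
    also have "\<dots> = ennreal (1 / r) + (\<Sum>k<p. ennreal (2 ^ (k + 1) / r) * indicator {x \<in> space M. f x < r / 2 ^ k} x)"
    proof -
      have "ennreal (\<Sum>k<p. (2 ^ (k + 1) / r) * indicat_real {..<r / 2 ^ k} (f x)) =
          (\<Sum>k<p. ennreal ((2 ^ (k + 1) / r) * indicat_real {..<r / 2 ^ k} (f x)))"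
        using r by (intro sum_ennreal[symmetric]) auto
      also have "\<dots> = (\<Sum>k<p. ennreal (2 ^ (k + 1) / r) * indicator {x \<in> space M. f x < r / 2 ^ k} x)"
        using x(1) by (intro sum.cong) (auto simp: indicator_def)
      finally show ?thesis using r by (subst ennreal_plus) (auto intro!: sum_nonneg)
    qed
    also have "\<dots> \<le> ennreal (1 / r) + (\<Sum>k. ennreal (2 ^ (k + 1) / r) * indicator {x \<in> space M. f x < r / 2 ^ k} x)"
      by (intro add_left_mono sum_le_suminf) auto
    finally show "inverse (ennreal (f x)) \<le> \<dots>" .
  qed
  also have "\<dots> = ennreal (1 / r) * emeasure M (space M) +
      (\<Sum>k. ennreal (2 ^ (k + 1) / r) * emeasure M {x \<in> space M. f x < r / 2 ^ k})"
    by (subst nn_integral_add) (auto simp: nn_integral_suminf nn_integral_cmult_indicator)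
  also have "\<dots> \<le> ennreal (1 / r) * ennreal m +
      (\<Sum>k. ennreal (2 ^ (k + 1) / r) * ennreal (pi * (r / 2 ^ k)\<^sup>2))"
    using r total by (intro add_mono mult_left_mono suminf_le small) auto
  also have "(\<Sum>k. ennreal (2 ^ (k + 1) / r) * ennreal (pi * (r / 2 ^ k)\<^sup>2)) = (\<Sum>k. ennreal (2 * pi * r * (1 / 2) ^ k))"
  proof (intro suminf_cong)
    fix k :: nat
    have "(2 ^ (k + 1) / r) * (pi * (r / 2 ^ k)\<^sup>2) = 2 * pi * r * (1 / 2) ^ k"
      using r(1) by (simp add: power2_eq_square field_simps power_one_over)
    then show "ennreal (2 ^ (k + 1) / r) * ennreal (pi * (r / 2 ^ k)\<^sup>2) = ennreal (2 * pi * r * (1 / 2) ^ k)"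
      using r(1) by (subst ennreal_mult[symmetric]) auto
  qed
  also have "\<dots> = ennreal (\<Sum>k. 2 * pi * r * (1 / 2) ^ k)"
    using r by (intro suminf_ennreal2) (auto intro!: summable_mult summable_geometric)
  also have "(\<Sum>k. 2 * pi * r * (1 / 2) ^ k) = 4 * pi * r"
    by (subst suminf_mult) (auto intro: summable_geometric simp: suminf_geometric)
  also have "ennreal (1 / r) * ennreal m + ennreal (4 * pi * r) = ennreal ((1 + 4 * pi) * sqrt m)"
  proof -
    have "1 / r * m = r" using r(1) unfolding r(2)[symmetric] by (simp add: power2_eq_square)
    then have "ennreal (1 / r) * ennreal m = ennreal r"
      using r(1) total by (subst ennreal_mult[symmetric]) auto
    then show ?thesis using r(1)
      by (simp add: ennreal_plus[symmetric] r_def[symmetric] algebra_simps del: ennreal_plus)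
  qed
  finally show ?thesis .
qed


lemma measurable_lebesgue_if_borel:
  "f \<in> borel_measurable borel \<Longrightarrow> f \<in> borel_measurable lebesgue"
  by (rule measurable_completion) simp

lemma measure_ball_plane: "r \<ge> 0 \<Longrightarrow> area (ball (x::real^2) r) = pi * r\<^sup>2"
  using emeasure_ball_plane[of r x] by (simp add: measure_def)

lemma integrable_indicator_lmeasurable:
  assumes "A \<in> lmeasurable" shows "integrable lebesgue (indicat_real A)"
proof (rule integrable_real_indicator)
  show "A \<in> sets lebesgue" "emeasure lebesgue A < \<infinity>"
    using assms unfolding fmeasurable_def by blast+
qed

lemma has_bochner_integral_indicator_lmeasurable:
  "A \<in> lmeasurable \<Longrightarrow> has_bochner_integral lebesgue (indicat_real A) (area A)"
  by (simp add: has_bochner_integral_iff integrable_indicator_lmeasurable)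

lemma integrable_indicator_bounded:
  fixes f :: "real^2 \<Rightarrow> 'b::{banach, second_countable_topology}"
  assumes "A \<in> lmeasurable" "f \<in> borel_measurable lebesgue" "\<And>y. norm (f y) \<le> B"
  shows "integrable lebesgue (\<lambda>y. indicat_real A y *\<^sub>R f y)"
proof (rule Bochner_Integration.integrable_bound)
  show "integrable lebesgue (\<lambda>y. B * indicat_real A y)"
    by (intro integrable_mult_right integrable_indicator_lmeasurable assms(1))
  show "(\<lambda>y. indicat_real A y *\<^sub>R f y) \<in> borel_measurable lebesgue"
    using assms(1,2) by (intro borel_measurable_scaleR borel_measurable_indicator) (auto simp: fmeasurable_def)
  have "B \<ge> 0" using assms(3) norm_ge_zero order_trans by blast
  then show "AE y in lebesgue. norm (indicat_real A y *\<^sub>R f y) \<le> norm (B * indicat_real A y)"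
    using assms(3) by (intro AE_I2) (auto simp: indicator_def)
qed

lemma inverse_dist_integrable:
  fixes x :: "real^2"
  assumes A: "A \<in> lmeasurable"
  shows "integrable lebesgue (\<lambda>y. indicat_real A y * (1 / norm (x - y)))" (is ?I)
    and "(LINT y|lebesgue. indicat_real A y * (1 / norm (x - y))) \<le> (1 + 4 * pi) * sqrt (area A)" (is ?B)
proof -
  have A': "A \<in> sets lebesgue" using A by (simp add: fmeasurable_def)
  have meas: "(\<lambda>y. norm (x - y)) \<in> borel_measurable lebesgue"
    by (intro measurable_lebesgue_if_borel) measurable
  have eqA: "emeasure lebesgue A = ennreal (area A)"
    using A by (simp add: emeasure_eq_measure2)
  have "(\<integral>\<^sup>+y. ennreal (indicat_real A y * (1 / norm (x - y))) \<partial>lebesgue)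
      \<le> (\<integral>\<^sup>+y. inverse (ennreal (norm (x - y))) * indicator A y \<partial>lebesgue)"
  proof (intro nn_integral_mono)
    fix y show "ennreal (indicat_real A y * (1 / norm (x - y))) \<le> inverse (ennreal (norm (x - y))) * indicator A y"
      by (cases "x = y") (auto simp: indicator_def inverse_ennreal divide_inverse)
  qed
  also have "\<dots> = (\<integral>\<^sup>+y. inverse (ennreal (norm (x - y))) \<partial>lebesgue_on A)"
    using A' by (subst nn_integral_restrict_space) auto
  also have "\<dots> \<le> ennreal ((1 + 4 * pi) * sqrt (area A))"
  proof (rule nn_integral_inverse_le)
    show "(\<lambda>y. norm (x - y)) \<in> borel_measurable (lebesgue_on A)"
      using meas by (rule measurable_restrict_space1)
    show "emeasure (lebesgue_on A) {y \<in> space (lebesgue_on A). norm (x - y) < r} \<le> ennreal (pi * r\<^sup>2)" if "r > 0" for r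
    proof -
      have "emeasure (lebesgue_on A) {y \<in> space (lebesgue_on A). norm (x - y) < r} =
            emeasure lebesgue {y \<in> space (lebesgue_on A). norm (x - y) < r}"
        using A' by (intro emeasure_restrict_space) auto
      also have "\<dots> \<le> emeasure lebesgue (ball x r)"
        by (intro emeasure_mono) (auto simp: dist_norm)
      finally show ?thesis unfolding emeasure_ball_plane[OF less_imp_le[OF that]] .
    qed
    show "emeasure (lebesgue_on A) (space (lebesgue_on A)) \<le> ennreal (area A)"
      using A' eqA by (simp add: emeasure_restrict_space)
  qed auto
  finally have le: "(\<integral>\<^sup>+y. ennreal (indicat_real A y * (1 / norm (x - y))) \<partial>lebesgue)
      \<le> ennreal ((1 + 4 * pi) * sqrt (area A))" .
  have m: "(\<lambda>y. indicat_real A y * (1 / norm (x - y))) \<in> borel_measurable lebesgue"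
    using A' meas by measurable
  show ?I
  proof (rule integrableI_nonneg[OF m])
    show "(\<integral>\<^sup>+y. ennreal (indicat_real A y * (1 / norm (x - y))) \<partial>lebesgue) < \<infinity>"
      using le by (rule order_le_less_trans) simp
  qed auto
  show ?B
    using le by (subst integral_eq_nn_integral[OF m]) (auto intro!: enn2real_leI)
qed

lemma norm_perp [simp]: "norm (perp x) = norm x"
  by (simp add: perp_def norm_eq_sqrt_inner inner_vec_def UNIV_2 add.commute)

lemma norm_biot_savart_kernel: "norm (biot_savart_kernel z) = 1 / (2 * pi) * (1 / norm z)"
  by (cases "z = 0") (simp_all add: biot_savart_kernel_def power2_eq_square)

lemma perp_linear: "bounded_linear perp"
proof (rule bounded_linear_intro[of _ 1])
  show "perp (x + y) = perp x + perp y" "perp (r *\<^sub>R x) = r *\<^sub>R perp x" for x y r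
    by (simp_all add: perp_def vec_eq_iff forall_2)
qed auto

lemma measurable_perp [measurable]: "perp \<in> borel_measurable borel"
  by (intro borel_measurable_continuous_onI linear_continuous_on perp_linear)

lemma measurable_kernel [measurable]: "biot_savart_kernel \<in> borel_measurable borel"
  unfolding biot_savart_kernel_def by measurable

text \<open>All singular integrals below are compared with the integral of \<open>1 / |x - y|\<close> over a set of
  finite area.\<close>

lemma kernel_dominated_integral:
  fixes x :: "real^2" and f :: "real^2 \<Rightarrow> 'b::{banach, second_countable_topology}"
  assumes A: "A \<in> lmeasurable" and f: "f \<in> borel_measurable lebesgue"
    and le: "\<And>y. norm (f y) \<le> indicat_real A y * (1 / norm (x - y))"
  shows "integrable lebesgue f" (is ?I)
    and "norm (LINT y|lebesgue. f y) \<le> (1 + 4 * pi) * sqrt (area A)" (is ?B)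
proof -
  show I: ?I
    using inverse_dist_integrable(1)[OF A, of x] f
    by (rule Bochner_Integration.integrable_bound) (use le in \<open>auto intro!: AE_I2 intro: order_trans\<close>)
  have "norm (LINT y|lebesgue. f y) \<le> (LINT y|lebesgue. indicat_real A y * (1 / norm (x - y)))"
    by (intro Bochner_Integration.integral_norm_bound_integral I inverse_dist_integrable(1)[OF A] le)
  then show ?B using inverse_dist_integrable(2)[OF A, of x] by simp
qed

lemma integrable_kernel:
  assumes A: "A \<in> lmeasurable"
  shows "integrable lebesgue (\<lambda>y. indicat_real A y *\<^sub>R biot_savart_kernel (x - y))"
proof -
  have "integrable lebesgue (\<lambda>y. (2 * pi) *\<^sub>R (indicat_real A y *\<^sub>R biot_savart_kernel (x - y)))"
  proof (rule kernel_dominated_integral(1)[OF A])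
    have "(\<lambda>y. biot_savart_kernel (x - y)) \<in> borel_measurable lebesgue"
      by (intro measurable_lebesgue_if_borel) measurable
    then show "(\<lambda>y. (2 * pi) *\<^sub>R (indicat_real A y *\<^sub>R biot_savart_kernel (x - y))) \<in> borel_measurable lebesgue"
      using A by (intro borel_measurable_scaleR borel_measurable_const borel_measurable_indicator) (auto simp: fmeasurable_def)
  qed (auto simp: norm_biot_savart_kernel)
  then have "integrable lebesgue (\<lambda>y. (1 / (2 * pi)) *\<^sub>R (2 * pi) *\<^sub>R (indicat_real A y *\<^sub>R biot_savart_kernel (x - y)))"
    by (rule integrable_scaleR_right)
  then show ?thesis by simp
qed

text \<open>Only the points of the symmetric difference contribute to the difference of the two integrals.\<close>

lemma biot_savart_diff_le:
  assumes A: "A \<in> lmeasurable" and B: "B \<in> lmeasurable"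
  shows "norm (biot_savart (indicat_real A) x - biot_savart (indicat_real B) x) \<le> 3 * sqrt (area (sym_diff A B))"
proof -
  have S: "sym_diff A B \<in> lmeasurable" using A B by (intro fmeasurable.Un fmeasurable.Diff)
  let ?g = "\<lambda>y. (indicat_real A y - indicat_real B y) *\<^sub>R biot_savart_kernel (x - y)"
  have eq: "biot_savart (indicat_real A) x - biot_savart (indicat_real B) x = (LINT y|lebesgue. ?g y)"
    unfolding biot_savart_def
    by (subst Bochner_Integration.integral_diff[symmetric]) (auto intro!: integrable_kernel A B simp: algebra_simps)
  have "norm (LINT y|lebesgue. (2 * pi) *\<^sub>R ?g y) \<le> (1 + 4 * pi) * sqrt (area (sym_diff A B))"
  proof (rule kernel_dominated_integral(2)[OF S])
    have "(\<lambda>y. biot_savart_kernel (x - y)) \<in> borel_measurable lebesgue"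
      by (intro measurable_lebesgue_if_borel) measurable
    then show "(\<lambda>y. (2 * pi) *\<^sub>R ?g y) \<in> borel_measurable lebesgue"
      using A B by (intro borel_measurable_scaleR borel_measurable_const borel_measurable_diff borel_measurable_indicator)
        (auto simp: fmeasurable_def)
    show "norm ((2 * pi) *\<^sub>R ?g y) \<le> indicat_real (sym_diff A B) y * (1 / norm (x - y))" for y
      by (auto simp: norm_biot_savart_kernel indicator_def)
  qed
  then have "2 * pi * norm (LINT y|lebesgue. ?g y) \<le> (1 + 4 * pi) * sqrt (area (sym_diff A B))"
    unfolding integral_scaleR_right by simp
  also have "\<dots> \<le> 2 * pi * (3 * sqrt (area (sym_diff A B)))"
    using pi_ge_two mult_right_mono[of "1 + 4 * pi" "6 * pi" "sqrt (area (sym_diff A B))"] by simp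
  finally show ?thesis unfolding eq by (simp add: mult_le_cancel_left)
qed

corollary norm_biot_savart_le:
  assumes "A \<in> lmeasurable"
  shows "norm (biot_savart (indicat_real A) x) \<le> 3 * sqrt (area A)"
  using biot_savart_diff_le[OF assms fmeasurable.empty_sets, of x] by (simp add: biot_savart_def)

text \<open>Each dyadic shell contributes a bounded amount to the integral of this function over the plane.  There are about \<open>p\<close> shells
  between the scales \<open>2 ^ (-p)\<close> and one, hence the logarithmic growth in the next lemma.\<close>

lemma log_kernel_pointwise:
  fixes d :: real
  assumes "d \<ge> 0"
  shows "1 / (d\<^sup>2 + (1 / 2 ^ p)\<^sup>2) \<le> 1 + (\<Sum>k<Suc p. 4 ^ (k + 1) * indicat_real {..<1 / 2 ^ k} d)"
proof -
  have far: "1 / d\<^sup>2 \<le> 1 + (\<Sum>k<q. 4 ^ (k + 1) * indicat_real {..<1 / 2 ^ k} d)" if "d \<ge> 1 / 2 ^ q" for q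
    using that
  proof (induction q)
    case 0
    then show ?case by (simp add: divide_simps)
  next
    case (Suc q)
    have pos: "0 \<le> (\<Sum>k<q. 4 ^ (k + 1) * indicat_real {..<1 / 2 ^ k} d)"
      by (intro sum_nonneg) auto
    show ?case
    proof (cases "d \<ge> 1 / 2 ^ q")
      case True
      then have "indicat_real {..<1 / 2 ^ q} d = 0" by simp
      then show ?thesis using Suc.IH[OF True] unfolding sum.lessThan_Suc by simp
    next
      case False
      have "(1 / 2 ^ Suc q)\<^sup>2 \<le> d\<^sup>2" using Suc.prems by (intro power_mono) auto
      then have "1 / d\<^sup>2 \<le> 1 / (1 / 2 ^ Suc q)\<^sup>2" by (intro frac_le) auto
      also have "\<dots> = 4 ^ (q + 1)" by (simp add: power2_eq_square power_mult_distrib[symmetric] field_simps)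
      finally have "1 / d\<^sup>2 \<le> 4 ^ (q + 1)" .
      moreover have eq: "indicat_real {..<1 / 2 ^ q} d = 1" using False by simp
      ultimately show ?thesis using pos unfolding sum.lessThan_Suc eq mult_1_right by linarith
    qed
  qed
  have pos: "0 \<le> (\<Sum>k<p. 4 ^ (k + 1) * indicat_real {..<1 / 2 ^ k} d)"
    by (intro sum_nonneg) auto
  show ?thesis
  proof (cases "d \<ge> 1 / 2 ^ p")
    case True
    then have d0: "d > 0" by (rule less_le_trans[rotated]) simp
    have "1 / (d\<^sup>2 + (1 / 2 ^ p)\<^sup>2) \<le> 1 / d\<^sup>2" using d0 by (intro frac_le) auto
    moreover have "indicat_real {..<1 / 2 ^ p} d = 0" using True by simp
    ultimately show ?thesis using far[OF True] unfolding sum.lessThan_Suc by simp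
  next
    case False
    have "1 / (d\<^sup>2 + (1 / 2 ^ p)\<^sup>2) \<le> 1 / (1 / 2 ^ p)\<^sup>2" by (intro frac_le) auto
    also have "\<dots> = 4 ^ p" by (simp add: power2_eq_square power_mult_distrib[symmetric])
    also have "\<dots> \<le> 4 ^ (p + 1)" by simp
    finally have "1 / (d\<^sup>2 + (1 / 2 ^ p)\<^sup>2) \<le> 4 ^ (p + 1)" .
    moreover have eq: "indicat_real {..<1 / 2 ^ p} d = 1" using False by simp
    ultimately show ?thesis using pos unfolding sum.lessThan_Suc eq mult_1_right by linarith
  qed
qed

lemma log_kernel_integral:
  fixes x :: "real^2"
  assumes A: "A \<in> lmeasurable"
  shows "integrable lebesgue (\<lambda>y. indicat_real A y * (1 / ((norm (x - y))\<^sup>2 + (1 / 2 ^ p)\<^sup>2)))" (is ?I)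
    and "(LINT y|lebesgue. indicat_real A y * (1 / ((norm (x - y))\<^sup>2 + (1 / 2 ^ p)\<^sup>2)))
       \<le> area A + 4 * pi * (p + 1)" (is ?B)
proof -
  have "norm (1 / ((norm (x - y))\<^sup>2 + (1 / 2 ^ p)\<^sup>2)) \<le> 1 / (1 / 2 ^ p)\<^sup>2" for y
    by (simp only: real_norm_def, subst abs_of_nonneg) (auto intro!: frac_le add_nonneg_nonneg)
  moreover have "(\<lambda>y. 1 / ((norm (x - y))\<^sup>2 + (1 / 2 ^ p)\<^sup>2)) \<in> borel_measurable lebesgue"
    by (intro measurable_lebesgue_if_borel) measurable
  ultimately show I: ?I
    using integrable_indicator_bounded[OF A, where f = "\<lambda>y. 1 / ((norm (x - y))\<^sup>2 + (1 / 2 ^ p)\<^sup>2)"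
        and B = "1 / (1 / 2 ^ p)\<^sup>2"] by simp
  let ?J = "\<lambda>y. indicat_real A y + (\<Sum>k<Suc p. 4 ^ (k + 1) * indicat_real (ball x (1 / 2 ^ k)) y)"
  have J: "has_bochner_integral lebesgue ?J (area A + (\<Sum>k<Suc p. 4 ^ (k + 1) * area (ball x (1 / 2 ^ k))))"
    by (intro has_bochner_integral_add has_bochner_integral_sum has_bochner_integral_mult_right
        has_bochner_integral_indicator_lmeasurable A lmeasurable_ball)
  have "(LINT y|lebesgue. indicat_real A y * (1 / ((norm (x - y))\<^sup>2 + (1 / 2 ^ p)\<^sup>2))) \<le> (LINT y|lebesgue. ?J y)"
  proof (intro integral_mono I)
    show "integrable lebesgue ?J" using J by (simp add: has_bochner_integral_iff)
    fix y
    have "indicat_real (ball x (1 / 2 ^ k)) y = indicat_real {..<1 / 2 ^ k} (norm (x - y))" for k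
      by (simp add: indicator_def dist_norm)
    then show "indicat_real A y * (1 / ((norm (x - y))\<^sup>2 + (1 / 2 ^ p)\<^sup>2)) \<le> ?J y"
      using log_kernel_pointwise[of "norm (x - y)" p]
      by (cases "y \<in> A") (auto simp del: sum.lessThan_Suc intro!: sum_nonneg)
  qed
  also have "(LINT y|lebesgue. ?J y) = area A + (\<Sum>k<Suc p. 4 ^ (k + 1) * area (ball x (1 / 2 ^ k)))"
    using J by (simp add: has_bochner_integral_iff)
  also have "(\<Sum>k<Suc p. 4 ^ (k + 1) * area (ball x (1 / 2 ^ k))) = (\<Sum>k<Suc p. 4 * pi)"
  proof (intro sum.cong refl)
    fix k
    have "area (ball x (1 / 2 ^ k)) = pi * (1 / 2 ^ k)\<^sup>2" by (intro measure_ball_plane) simp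
    then show "4 ^ (k + 1) * area (ball x (1 / 2 ^ k)) = 4 * pi"
      by (simp only:) (simp add: power2_eq_square power_mult_distrib[symmetric])
  qed
  finally show ?B by (simp add: algebra_simps)
qed

section \<open>The mollified velocity\<close>

text \<open>The vortex blob kernel: divergence-free and smooth for \<open>e > 0\<close>, with an explicit derivative.\<close>

definition reg_kernel :: "real \<Rightarrow> real^2 \<Rightarrow> real^2" where
  "reg_kernel e z = (1 / (2 * pi)) *\<^sub>R ((1 / ((norm z)\<^sup>2 + e\<^sup>2)) *\<^sub>R perp z)"

definition reg_kernel_deriv :: "real \<Rightarrow> real^2 \<Rightarrow> real^2 \<Rightarrow> real^2" where
  "reg_kernel_deriv e z h = (1 / (2 * pi)) *\<^sub>R
     ((1 / ((norm z)\<^sup>2 + e\<^sup>2)) *\<^sub>R perp h - (2 * (z \<bullet> h) / ((norm z)\<^sup>2 + e\<^sup>2)\<^sup>2) *\<^sub>R perp z)"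

lemma reg_kernel_has_derivative:
  assumes "e > 0"
  shows "(reg_kernel e has_derivative reg_kernel_deriv e z) (at z)"
proof -
  define q where "q z = (norm z)\<^sup>2 + e\<^sup>2" for z :: "real^2"
  have q: "q z > 0" for z using assms by (simp add: q_def add_nonneg_pos)
  have n: "(q has_derivative (\<lambda>h. 2 * (z \<bullet> h))) (at z)"
    unfolding power2_norm_eq_inner q_def[abs_def]
    by (auto intro!: derivative_eq_intros simp: inner_commute)
  have p: "(perp has_derivative perp) (at z)"
    using bounded_linear.has_derivative[OF perp_linear has_derivative_ident] .
  have "((\<lambda>z. (1 / (2 * pi)) *\<^sub>R ((1 / q z) *\<^sub>R perp z)) has_derivative
     (\<lambda>h. (1 / (2 * pi)) *\<^sub>R ((1 / q z) *\<^sub>R perp h - (2 * (z \<bullet> h) / (q z)\<^sup>2) *\<^sub>R perp z))) (at z)"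
    by (rule has_derivative_eq_rhs[OF has_derivative_scaleR_right[OF has_derivative_scaleR[OF has_derivative_divide'[OF has_derivative_const n] p]]])
      (use q[of z] in \<open>simp_all add: fun_eq_iff power2_eq_square\<close>)
  then show ?thesis unfolding reg_kernel_def[abs_def] reg_kernel_deriv_def[abs_def] q_def .
qed

lemma norm_reg_kernel_deriv_le:
  assumes "e > 0"
  shows "norm (reg_kernel_deriv e z h) \<le> 3 / (2 * pi) * (1 / ((norm z)\<^sup>2 + e\<^sup>2)) * norm h"
proof -
  define q where "q = (norm z)\<^sup>2 + e\<^sup>2"
  have q: "q > 0" "(norm z)\<^sup>2 \<le> q" using assms by (auto simp: q_def add_nonneg_pos)
  have "norm ((1 / q) *\<^sub>R perp h - (2 * (z \<bullet> h) / q\<^sup>2) *\<^sub>R perp z) \<le> norm h / q + 2 * \<bar>z \<bullet> h\<bar> / q\<^sup>2 * norm z"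
    using q by (intro order_trans[OF norm_triangle_ineq4]) (simp add: abs_mult)
  also have "2 * \<bar>z \<bullet> h\<bar> / q\<^sup>2 * norm z \<le> 2 * (norm z * norm h) / q\<^sup>2 * norm z"
    by (intro mult_right_mono divide_right_mono mult_left_mono Cauchy_Schwarz_ineq2) auto
  also have "\<dots> = 2 * norm h / q\<^sup>2 * (norm z)\<^sup>2" by (simp add: power2_eq_square)
  also have "\<dots> \<le> 2 * norm h / q\<^sup>2 * q" using q by (intro mult_left_mono) auto
  also have "\<dots> = 2 * norm h / q" using q by (simp add: power2_eq_square)
  finally have *: "norm ((1 / q) *\<^sub>R perp h - (2 * (z \<bullet> h) / q\<^sup>2) *\<^sub>R perp z) \<le> 3 * norm h / q"
    by (simp add: add_divide_distrib[symmetric])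
  have "norm (reg_kernel_deriv e z h) = 1 / (2 * pi) * norm ((1 / q) *\<^sub>R perp h - (2 * (z \<bullet> h) / q\<^sup>2) *\<^sub>R perp z)"
    unfolding reg_kernel_deriv_def q_def[symmetric] by simp
  also have "\<dots> \<le> 1 / (2 * pi) * (3 * norm h / q)" by (intro mult_left_mono *) auto
  finally show ?thesis by (simp add: q_def)
qed

text \<open>The kernel is a perpendicular gradient, hence divergence-free.\<close>

lemma reg_kernel_deriv_trace:
  "reg_kernel_deriv e z (axis 1 1) $ 1 + reg_kernel_deriv e z (axis 2 1) $ 2 = 0"
proof -
  have "z \<bullet> axis 1 1 = z $ 1" "z \<bullet> axis 2 1 = z $ 2" by (simp_all add: inner_axis)
  then show ?thesis unfolding reg_kernel_deriv_def
    by (simp add: perp_def axis_def algebra_simps)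
qed

lemma continuous_on_reg_kernel_deriv:
  assumes "e > 0" shows "continuous_on UNIV (\<lambda>z. reg_kernel_deriv e z h)"
proof -
  have "(norm z)\<^sup>2 + e\<^sup>2 \<noteq> 0" for z :: "real^2" using assms
    by (metis add_nonneg_pos less_irrefl zero_le_power2 zero_less_power)
  then show ?thesis unfolding reg_kernel_deriv_def
    by (intro continuous_intros linear_continuous_on perp_linear) auto
qed

lemma norm_reg_kernel_le:
  assumes "e > 0" shows "norm (reg_kernel e z) \<le> 1 / e"
proof -
  define q where "q = (norm z)\<^sup>2 + e\<^sup>2"
  have q: "q > 0" using assms by (simp add: q_def add_nonneg_pos)
  have "2 * norm z * e \<le> q" unfolding q_def by (rule sum_squares_bound)
  moreover have "norm z * e \<ge> 0" using assms by simp
  ultimately have "norm z * e \<le> q" by linarith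
  then have "norm z / q \<le> 1 / e" using q assms by (simp add: field_simps)
  moreover have "norm (reg_kernel e z) = 1 / (2 * pi) * (norm z / q)"
    using q by (simp add: reg_kernel_def q_def)
  moreover have "1 / (2 * pi) * (norm z / q) \<le> 1 * (norm z / q)"
  proof (rule mult_right_mono)
    show "1 / (2 * pi) \<le> 1" using pi_ge_two by (simp add: divide_simps)
    show "0 \<le> norm z / q" using q by simp
  qed
  ultimately show ?thesis by linarith
qed

lemma norm_reg_kernel_deriv_le_const:
  assumes "e > 0" shows "norm (reg_kernel_deriv e z h) \<le> 1 / e\<^sup>2 * norm h"
proof -
  have "3 / (2 * pi) * (1 / ((norm z)\<^sup>2 + e\<^sup>2)) \<le> 1 * (1 / e\<^sup>2)"
  proof (rule mult_mono)
    show "3 / (2 * pi) \<le> 1" using pi_ge_two by (simp add: divide_simps)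
    show "1 / ((norm z)\<^sup>2 + e\<^sup>2) \<le> 1 / e\<^sup>2" using assms by (intro frac_le) auto
  qed auto
  then show ?thesis using norm_reg_kernel_deriv_le[OF assms, of z h]
    by (smt (verit) mult_right_mono norm_ge_zero mult_1)
qed

text \<open>Within distance \<open>sqrt e\<close> of the origin the difference is at most the singular kernel.  Further out it is
  at most \<open>e^2 / |z|^3 \<le> sqrt e\<close>.  With this radius both parts are of order
  \<open>sqrt e\<close> after integration over a set of finite area.\<close>

lemma norm_diff_reg_kernel_le:
  assumes "0 < e"
  shows "2 * pi * norm (biot_savart_kernel z - reg_kernel e z) \<le>
    indicat_real (ball 0 (sqrt e)) z * (1 / norm z) + sqrt e"
proof (cases "z = 0")
  case True
  then show ?thesis using assms by (simp add: biot_savart_kernel_def reg_kernel_def)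
next
  case False
  define d where "d = norm z"
  have d: "d > 0" using False by (simp add: d_def)
  have "biot_savart_kernel z - reg_kernel e z = (1 / (2 * pi)) *\<^sub>R ((1 / d\<^sup>2 - 1 / (d\<^sup>2 + e\<^sup>2)) *\<^sub>R perp z)"
    by (simp add: biot_savart_kernel_def reg_kernel_def d_def algebra_simps)
  then have "2 * pi * norm (biot_savart_kernel z - reg_kernel e z) = \<bar>1 / d\<^sup>2 - 1 / (d\<^sup>2 + e\<^sup>2)\<bar> * d"
    by (simp add: d_def)
  also have "\<bar>1 / d\<^sup>2 - 1 / (d\<^sup>2 + e\<^sup>2)\<bar> = 1 / d\<^sup>2 - 1 / (d\<^sup>2 + e\<^sup>2)"
    using d by (intro abs_of_nonneg) (simp add: frac_le)
  finally have eq: "2 * pi * norm (biot_savart_kernel z - reg_kernel e z) = (1 / d\<^sup>2 - 1 / (d\<^sup>2 + e\<^sup>2)) * d" .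
  show ?thesis
  proof (cases "d < sqrt e")
    case True
    have "(1 / d\<^sup>2 - 1 / (d\<^sup>2 + e\<^sup>2)) * d \<le> (1 / d\<^sup>2) * d"
      using d by (intro mult_right_mono) auto
    also have "\<dots> = 1 / d" using d by (simp add: power2_eq_square)
    also have "\<dots> \<le> 1 / d + sqrt e" using assms by simp
    finally show ?thesis using True eq by (simp add: d_def)
  next
    case F: False
    have pos: "d\<^sup>2 + e\<^sup>2 > 0" using d by (simp add: add_pos_nonneg)
    have "1 / d\<^sup>2 - 1 / (d\<^sup>2 + e\<^sup>2) = e\<^sup>2 / (d\<^sup>2 * (d\<^sup>2 + e\<^sup>2))"
      using d pos by (subst diff_frac_eq) auto
    then have "(1 / d\<^sup>2 - 1 / (d\<^sup>2 + e\<^sup>2)) * d = e\<^sup>2 / (d * (d\<^sup>2 + e\<^sup>2))"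
      using d by (simp add: power2_eq_square[of d])
    also have "\<dots> \<le> e\<^sup>2 / (sqrt e * (sqrt e)\<^sup>2)"
    proof (intro divide_left_mono mult_mono)
      have "(sqrt e)\<^sup>2 \<le> d\<^sup>2" using F assms by (intro power_mono) auto
      then show "(sqrt e)\<^sup>2 \<le> d\<^sup>2 + e\<^sup>2" by (smt (verit) zero_le_power2)
    qed (use F d assms pos in auto)
    also have "\<dots> = sqrt e"
      using assms by (simp add: field_simps power2_eq_square)
    finally show ?thesis using F eq by (simp add: d_def)
  qed
qed

text \<open>All smoothness comes from the kernel.  The difference quotients are
  bounded by twice the Lipschitz constant of \<open>k\<close>, and dominated convergence applies along every
  sequence that tends to \<open>x\<close>.\<close>

lemma convolution_has_derivative:
  fixes k :: "real^2 \<Rightarrow> real^2"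
  assumes A: "A \<in> lmeasurable"
    and der: "\<And>z. (k has_derivative k' z) (at z)"
    and cont: "\<And>h. continuous_on UNIV (\<lambda>z. k' z h)"
    and B: "\<And>z h. norm (k' z h) \<le> B * norm h"
    and B0: "\<And>z. norm (k z) \<le> B0"
  shows "((\<lambda>x. LINT y|lebesgue. indicat_real A y *\<^sub>R k (x - y)) has_derivative
     (\<lambda>h. LINT y|lebesgue. indicat_real A y *\<^sub>R k' (x - y) h)) (at x)"
proof -
  have k'm: "(\<lambda>y. k' (x - y) h) \<in> borel_measurable lebesgue" for x h
    by (intro measurable_lebesgue_if_borel borel_measurable_continuous_onI continuous_on_compose2[OF cont] continuous_intros) auto
  have kc: "continuous_on UNIV k"
    using der by (meson continuous_at_imp_continuous_on has_derivative_continuous)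
  have km: "(\<lambda>y. k (x - y)) \<in> borel_measurable lebesgue" for x
    by (intro measurable_lebesgue_if_borel borel_measurable_continuous_onI continuous_on_compose2[OF kc] continuous_intros) auto
  have i0: "integrable lebesgue (\<lambda>y. indicat_real A y *\<^sub>R k (x - y))" for x
    by (rule integrable_indicator_bounded[OF A km B0])
  have i1: "integrable lebesgue (\<lambda>y. indicat_real A y *\<^sub>R k' (x - y) h)" for h x
    by (rule integrable_indicator_bounded[OF A k'm B])
  have lin: "bounded_linear (k' z)" for z using der by (rule has_derivative_bounded_linear)
  have B_nonneg: "B \<ge> 0"
    using B[of 0 "axis 1 1"] by (simp add: norm_axis_1) (smt (verit) norm_ge_zero)
  have lip: "norm (k z - k z') \<le> B * norm (z - z')" for z z'
    using differentiable_bound[OF convex_UNIV, of k k' B z z'] der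
    by (auto intro!: onorm_le B)
  let ?D = "\<lambda>h. LINT y|lebesgue. indicat_real A y *\<^sub>R k' (x - y) h"
  have bl: "bounded_linear ?D"
  proof (rule bounded_linear_intro)
    show "?D (h1 + h2) = ?D h1 + ?D h2" for h1 h2
      by (subst Bochner_Integration.integral_add[symmetric, OF i1 i1])
        (simp add: linear_simps(1)[OF lin] scaleR_add_right)
    show "?D (r *\<^sub>R h) = r *\<^sub>R ?D h" for r h
      by (subst integral_scaleR_right[symmetric]) (simp add: linear_simps(5)[OF lin] mult.commute)
    show "norm (?D h) \<le> norm h * (area A * B)" for h
    proof -
      have "norm (?D h) \<le> (LINT y|lebesgue. indicat_real A y * (B * norm h))"
        using A B_nonneg by (intro Bochner_Integration.integral_norm_bound_integral i1 integrable_mult_left integrable_indicator_lmeasurable)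
          (auto simp: indicator_def B)
      then show ?thesis by (simp add: mult_ac)
    qed
  qed
  have "((\<lambda>y. ((LINT z|lebesgue. indicat_real A z *\<^sub>R k (y - z)) - (LINT z|lebesgue. indicat_real A z *\<^sub>R k (x - z)) - ?D (y - x)) /\<^sub>R norm (y - x)) \<longlongrightarrow> 0) (at x)"
    unfolding tendsto_at_iff_sequentially
  proof (intro allI impI)
    fix X :: "nat \<Rightarrow> real^2" assume X: "\<forall>i. X i \<in> UNIV - {x}" "X \<longlonglongrightarrow> x"
    let ?g = "\<lambda>i z. indicat_real A z *\<^sub>R ((k (X i - z) - k (x - z) - k' (x - z) (X i - x)) /\<^sub>R norm (X i - x))"
    have "(\<lambda>i. LINT z|lebesgue. ?g i z) \<longlonglongrightarrow> integral\<^sup>L lebesgue (\<lambda>z::real^2. (0::real^2))"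
    proof (rule Bochner_Integration.integral_dominated_convergence[where w = "\<lambda>z. indicat_real A z * (2 * B)" and s = ?g and f = "\<lambda>z. 0"])
      show "integrable lebesgue (\<lambda>z. indicat_real A z * (2 * B))"
        using A by (intro integrable_mult_left integrable_indicator_lmeasurable)
      show "(\<lambda>z. ?g i z) \<in> borel_measurable lebesgue" for i
        using A by (intro borel_measurable_scaleR borel_measurable_indicator borel_measurable_diff km k'm borel_measurable_const)
          (auto dest: fmeasurableD)
      show "AE z in lebesgue. (\<lambda>i. ?g i z) \<longlonglongrightarrow> 0"
      proof (rule AE_I2)
        fix z
        have "((\<lambda>w. k (w - z)) has_derivative k' (x - z)) (at x)"
          by (rule has_derivative_compose[of "\<lambda>w. w - z" "\<lambda>h. h" x UNIV k, OF _ der[of "x - z"]])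
            (auto intro!: derivative_eq_intros)
        then have "((\<lambda>w. (k (w - z) - k (x - z) - k' (x - z) (w - x)) /\<^sub>R norm (w - x)) \<longlongrightarrow> 0) (at x)"
          by (simp add: has_derivative_def Lim_ident_at)
        then have "(\<lambda>i. (k (X i - z) - k (x - z) - k' (x - z) (X i - x)) /\<^sub>R norm (X i - x)) \<longlonglongrightarrow> 0"
          using X unfolding tendsto_at_iff_sequentially comp_def by blast
        from tendsto_scaleR[OF tendsto_const this, of "indicat_real A z"]
        show "(\<lambda>i. ?g i z) \<longlonglongrightarrow> 0" by (simp only: scaleR_zero_right)
      qed
      show "AE z in lebesgue. norm (?g i z) \<le> indicat_real A z * (2 * B)" for i
      proof (rule AE_I2)
        fix z
        have pos: "norm (X i - x) > 0" using X(1) by auto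
        have "norm (k (X i - z) - k (x - z) - k' (x - z) (X i - x)) \<le> B * norm (X i - x) + B * norm (X i - x)"
          using lip[of "X i - z" "x - z"] B[of "x - z" "X i - x"]
          by (intro order_trans[OF norm_triangle_ineq4[of "k (X i - z) - k (x - z)"]] add_mono) auto
        then have "norm ((k (X i - z) - k (x - z) - k' (x - z) (X i - x)) /\<^sub>R norm (X i - x)) \<le> 2 * B"
          using pos by (simp only: norm_scaleR) (simp add: field_simps)
        then show "norm (?g i z) \<le> indicat_real A z * (2 * B)" by (simp add: indicator_def)
      qed
    qed auto
    moreover have "(LINT z|lebesgue. ?g i z) = ((LINT z|lebesgue. indicat_real A z *\<^sub>R k (X i - z)) - (LINT z|lebesgue. indicat_real A z *\<^sub>R k (x - z)) - ?D (X i - x)) /\<^sub>R norm (X i - x)" for i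
    proof -
      have "(LINT z|lebesgue. ?g i z) = (LINT z|lebesgue. inverse (norm (X i - x)) *\<^sub>R (indicat_real A z *\<^sub>R k (X i - z) - indicat_real A z *\<^sub>R k (x - z) - indicat_real A z *\<^sub>R k' (x - z) (X i - x)))"
        by (intro Bochner_Integration.integral_cong) (auto simp: algebra_simps)
      also have "\<dots> = inverse (norm (X i - x)) *\<^sub>R ((LINT z|lebesgue. indicat_real A z *\<^sub>R k (X i - z)) - (LINT z|lebesgue. indicat_real A z *\<^sub>R k (x - z)) - ?D (X i - x))"
        by (simp only: integral_scaleR_right Bochner_Integration.integral_diff[OF Bochner_Integration.integrable_diff[OF i0 i0] i1] Bochner_Integration.integral_diff[OF i0 i0])
      finally show ?thesis .
    qed
    ultimately show "((\<lambda>y. ((LINT z|lebesgue. indicat_real A z *\<^sub>R k (y - z)) - (LINT z|lebesgue. indicat_real A z *\<^sub>R k (x - z)) - ?D (y - x)) /\<^sub>R norm (y - x)) \<circ> X) \<longlonglongrightarrow> 0"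
      by (simp add: comp_def)
  qed
  then show ?thesis using bl unfolding has_derivative_def by (simp add: Lim_ident_at)
qed

definition reg_velocity :: "real \<Rightarrow> (real^2) set \<Rightarrow> real^2 \<Rightarrow> real^2" where
  "reg_velocity e A x = (LINT y|lebesgue. indicat_real A y *\<^sub>R reg_kernel e (x - y))"

definition reg_velocity_deriv :: "real \<Rightarrow> (real^2) set \<Rightarrow> real^2 \<Rightarrow> real^2 \<Rightarrow> real^2" where
  "reg_velocity_deriv e A x h = (LINT y|lebesgue. indicat_real A y *\<^sub>R reg_kernel_deriv e (x - y) h)"

lemma reg_velocity_has_derivative:
  assumes "e > 0" "A \<in> lmeasurable"
  shows "(reg_velocity e A has_derivative reg_velocity_deriv e A x) (at x)"
  using convolution_has_derivative[OF assms(2) reg_kernel_has_derivative[OF assms(1)]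
      continuous_on_reg_kernel_deriv[OF assms(1)] norm_reg_kernel_deriv_le_const[OF assms(1)] norm_reg_kernel_le[OF assms(1)]]
  unfolding reg_velocity_def[abs_def] reg_velocity_deriv_def[abs_def] .

lemma measurable_reg_kernel_deriv:
  assumes "e > 0" shows "(\<lambda>y. reg_kernel_deriv e (x - y) h) \<in> borel_measurable lebesgue"
  by (intro measurable_lebesgue_if_borel borel_measurable_continuous_onI
      continuous_on_compose2[OF continuous_on_reg_kernel_deriv[OF assms]] continuous_intros) auto

lemma measurable_reg_kernel:
  "(\<lambda>y. reg_kernel e (x - y)) \<in> borel_measurable lebesgue"
  unfolding reg_kernel_def by (intro measurable_lebesgue_if_borel) measurable

lemma integrable_reg_kernel_deriv:
  assumes "e > 0" "A \<in> lmeasurable"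
  shows "integrable lebesgue (\<lambda>y. indicat_real A y *\<^sub>R reg_kernel_deriv e (x - y) h)"
  by (rule integrable_indicator_bounded[OF assms(2) measurable_reg_kernel_deriv[OF assms(1)]
      norm_reg_kernel_deriv_le_const[OF assms(1)]])

lemma integrable_reg_kernel:
  assumes "e > 0" "A \<in> lmeasurable"
  shows "integrable lebesgue (\<lambda>y. indicat_real A y *\<^sub>R reg_kernel e (x - y))"
  by (rule integrable_indicator_bounded[OF assms(2) measurable_reg_kernel norm_reg_kernel_le[OF assms(1)]])

lemma reg_velocity_deriv_trace:
  assumes "e > 0" "A \<in> lmeasurable"
  shows "reg_velocity_deriv e A x (axis 1 1) $ 1 + reg_velocity_deriv e A x (axis 2 1) $ 2 = 0"
proof -
  have comp: "(LINT y|lebesgue. f y) $ i = (LINT y|lebesgue. f y $ i)" and comp': "integrable lebesgue (\<lambda>y. f y $ i)"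
    if "integrable lebesgue f" for f :: "real^2 \<Rightarrow> real^2" and i
    using integral_bounded_linear[OF bounded_linear_vec_nth that, of i]
      integrable_bounded_linear[OF bounded_linear_vec_nth that, of i] by simp_all
  note I = integrable_reg_kernel_deriv[OF assms]
  have "reg_velocity_deriv e A x (axis 1 1) $ 1 + reg_velocity_deriv e A x (axis 2 1) $ 2 =
     (LINT y|lebesgue. (indicat_real A y *\<^sub>R reg_kernel_deriv e (x - y) (axis 1 1)) $ 1
        + (indicat_real A y *\<^sub>R reg_kernel_deriv e (x - y) (axis 2 1)) $ 2)"
    unfolding reg_velocity_deriv_def comp[OF I]
    by (rule Bochner_Integration.integral_add[symmetric]; rule comp'[OF I])
  also have "\<dots> = (LINT y|lebesgue. indicat_real A y *
      (reg_kernel_deriv e (x - y) (axis 1 1) $ 1 + reg_kernel_deriv e (x - y) (axis 2 1) $ 2))"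
    by (simp add: algebra_simps)
  finally show ?thesis by (simp add: reg_kernel_deriv_trace)
qed

text \<open>At scale \<open>2 ^ (-p)\<close> the Lipschitz constant grows only linearly in \<open>p\<close>.  This is the discrete form
  of the log-Lipschitz bound for the velocity, and it is the reason why the Euler scheme converges.\<close>

lemma norm_reg_velocity_deriv_le:
  assumes A: "A \<in> lmeasurable"
  shows "norm (reg_velocity_deriv (1 / 2 ^ p) A x h) \<le> (area A + 4 * pi * (p + 1)) * norm h"
proof -
  let ?e = "1 / 2 ^ p :: real"
  have e: "?e > 0" by simp
  have "norm (reg_velocity_deriv ?e A x h) \<le> (LINT y|lebesgue. norm h * (indicat_real A y * (1 / ((norm (x - y))\<^sup>2 + ?e\<^sup>2))))"
    unfolding reg_velocity_deriv_def
  proof (intro Bochner_Integration.integral_norm_bound_integral integrable_reg_kernel_deriv e A integrable_mult_right log_kernel_integral(1))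
    fix y
    have "norm (reg_kernel_deriv ?e (x - y) h) \<le> 3 / (2 * pi) * (1 / ((norm (x - y))\<^sup>2 + ?e\<^sup>2)) * norm h"
      by (rule norm_reg_kernel_deriv_le[OF e])
    also have "\<dots> \<le> 1 * (1 / ((norm (x - y))\<^sup>2 + ?e\<^sup>2)) * norm h"
      by (intro mult_right_mono) (use pi_ge_two in simp_all)
    finally show "norm (indicat_real A y *\<^sub>R reg_kernel_deriv ?e (x - y) h) \<le> norm h * (indicat_real A y * (1 / ((norm (x - y))\<^sup>2 + ?e\<^sup>2)))"
      by (simp add: indicator_def)
  qed
  also have "\<dots> \<le> norm h * (area A + 4 * pi * (p + 1))"
    by (simp only: integral_mult_right_zero) (intro mult_left_mono log_kernel_integral(2) A norm_ge_zero)
  finally show ?thesis by (simp add: mult.commute)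
qed

lemma reg_velocity_lipschitz:
  assumes A: "A \<in> lmeasurable"
  shows "norm (reg_velocity (1 / 2 ^ p) A x - reg_velocity (1 / 2 ^ p) A y) \<le> (area A + 4 * pi * (p + 1)) * norm (x - y)"
proof (rule differentiable_bound[OF convex_UNIV reg_velocity_has_derivative[OF _ A]])
  show "onorm (reg_velocity_deriv (1 / 2 ^ p) A z) \<le> area A + 4 * pi * (p + 1)" for z
    by (rule onorm_le) (rule norm_reg_velocity_deriv_le[OF A])
qed auto

lemma norm_reg_velocity_le:
  assumes "e > 0" "A \<in> lmeasurable"
  shows "norm (reg_velocity e A x) \<le> area A / e"
proof -
  have "norm (reg_velocity e A x) \<le> (LINT y|lebesgue. indicat_real A y * (1 / e))"
    unfolding reg_velocity_def
    by (intro Bochner_Integration.integral_norm_bound_integral integrable_reg_kernel integrable_mult_left integrable_indicator_lmeasurable assms)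
      (auto simp: indicator_def intro: order_trans[OF norm_reg_kernel_le] simp: assms)
  then show ?thesis by simp
qed

text \<open>The bound is uniform in \<open>x\<close>: the disc of radius \<open>sqrt e\<close> around \<open>x\<close> contributes a multiple of
  \<open>sqrt e\<close> as a set of area \<open>pi * e\<close>, and the rest of \<open>A\<close> contributes its area times \<open>sqrt e\<close>.\<close>

lemma biot_savart_diff_reg_velocity:
  assumes e: "e > 0" and A: "A \<in> lmeasurable"
  shows "norm (biot_savart (indicat_real A) x - reg_velocity e A x) \<le> (6 + area A) * sqrt e"
proof -
  let ?b = "ball x (sqrt e)"
  let ?w = "\<lambda>y. indicat_real ?b y * (1 / norm (x - y)) + indicat_real A y * sqrt e"
  have i: "integrable lebesgue (\<lambda>y. indicat_real A y *\<^sub>R (biot_savart_kernel (x - y) - reg_kernel e (x - y)))"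
    using Bochner_Integration.integrable_diff[OF integrable_kernel[OF A] integrable_reg_kernel[OF e A]] by (simp add: algebra_simps)
  have j: "integrable lebesgue ?w"
    by (intro Bochner_Integration.integrable_add inverse_dist_integrable integrable_mult_left integrable_indicator_lmeasurable A lmeasurable_ball)
  have "biot_savart (indicat_real A) x - reg_velocity e A x =
     (LINT y|lebesgue. indicat_real A y *\<^sub>R (biot_savart_kernel (x - y) - reg_kernel e (x - y)))"
    unfolding biot_savart_def reg_velocity_def
    by (subst Bochner_Integration.integral_diff[symmetric]) (auto intro!: integrable_kernel integrable_reg_kernel e A simp: algebra_simps)
  then have "2 * pi * norm (biot_savart (indicat_real A) x - reg_velocity e A x) =
     norm (LINT y|lebesgue. (2 * pi) *\<^sub>R (indicat_real A y *\<^sub>R (biot_savart_kernel (x - y) - reg_kernel e (x - y))))"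
    by (subst integral_scaleR_right) simp
  also have "\<dots> \<le> (LINT y|lebesgue. ?w y)"
  proof (intro Bochner_Integration.integral_norm_bound_integral integrable_scaleR_right i j)
    fix y
    have "indicat_real (ball 0 (sqrt e)) (x - y) = indicat_real ?b y"
      by (simp add: indicator_def dist_norm norm_minus_commute)
    then show "norm ((2 * pi) *\<^sub>R (indicat_real A y *\<^sub>R (biot_savart_kernel (x - y) - reg_kernel e (x - y)))) \<le> ?w y"
      using norm_diff_reg_kernel_le[OF e, of "x - y"] by (cases "y \<in> A") auto
  qed
  also have "\<dots> = (LINT y|lebesgue. indicat_real ?b y * (1 / norm (x - y))) + area A * sqrt e"
    by (subst Bochner_Integration.integral_add)
      (auto intro!: inverse_dist_integrable(1)[simplified] integrable_indicator_lmeasurable A)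
  also have "\<dots> \<le> (1 + 4 * pi) * sqrt (pi * e) + area A * sqrt e"
    using inverse_dist_integrable(2)[of ?b x] e measure_ball_plane[of "sqrt e" x] by simp
  also have "(1 + 4 * pi) * sqrt (pi * e) \<le> (6 * pi) * (2 * sqrt e)"
  proof (intro mult_mono)
    have "sqrt (pi * e) \<le> sqrt (4 * e)" using e pi_less_4 by (intro real_sqrt_le_mono mult_right_mono) auto
    then show "sqrt (pi * e) \<le> 2 * sqrt e" by (simp add: real_sqrt_mult)
  qed (use pi_ge_two e in auto)
  also have "6 * pi * (2 * sqrt e) + area A * sqrt e \<le> 2 * pi * ((6 + area A) * sqrt e)"
  proof -
    have "1 * (area A * sqrt e) \<le> (2 * pi) * (area A * sqrt e)"
      using pi_ge_two e by (intro mult_right_mono) auto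
    then show ?thesis by (simp add: algebra_simps)
  qed
  finally show ?thesis by (simp add: mult_le_cancel_left)
qed

text \<open>An explicit Euler step for a divergence-free field preserves area up to second order in the
  step: the trace term of the Jacobian determinant vanishes.\<close>

lemma measure_vimage_euler_step:
  fixes v :: "real^2 \<Rightarrow> real^2"
  assumes der: "\<And>x. (v has_derivative v' x) (at x)"
    and L: "\<And>x h. norm (v' x h) \<le> L * norm h"
    and trace: "\<And>x. v' x (axis 1 1) $ 1 + v' x (axis 2 1) $ 2 = 0"
    and M: "\<And>x. norm (v x) \<le> M"
    and \<eta>: "0 \<le> \<eta>" "\<eta> * L \<le> 1 / 2"
    and U: "open U" "bounded U"
  defines "E \<equiv> \<lambda>x. x + \<eta> *\<^sub>R v x"
  shows "open (E -` U)" "bounded (E -` U)"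
    and "(1 - 2 * (\<eta> * L)\<^sup>2) * area (E -` U) \<le> area U"
proof -
  define S where "S = E -` U"
  define E' where "E' x h = h + \<eta> *\<^sub>R v' x h" for x h
  have L0: "L \<ge> 0" using L[of 0 "axis 1 1"] by (simp add: norm_axis_1) (smt (verit) norm_ge_zero)
  have derE: "(E has_derivative E' x) (at x)" for x
    unfolding E_def E'_def by (intro derivative_intros der)
  have "continuous_on UNIV E"
    using derE by (meson continuous_at_imp_continuous_on has_derivative_continuous)
  then show "open (E -` U)" using U(1) by (simp add: continuous_on_open_vimage)
  then have oS: "open S" by (simp add: S_def)
  obtain r where r: "\<And>x. x \<in> U \<Longrightarrow> norm x \<le> r" using U(2) by (auto simp: bounded_iff)
  show "bounded (E -` U)"
    unfolding bounded_iff
  proof (intro exI ballI)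
    fix x assume "x \<in> E -` U"
    then have "norm (E x) \<le> r" using r by auto
    moreover have "norm x \<le> norm (E x) + norm (\<eta> *\<^sub>R v x)"
      using norm_triangle_ineq4[of "E x" "\<eta> *\<^sub>R v x"] by (simp add: E_def)
    moreover have "norm (\<eta> *\<^sub>R v x) \<le> \<eta> * M" using \<eta> M by (simp add: mult_left_mono)
    ultimately show "norm x \<le> r + \<eta> * M" by linarith
  qed
  then have lS: "S \<in> lmeasurable" using oS by (simp add: S_def lmeasurable_open)
  have lU: "U \<in> lmeasurable" using U by (simp add: lmeasurable_open)
  have lip: "norm (v x - v y) \<le> L * norm (x - y)" for x y
    using differentiable_bound[OF convex_UNIV, of v v' L x y] der by (auto intro!: onorm_le L)
  have inj: "inj_on E S"
  proof (rule inj_onI)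
    fix x y assume "E x = E y"
    then have "x - y = \<eta> *\<^sub>R (v y - v x)" by (simp add: E_def algebra_simps)
    then have "norm (x - y) = \<eta> * norm (v y - v x)" using \<eta> by simp
    also have "\<dots> \<le> \<eta> * (L * norm (y - x))" using \<eta> lip by (intro mult_left_mono) auto
    also have "\<dots> \<le> 1 / 2 * norm (x - y)"
      using \<eta>(2) mult_right_mono[of "\<eta> * L" "1/2" "norm (x - y)"] by (simp add: norm_minus_commute)
    finally show "x = y" by simp
  qed
  \<comment> \<open>\<open>det (I + \<eta> A) = 1 + \<eta> trace A + \<eta>^2 det A\<close> for two by two matrices.\<close>
  have detlow: "1 - 2 * (\<eta> * L)\<^sup>2 \<le> \<bar>det (matrix (E' x))\<bar>" and detup: "\<bar>det (matrix (E' x))\<bar> \<le> 1 + 2 * (\<eta> * L)\<^sup>2" for x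
  proof -
    define a b c d where "a = v' x (axis 1 1) $ 1" "b = v' x (axis 2 1) $ 1"
      "c = v' x (axis 1 1) $ 2" "d = v' x (axis 2 1) $ 2"
    have le: "\<bar>v' x (axis j 1) $ i\<bar> \<le> L" for i j
      using component_le_norm_cart[of "v' x (axis j 1)" i] L[of x "axis j 1"] by (simp add: norm_axis_1)
    have ad: "a + d = 0" using trace[of x] by (simp add: a_b_c_d_def)
    have "det (matrix (E' x)) = (1 + \<eta> * a) * (1 + \<eta> * d) - (\<eta> * b) * (\<eta> * c)"
      by (simp add: det_2 matrix_def E'_def a_b_c_d_def axis_def)
    also have "\<dots> = 1 + \<eta> * (a + d) + \<eta>\<^sup>2 * (a * d - b * c)" by algebra
    finally have "det (matrix (E' x)) = 1 + \<eta>\<^sup>2 * (a * d - b * c)" by (simp add: ad)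
    moreover have "\<bar>\<eta>\<^sup>2 * (a * d - b * c)\<bar> \<le> 2 * (\<eta> * L)\<^sup>2"
    proof -
      have "\<bar>a * d\<bar> \<le> L * L" "\<bar>b * c\<bar> \<le> L * L"
        unfolding abs_mult a_b_c_d_def by (intro mult_mono le abs_ge_zero L0)+
      then have "\<bar>a * d - b * c\<bar> \<le> 2 * L\<^sup>2" by (simp add: power2_eq_square)
      then have "\<eta>\<^sup>2 * \<bar>a * d - b * c\<bar> \<le> \<eta>\<^sup>2 * (2 * L\<^sup>2)" by (intro mult_left_mono) auto
      then show ?thesis by (simp add: abs_mult power_mult_distrib)
    qed
    ultimately show "1 - 2 * (\<eta> * L)\<^sup>2 \<le> \<bar>det (matrix (E' x))\<bar>" "\<bar>det (matrix (E' x))\<bar> \<le> 1 + 2 * (\<eta> * L)\<^sup>2" by linarith+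
  qed
  have dw: "(E has_derivative E' x) (at x within S)" for x by (rule has_derivative_at_withinI[OF derE])
  have sS: "S \<in> sets lebesgue" using lS by (rule fmeasurableD)
  have int: "(\<lambda>x. \<bar>det (matrix (E' x))\<bar>) integrable_on S"
  proof (rule measurable_bounded_by_integrable_imp_integrable[where g = "\<lambda>_. 1 + 2 * (\<eta> * L)\<^sup>2"])
    show "(\<lambda>x. \<bar>det (matrix (E' x))\<bar>) \<in> borel_measurable (lebesgue_on S)"
      using borel_measurable_det_Jacobian[OF sS dw] by measurable
    show "(\<lambda>_. 1 + 2 * (\<eta> * L)\<^sup>2) integrable_on S" using lS by (intro integrable_on_const)
  qed (use detup sS in auto)
  have "(1 - 2 * (\<eta> * L)\<^sup>2) * area S = integral S (\<lambda>_. 1 - 2 * (\<eta> * L)\<^sup>2)"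
    using lS by (simp add: lmeasure_integral integral_mult_right[symmetric] del: integral_mult_right)
  also have "\<dots> \<le> integral S (\<lambda>x. \<bar>det (matrix (E' x))\<bar>)"
    using lS by (intro integral_le int integrable_on_const detlow)
  also have "\<dots> = area (E ` S)"
    using measure_differentiable_image_eq[OF sS dw inj int] by simp
  also have "\<dots> \<le> area U"
  proof (rule measure_mono_fmeasurable[OF _ _ lU])
    show "E ` S \<subseteq> U" by (auto simp: S_def)
    show "E ` S \<in> sets lebesgue"
      using measurable_differentiable_image_eq[OF sS dw inj] int by (auto dest: fmeasurableD)
  qed
  finally show "(1 - 2 * (\<eta> * L)\<^sup>2) * area (E -` U) \<le> area U" by (simp add: S_def)
qed

section \<open>The velocity of the unit disc\<close>

text \<open>In complex notation the Biot-Savart kernel is, up to a constant and a conjugation, the Cauchy kernel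
  \<open>1 / (X - Y)\<close>.  Its integral over the disc is found by splitting the disc at the circle through
  \<open>x\<close>.  On each side the kernel has a geometric expansion, and rotations make the integrals of
  nonzero powers of \<open>Y\<close> vanish.\<close>

definition plane_complex :: "real^2 \<Rightarrow> complex" where
  "plane_complex y = Complex (y $ 1) (y $ 2)"

definition rot :: "real \<Rightarrow> real^2 \<Rightarrow> real^2" where
  "rot \<theta> y = vector [cos \<theta> * y $ 1 - sin \<theta> * y $ 2, sin \<theta> * y $ 1 + cos \<theta> * y $ 2]"

lemma norm_plane_complex [simp]: "norm (plane_complex y) = norm y"
  by (simp add: plane_complex_def norm_eq_sqrt_inner[of y] inner_vec_def UNIV_2 cmod_def power2_eq_square)

lemma plane_complex_eq_iff [simp]: "plane_complex x = plane_complex y \<longleftrightarrow> x = y"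
  by (simp add: plane_complex_def vec_eq_iff forall_2)

lemma plane_complex_diff: "plane_complex (x - y) = plane_complex x - plane_complex y"
  by (simp add: plane_complex_def complex_eq_iff)

lemma plane_complex_rot: "plane_complex (rot \<theta> y) = cis \<theta> * plane_complex y"
  by (simp add: plane_complex_def rot_def complex_eq_iff)

lemma measurable_plane_complex [measurable]: "plane_complex \<in> borel_measurable borel"
proof -
  have "bounded_linear plane_complex"
    by (rule bounded_linear_intro[of _ 1]) (auto simp: plane_complex_def complex_eq_iff cmod_def
       norm_eq_sqrt_inner inner_vec_def UNIV_2 power2_eq_square)
  then show ?thesis by (intro borel_measurable_continuous_onI linear_continuous_on)
qed

lemma norm_rot [simp]: "norm (rot \<theta> y) = norm y"
  using norm_plane_complex[of "rot \<theta> y"] by (simp add: plane_complex_rot norm_mult)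

lemma rot_rot: "rot a (rot b y) = rot (a + b) y"
  using plane_complex_eq_iff[of "rot a (rot b y)" "rot (a + b) y"]
  by (simp add: plane_complex_rot cis_mult mult.assoc[symmetric])

lemma rot_0 [simp]: "rot 0 y = y"
  using plane_complex_eq_iff[of "rot 0 y" y] by (simp add: plane_complex_rot)

lemma linear_rot: "linear (rot \<theta>)"
  by (rule linearI) (simp_all add: rot_def vec_eq_iff forall_2 algebra_simps)

lemma measurable_rot [measurable]: "rot \<theta> \<in> borel_measurable borel"
  by (intro borel_measurable_continuous_onI linear_continuous_on linear_conv_bounded_linear[THEN iffD1] linear_rot)

text \<open>By the characterisation of Lebesgue measure through boxes it is enough to know the measure of
  rotated boxes.\<close>

lemma lborel_distr_rot: "distr lborel borel (rot \<theta>) = lborel"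
proof (rule lborel_eqI[symmetric])
  fix l u :: "real^2" assume le: "\<And>b. b \<in> Basis \<Longrightarrow> l \<bullet> b \<le> u \<bullet> b"
  have eq: "rot \<theta> -` box l u = rot (- \<theta>) ` box l u"
  proof (intro equalityI subsetI)
    fix y assume "y \<in> rot \<theta> -` box l u"
    then show "y \<in> rot (- \<theta>) ` box l u"
      by (intro image_eqI[of _ _ "rot \<theta> y"]) (auto simp: rot_rot)
  qed (auto simp: rot_rot)
  have o: "orthogonal_transformation (rot (- \<theta>))"
    by (simp add: orthogonal_transformation linear_rot)
  have b: "box l u \<in> lmeasurable" by (rule lmeasurable_box)
  have bs: "rot \<theta> -` box l u \<in> sets borel"
    using measurable_sets[OF measurable_rot, of "box l u" \<theta>] by simp
  have "emeasure (distr lborel borel (rot \<theta>)) (box l u) = emeasure lborel (rot \<theta> -` box l u)"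
    by (subst emeasure_distr) (auto simp: measurable_distr_eq1)
  also have "\<dots> = emeasure lebesgue (rot (- \<theta>) ` box l u)"
    unfolding eq[symmetric] by (simp add: bs)
  also have "\<dots> = ennreal (area (rot (- \<theta>) ` box l u))"
    using measurable_orthogonal_image[OF o b] by (rule emeasure_eq_measure2)
  also have "\<dots> = ennreal (area (box l u))"
    by (simp only: measure_orthogonal_image[OF o b])
  also have "\<dots> = emeasure lebesgue (box l u)" by (rule emeasure_eq_measure2[OF b, symmetric])
  also have "\<dots> = emeasure lborel (box l u)" by simp
  also have "\<dots> = ennreal (prod ((\<bullet>) (u - l)) Basis)" by (rule emeasure_lborel_box[OF le])
  finally show "emeasure (distr lborel borel (rot \<theta>)) (box l u) = ennreal (prod ((\<bullet>) (u - l)) Basis)" .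
qed simp

lemma integral_rot:
  fixes f :: "real^2 \<Rightarrow> complex"
  assumes [measurable]: "f \<in> borel_measurable borel"
  shows "(LINT y|lebesgue. f (rot \<theta> y)) = (LINT y|lebesgue. f y)"
proof -
  have "(LINT y|lebesgue. f (rot \<theta> y)) = (LINT y|lborel. f (rot \<theta> y))"
    by (intro integral_completion) simp
  also have "\<dots> = (LINT y|distr lborel borel (rot \<theta>). f y)"
    by (subst integral_distr) simp_all
  also have "\<dots> = (LINT y|lebesgue. f y)"
    unfolding lborel_distr_rot by (rule integral_completion[symmetric]) simp
  finally show ?thesis .
qed

lemma integral_rot_zero:
  fixes f :: "real^2 \<Rightarrow> complex"
  assumes f: "f \<in> borel_measurable borel" and eq: "\<And>y. f (rot \<theta> y) = - f y"
  shows "(LINT y|lebesgue. f y) = 0"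
proof -
  have "(LINT y|lebesgue. f y) = - (LINT y|lebesgue. f y)"
    using integral_rot[OF f, of \<theta>] by (simp add: eq)
  then show ?thesis by simp
qed

lemma cis_pi_div_power: "n \<ge> 1 \<Longrightarrow> cis (pi / real n) ^ n = -1"
proof -
  assume "n \<ge> 1"
  then have "real n * (pi / real n) = pi" by simp
  then have "cis (pi / real n) ^ n = cis pi" by (simp only: Complex.DeMoivre)
  also have "cis pi = -1" by (simp add: complex_eq_iff)
  finally show "cis (pi / real n) ^ n = -1" .
qed

text \<open>Rotation by the angle \<open>pi / n\<close> changes the sign of the \<open>n\<close>-th power.\<close>

lemma integral_power_zero:
  assumes [measurable]: "B \<in> sets borel" and inv: "\<And>\<theta> y. rot \<theta> y \<in> B \<longleftrightarrow> y \<in> B" and n: "n \<ge> 1"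
  shows "(LINT y|lebesgue. indicat_real B y *\<^sub>R plane_complex y ^ n) = 0"
    and "(LINT y|lebesgue. indicat_real B y *\<^sub>R (1 / plane_complex y ^ n)) = 0"
proof -
  have c: "plane_complex (rot (pi / real n) y) ^ n = - (plane_complex y ^ n)" for y
    using cis_pi_div_power[OF n] by (simp add: plane_complex_rot power_mult_distrib)
  have i: "indicat_real B (rot \<theta> y) = indicat_real B y" for \<theta> y by (simp add: indicator_def inv)
  show "(LINT y|lebesgue. indicat_real B y *\<^sub>R plane_complex y ^ n) = 0"
    by (rule integral_rot_zero[of _ "pi / real n"]) (measurable, simp add: c i)
  show "(LINT y|lebesgue. indicat_real B y *\<^sub>R (1 / plane_complex y ^ n)) = 0"
    by (rule integral_rot_zero[of _ "pi / real n"]) (measurable, simp add: c i)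
qed

lemma cauchy_kernel_integrable:
  assumes A: "A \<in> lmeasurable"
  shows "integrable lebesgue (\<lambda>y. indicat_real A y *\<^sub>R (1 / (plane_complex x - plane_complex y)))"
proof (rule kernel_dominated_integral(1)[OF A, where x = x])
  have "(\<lambda>y. 1 / (plane_complex x - plane_complex y)) \<in> borel_measurable lebesgue"
    by (intro measurable_lebesgue_if_borel) measurable
  then show "(\<lambda>y. indicat_real A y *\<^sub>R (1 / (plane_complex x - plane_complex y))) \<in> borel_measurable lebesgue"
    using A by (intro borel_measurable_scaleR borel_measurable_indicator) (auto dest: fmeasurableD)
qed (simp add: plane_complex_diff[symmetric] norm_divide)

text \<open>A finite geometric sum with its remainder.  The remainder is kept, instead of passing to the series,
  because it is dominated by the integrable function \<open>1 / |X - Y|\<close> up to the circle \<open>|Y| = |X|\<close>,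
  where the series does not converge.\<close>

lemma geometric_remainder:
  fixes X Y :: complex
  assumes "X \<noteq> 0" "X \<noteq> Y"
  shows "1 / (X - Y) = (\<Sum>n<m. (1 / X ^ Suc n) * Y ^ n) + (Y / X) ^ m * (1 / (X - Y))"
proof (induction m)
  case (Suc m)
  have "1 / (X - Y) = 1 / X + (Y / X) * (1 / (X - Y))" using assms by (simp add: field_simps)
  then have "(Y / X) ^ m * (1 / (X - Y)) = (Y / X) ^ m * (1 / X) + (Y / X) ^ m * ((Y / X) * (1 / (X - Y)))"
    by (metis distrib_left)
  also have "(Y / X) ^ m * (1 / X) = (1 / X ^ Suc m) * Y ^ m" by (simp add: power_divide)
  also have "(Y / X) ^ m * ((Y / X) * (1 / (X - Y))) = (Y / X) ^ Suc m * (1 / (X - Y))" by (simp add: mult_ac)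
  finally have step: "(Y / X) ^ m * (1 / (X - Y)) = (1 / X ^ Suc m) * Y ^ m + (Y / X) ^ Suc m * (1 / (X - Y))" .
  have "1 / (X - Y) = (\<Sum>n<m. (1 / X ^ Suc n) * Y ^ n) + (Y / X) ^ m * (1 / (X - Y))" by (rule Suc.IH)
  also have "\<dots> = (\<Sum>n<Suc m. (1 / X ^ Suc n) * Y ^ n) + (Y / X) ^ Suc m * (1 / (X - Y))"
    by (simp only: step sum.lessThan_Suc add.assoc)
  finally show ?case .
qed simp

lemma remainder_tendsto:
  fixes q :: "real^2 \<Rightarrow> complex"
  assumes A: "A \<in> lmeasurable"
    and q: "q \<in> borel_measurable borel" "\<And>y. y \<in> A \<Longrightarrow> norm (q y) < 1"
  shows "(\<lambda>m. LINT y|lebesgue. indicat_real A y *\<^sub>R (q y ^ m * (1 / (plane_complex x - plane_complex y)))) \<longlonglongrightarrow> 0"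
proof -
  note q(1) [measurable]
  have "(\<lambda>m. LINT y|lebesgue. indicat_real A y *\<^sub>R (q y ^ m * (1 / (plane_complex x - plane_complex y)))) \<longlonglongrightarrow>
     integral\<^sup>L lebesgue (\<lambda>y::real^2. (0::complex))"
  proof (rule Bochner_Integration.integral_dominated_convergence[where w = "\<lambda>y. indicat_real A y * (1 / norm (x - y))"])
    show "(\<lambda>y. indicat_real A y *\<^sub>R (q y ^ m * (1 / (plane_complex x - plane_complex y)))) \<in> borel_measurable lebesgue" for m
    proof -
      have "(\<lambda>y. q y ^ m * (1 / (plane_complex x - plane_complex y))) \<in> borel_measurable lebesgue"
        by (intro measurable_lebesgue_if_borel) measurable
      then show ?thesis
        using A by (intro borel_measurable_scaleR borel_measurable_indicator) (auto dest: fmeasurableD)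
    qed
    show "AE y in lebesgue. (\<lambda>m. indicat_real A y *\<^sub>R (q y ^ m * (1 / (plane_complex x - plane_complex y)))) \<longlonglongrightarrow> 0"
    proof (rule AE_I2)
      fix y
      show "(\<lambda>m. indicat_real A y *\<^sub>R (q y ^ m * (1 / (plane_complex x - plane_complex y)))) \<longlonglongrightarrow> 0"
      proof (cases "y \<in> A")
        case True
        then have "(\<lambda>m. q y ^ m) \<longlonglongrightarrow> 0" using q(2) by (intro LIMSEQ_power_zero)
        from tendsto_mult[OF this tendsto_const, of "1 / (plane_complex x - plane_complex y)"]
        show ?thesis using True by simp
      qed simp
    qed
    show "AE y in lebesgue. norm (indicat_real A y *\<^sub>R (q y ^ m * (1 / (plane_complex x - plane_complex y)))) \<le> indicat_real A y * (1 / norm (x - y))" for m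
    proof (rule AE_I2)
      fix y
      have "norm (q y) ^ m * (1 / norm (x - y)) \<le> 1 * (1 / norm (x - y))" if "y \<in> A"
        using q(2)[OF that] by (intro mult_right_mono power_le_one) auto
      then show "norm (indicat_real A y *\<^sub>R (q y ^ m * (1 / (plane_complex x - plane_complex y)))) \<le> indicat_real A y * (1 / norm (x - y))"
        by (simp add: indicator_def norm_mult norm_power norm_divide plane_complex_diff[symmetric])
    qed
  qed (use inverse_dist_integrable(1)[OF A] in auto)
  then show ?thesis by simp
qed

text \<open>An expansion of the Cauchy kernel with a geometric remainder integrates to its leading term
  alone when the other terms have mean zero: the remainder tends to zero as \<open>m\<close> grows, while the
  rest does not depend on \<open>m\<close>.\<close>

lemma cauchy_integral_series:
  fixes g :: "nat \<Rightarrow> real^2 \<Rightarrow> complex"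
  assumes B: "B \<in> lmeasurable" and [measurable]: "B \<in> sets borel"
    and g [measurable]: "\<And>n. g n \<in> borel_measurable borel" and b: "\<And>n y. y \<in> B \<Longrightarrow> norm (g n y) \<le> b n"
    and q [measurable]: "q \<in> borel_measurable borel" and q1: "\<And>y. y \<in> B \<Longrightarrow> norm (q y) < 1"
    and zero: "\<And>n. (LINT y|lebesgue. indicat_real B y *\<^sub>R g (Suc n) y) = 0"
    and expand: "\<And>m y. y \<in> B \<Longrightarrow> 1 / (plane_complex x - plane_complex y) =
      (\<Sum>n<m. c n * g n y) + q y ^ m * (1 / (plane_complex x - plane_complex y))"
  shows "(LINT y|lebesgue. indicat_real B y *\<^sub>R (1 / (plane_complex x - plane_complex y)))
    = c 0 * (LINT y|lebesgue. indicat_real B y *\<^sub>R g 0 y)"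
proof -
  let ?k = "\<lambda>y. 1 / (plane_complex x - plane_complex y)"
  define J where "J = (LINT y|lebesgue. indicat_real B y *\<^sub>R ?k y)"
  define I where "I = (LINT y|lebesgue. indicat_real B y *\<^sub>R g 0 y)"
  define rem where "rem m = (LINT y|lebesgue. indicat_real B y *\<^sub>R (q y ^ m * ?k y))" for m
  have ig: "integrable lebesgue (\<lambda>y. indicat_real B y *\<^sub>R g n y)" for n
  proof -
    have "integrable lebesgue (\<lambda>y. indicat_real B y *\<^sub>R (indicat_real B y *\<^sub>R g n y))"
    proof (rule integrable_indicator_bounded[OF B, of _ "\<bar>b n\<bar>"])
      show "(\<lambda>y. indicat_real B y *\<^sub>R g n y) \<in> borel_measurable lebesgue"
        by (intro measurable_lebesgue_if_borel) measurable
      show "norm (indicat_real B y *\<^sub>R g n y) \<le> \<bar>b n\<bar>" for y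
        by (auto simp: indicator_def intro: order_trans[OF b abs_ge_self])
    qed
    then show ?thesis by (simp add: indicator_inter_arith[symmetric])
  qed
  have eq: "J = c 0 * I + rem (Suc m)" for m
  proof -
    have ir: "integrable lebesgue (\<lambda>y. indicat_real B y *\<^sub>R (q y ^ Suc m * ?k y))"
    proof (rule kernel_dominated_integral(1)[OF B, where x = x])
      show "(\<lambda>y. indicat_real B y *\<^sub>R (q y ^ Suc m * ?k y)) \<in> borel_measurable lebesgue"
        by (intro measurable_lebesgue_if_borel) measurable
      fix y
      have "norm (q y) ^ Suc m * (1 / norm (x - y)) \<le> 1 * (1 / norm (x - y))" if "y \<in> B"
        using q1[OF that] by (intro mult_right_mono power_le_one) auto
      then show "norm (indicat_real B y *\<^sub>R (q y ^ Suc m * ?k y)) \<le> indicat_real B y * (1 / norm (x - y))"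
        by (simp add: indicator_def norm_mult norm_power norm_divide plane_complex_diff[symmetric] del: power_Suc)
    qed
    have si: "integrable lebesgue (\<lambda>y. \<Sum>n<Suc m. c n * (indicat_real B y *\<^sub>R g n y))"
      by (intro Bochner_Integration.integrable_sum integrable_mult_right ig)
    have "J = (LINT y|lebesgue. (\<Sum>n<Suc m. c n * (indicat_real B y *\<^sub>R g n y)) + indicat_real B y *\<^sub>R (q y ^ Suc m * ?k y))"
      unfolding J_def
    proof (intro Bochner_Integration.integral_cong refl)
      fix y
      show "indicat_real B y *\<^sub>R ?k y = (\<Sum>n<Suc m. c n * (indicat_real B y *\<^sub>R g n y)) + indicat_real B y *\<^sub>R (q y ^ Suc m * ?k y)"
      proof (cases "y \<in> B")
        case True
        then have ind: "indicat_real B y = 1" by simp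
        show ?thesis unfolding ind scaleR_one by (rule expand[OF True])
      qed simp
    qed
    also have "\<dots> = (\<Sum>n<Suc m. c n * (LINT y|lebesgue. indicat_real B y *\<^sub>R g n y)) + rem (Suc m)"
      unfolding rem_def Bochner_Integration.integral_add[OF si ir]
      by (subst Bochner_Integration.integral_sum) (intro integrable_mult_right ig, simp only: integral_mult_right_zero)
    also have "(\<Sum>n<Suc m. c n * (LINT y|lebesgue. indicat_real B y *\<^sub>R g n y)) = c 0 * I"
      by (simp add: sum.lessThan_Suc_shift zero I_def del: sum.lessThan_Suc)
    finally show ?thesis .
  qed
  have "rem \<longlonglongrightarrow> 0" unfolding rem_def by (rule remainder_tendsto[OF B q q1])
  then have "(\<lambda>m. rem (Suc m)) \<longlonglongrightarrow> 0" by (rule LIMSEQ_Suc)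
  moreover have "rem (Suc m) = J - c 0 * I" for m using eq[of m] by (metis add_diff_cancel_left')
  ultimately have "J - c 0 * I = 0" by (simp add: LIMSEQ_const_iff)
  then show ?thesis by (simp add: J_def I_def)
qed

lemma cauchy_integral_inner:
  assumes x: "x \<noteq> 0"
  shows "(LINT y|lebesgue. indicat_real (ball 0 (norm x)) y *\<^sub>R (1 / (plane_complex x - plane_complex y))) = pi * cnj (plane_complex x)"
proof -
  let ?X = "plane_complex x" and ?B = "ball 0 (norm x) :: (real^2) set"
  have X0: "?X \<noteq> 0" using x norm_plane_complex[of x] by force
  have "(LINT y|lebesgue. indicat_real ?B y *\<^sub>R (1 / (?X - plane_complex y)))
    = 1 / ?X ^ Suc 0 * (LINT y|lebesgue. indicat_real ?B y *\<^sub>R plane_complex y ^ 0)"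
  proof (rule cauchy_integral_series[where b = "\<lambda>n. norm x ^ n" and q = "\<lambda>y. plane_complex y / ?X"
        and c = "\<lambda>n. 1 / ?X ^ Suc n" and g = "\<lambda>n y. plane_complex y ^ n"])
    show "norm (plane_complex y ^ n) \<le> norm x ^ n" if "y \<in> ?B" for y n
      using that by (simp add: norm_power power_mono)
    show "norm (plane_complex y / ?X) < 1" if "y \<in> ?B" for y
      using that x by (simp add: norm_divide)
    show "(LINT y|lebesgue. indicat_real ?B y *\<^sub>R plane_complex y ^ Suc n) = 0" for n
      by (rule integral_power_zero(1)) auto
    show "1 / (?X - plane_complex y) = (\<Sum>n<m. 1 / ?X ^ Suc n * plane_complex y ^ n)
       + (plane_complex y / ?X) ^ m * (1 / (?X - plane_complex y))" if "y \<in> ?B" for m y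
      by (rule geometric_remainder[OF X0]) (use that in auto)
  qed (simp_all, measurable)
  also have "(LINT y|lebesgue. indicat_real ?B y *\<^sub>R plane_complex y ^ 0) = of_real (pi * (norm x)\<^sup>2)"
    using measure_ball_plane[of "norm x" 0] by (simp add: scaleR_conv_of_real)
  also have "1 / ?X ^ Suc 0 * of_real (pi * (norm x)\<^sup>2) = pi * cnj ?X"
  proof -
    have "of_real ((norm x)\<^sup>2) = ?X * cnj ?X" using complex_norm_square[of ?X] by simp
    then show ?thesis using X0 by simp
  qed
  finally show ?thesis .
qed

lemma cauchy_integral_outer:
  assumes x: "x \<noteq> 0"
  shows "(LINT y|lebesgue. indicat_real (ball 0 1 - cball 0 (norm x)) y *\<^sub>R (1 / (plane_complex x - plane_complex y))) = 0"
proof -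
  let ?X = "plane_complex x" and ?B = "ball 0 1 - cball 0 (norm x) :: (real^2) set"
  have gt: "norm x < norm y" if "y \<in> ?B" for y using that by auto
  have zero: "(LINT y|lebesgue. indicat_real ?B y *\<^sub>R (1 / plane_complex y ^ Suc n)) = 0" for n
    by (rule integral_power_zero(2)) auto
  have "(LINT y|lebesgue. indicat_real ?B y *\<^sub>R (1 / (?X - plane_complex y)))
    = - (?X ^ 0) * (LINT y|lebesgue. indicat_real ?B y *\<^sub>R (1 / plane_complex y ^ Suc 0))"
  proof (rule cauchy_integral_series[where b = "\<lambda>n. 1 / norm x ^ Suc n" and q = "\<lambda>y. ?X / plane_complex y"
        and c = "\<lambda>n. - (?X ^ n)" and g = "\<lambda>n y. 1 / plane_complex y ^ Suc n"])
    show "norm (1 / plane_complex y ^ Suc n) \<le> 1 / norm x ^ Suc n" if "y \<in> ?B" for y n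
    proof -
      have "norm x ^ Suc n \<le> norm y ^ Suc n" using gt[OF that] by (intro power_mono) auto
      then show ?thesis using x by (simp add: norm_divide norm_power frac_le del: power_Suc)
    qed
    show "norm (?X / plane_complex y) < 1" if "y \<in> ?B" for y
      using gt[OF that] le_less_trans[OF norm_ge_zero gt[OF that]] by (simp add: norm_divide)
    show "(LINT y|lebesgue. indicat_real ?B y *\<^sub>R (1 / plane_complex y ^ Suc (Suc n))) = 0" for n by (rule zero)
    show "1 / (?X - plane_complex y) = (\<Sum>n<m. - (?X ^ n) * (1 / plane_complex y ^ Suc n))
       + (?X / plane_complex y) ^ m * (1 / (?X - plane_complex y))" if "y \<in> ?B" for m y
    proof -
      have "y \<noteq> x" "norm y \<noteq> 0" using gt[OF that] by auto
      then have ne: "plane_complex y \<noteq> ?X" "plane_complex y \<noteq> 0"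
        using norm_plane_complex[of y] by (auto simp del: norm_plane_complex)
      have sw: "1 / (?X - plane_complex y) = - (1 / (plane_complex y - ?X))"
        by (simp add: minus_divide_right)
      have "1 / (?X - plane_complex y) = - ((\<Sum>n<m. (1 / plane_complex y ^ Suc n) * ?X ^ n) + (?X / plane_complex y) ^ m * (1 / (plane_complex y - ?X)))"
        unfolding sw by (rule arg_cong[OF geometric_remainder[OF ne(2,1)]])
      also have "\<dots> = (\<Sum>n<m. - ((1 / plane_complex y ^ Suc n) * ?X ^ n)) + (?X / plane_complex y) ^ m * (1 / (?X - plane_complex y))"
        unfolding sw by (simp only: minus_add_distrib mult_minus_right sum_negf)
      also have "(\<Sum>n<m. - ((1 / plane_complex y ^ Suc n) * ?X ^ n)) = (\<Sum>n<m. (- (?X ^ n)) * (1 / plane_complex y ^ Suc n))"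
        by (simp only: mult_minus_left mult.commute)
      finally show ?thesis .
    qed
    show "?B \<in> lmeasurable" by (intro fmeasurable.Diff lmeasurable_ball lmeasurable_cball)
  qed (simp, measurable)
  then show ?thesis unfolding zero by simp
qed

text \<open>The circle between the two regions is a null set.  At the centre of the disc the integral vanishes
  by symmetry.\<close>

lemma cauchy_integral_disc:
  assumes x: "norm x < 1"
  shows "(LINT y|lebesgue. indicat_real (ball 0 1) y *\<^sub>R (1 / (plane_complex x - plane_complex y))) = pi * cnj (plane_complex x)"
proof (cases "x = 0")
  case True
  have X0: "plane_complex 0 = 0" by (simp add: plane_complex_def complex_eq_iff)
  have "(LINT y|lebesgue. indicat_real (ball 0 1) y *\<^sub>R (1 / (plane_complex y) ^ 1)) = 0"
    by (rule integral_power_zero(2)) auto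
  then have "(LINT y|lebesgue. - (indicat_real (ball 0 1) y *\<^sub>R (1 / (plane_complex y)))) = 0" by simp
  then show ?thesis using True X0 by simp
next
  case False
  let ?k = "\<lambda>y. 1 / (plane_complex x - plane_complex y)"
  have [measurable]: "ball 0 r \<in> sets (borel :: (real^2) measure)" "cball 0 r \<in> sets (borel :: (real^2) measure)" for r
    by simp_all
  have "AE y::real^2 in lebesgue. y \<notin> sphere 0 (norm x)"
    using negligible_sphere[of "0::real^2" "norm x"] by (intro AE_not_in) (simp add: negligible_iff_null_sets)
  then have "(LINT y|lebesgue. indicat_real (ball 0 1) y *\<^sub>R ?k y) =
     (LINT y|lebesgue. indicat_real (ball 0 (norm x)) y *\<^sub>R ?k y + indicat_real (ball 0 1 - cball 0 (norm x)) y *\<^sub>R ?k y)"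
  proof (intro integral_cong_AE)
    show "(\<lambda>y. indicat_real (ball 0 1) y *\<^sub>R ?k y) \<in> borel_measurable lebesgue"
      "(\<lambda>y. indicat_real (ball 0 (norm x)) y *\<^sub>R ?k y + indicat_real (ball 0 1 - cball 0 (norm x)) y *\<^sub>R ?k y) \<in> borel_measurable lebesgue"
      by (intro measurable_lebesgue_if_borel, measurable)+
    assume "AE y::real^2 in lebesgue. y \<notin> sphere 0 (norm x)"
    then show "AE y in lebesgue. indicat_real (ball 0 1) y *\<^sub>R ?k y = indicat_real (ball 0 (norm x)) y *\<^sub>R ?k y + indicat_real (ball 0 1 - cball 0 (norm x)) y *\<^sub>R ?k y"
      by eventually_elim (use x in \<open>auto simp: indicator_def\<close>)
  qed
  also have "\<dots> = pi * cnj (plane_complex x)"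
    using cauchy_integral_inner[OF False] cauchy_integral_outer[OF False]
    by (subst Bochner_Integration.integral_add) (auto intro!: cauchy_kernel_integrable fmeasurable.Diff)
  finally show ?thesis .
qed

text \<open>The Cauchy integral in real notation.  This rigid rotation is the motion with which nearby patches are
  compared.\<close>

lemma biot_savart_disc:
  assumes x: "norm x < 1"
  shows "biot_savart (indicat_real (ball 0 1)) x = (1 / 2) *\<^sub>R perp x"
proof -
  define L :: "complex \<Rightarrow> real^2" where "L w = vector [Im w, Re w]" for w
  have L: "bounded_linear L"
    by (rule bounded_linear_intro[of _ 1])
      (auto simp: L_def vec_eq_iff forall_2 cmod_def norm_eq_sqrt_inner inner_vec_def UNIV_2 power2_eq_square add.commute)
  have k: "biot_savart_kernel z = (1 / (2 * pi)) *\<^sub>R L (1 / plane_complex z)" for z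
  proof -
    have nz: "(norm z)\<^sup>2 = (z $ 1)\<^sup>2 + (z $ 2)\<^sup>2"
      unfolding power2_norm_eq_inner by (simp add: inner_vec_def UNIV_2 power2_eq_square)
    have "1 / plane_complex z = Complex (z $ 1 / (norm z)\<^sup>2) (- (z $ 2) / (norm z)\<^sup>2)"
      by (simp add: complex_eq_iff Re_divide Im_divide plane_complex_def nz)
    then show ?thesis by (simp add: biot_savart_kernel_def L_def perp_def vec_eq_iff forall_2)
  qed
  let ?f = "\<lambda>y. indicat_real (ball 0 1) y *\<^sub>R (1 / (plane_complex x - plane_complex y))"
  have "biot_savart (indicat_real (ball 0 1)) x = (LINT y|lebesgue. (1 / (2 * pi)) *\<^sub>R L (?f y))"
    unfolding biot_savart_def
    by (intro Bochner_Integration.integral_cong refl) (simp add: k plane_complex_diff linear_simps(5)[OF L])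
  also have "\<dots> = (1 / (2 * pi)) *\<^sub>R L (LINT y|lebesgue. ?f y)"
    by (subst integral_scaleR_right, subst integral_bounded_linear[OF L])
      (auto intro!: cauchy_kernel_integrable)
  also have "\<dots> = (1 / 2) *\<^sub>R perp x"
    unfolding cauchy_integral_disc[OF x]
    by (simp add: L_def perp_def plane_complex_def vec_eq_iff forall_2)
  finally show ?thesis .
qed

section \<open>The weak formulation without compact support\<close>

lemma borel_measurable_lebesgue_AE:
  fixes f g :: "'a::euclidean_space \<Rightarrow> real"
  assumes f: "f \<in> borel_measurable lebesgue" and ae: "AE x in lebesgue. f x = g x"
  shows "g \<in> borel_measurable lebesgue"
proof (rule measurableI)
  fix S :: "real set" assume S: "S \<in> sets borel"
  show "g -` S \<inter> space lebesgue \<in> sets lebesgue"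
  proof (rule completion.in_sets_AE)
    show "AE x in lebesgue. x \<in> f -` S \<inter> space lebesgue \<longleftrightarrow> x \<in> g -` S \<inter> space lebesgue"
      using ae by eventually_elim auto
    show "f -` S \<inter> space lebesgue \<in> sets lebesgue" using f S by (rule measurable_sets)
  qed auto
qed simp

text \<open>A continuously differentiable function that vanishes exactly on the nonpositive half-line; two of them
  composed give a cutoff function that is smooth enough for the weak formulation.\<close>

definition pos_square :: "real \<Rightarrow> real" where "pos_square s = (max 0 s)\<^sup>2"

lemma pos_square_has_derivative: "(pos_square has_real_derivative 2 * max 0 s) (at s)"
  unfolding has_field_derivative_def
proof (rule has_derivativeI_sandwich[of 1])
  show "bounded_linear ((*) (2 * max 0 s))" by (rule bounded_linear_mult_right)
  show "((\<lambda>y. \<bar>y - s\<bar>) \<longlongrightarrow> 0) (at s)" by (auto intro!: tendsto_eq_intros)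
  fix y assume "y \<noteq> s"
  have "\<bar>pos_square y - pos_square s - 2 * max 0 s * (y - s)\<bar> \<le> (y - s)\<^sup>2"
  proof -
    consider "0 \<le> s" "0 \<le> y" | "0 \<le> s" "y < 0" | "s < 0" "0 \<le> y" | "s < 0" "y < 0" by linarith
    then show ?thesis
    proof cases
      case 2
      have "pos_square y - pos_square s - 2 * max 0 s * (y - s) = s * s - 2 * s * y"
        using 2 by (simp add: pos_square_def power2_eq_square algebra_simps)
      moreover have "s * y \<le> 0" using 2 by (simp add: mult_nonneg_nonpos)
      moreover have "(y - s)\<^sup>2 = y * y - 2 * s * y + s * s" by (simp add: power2_eq_square algebra_simps)
      ultimately show ?thesis by (simp add: abs_if) (smt (verit) zero_le_square)
    next
      case 3
      have "y\<^sup>2 \<le> (y - s)\<^sup>2" using 3 by (intro power_mono) auto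
      then show ?thesis using 3 by (simp add: pos_square_def)
    next
      case 1
      have "pos_square y - pos_square s - 2 * max 0 s * (y - s) = (y - s)\<^sup>2"
        using 1 by (simp add: pos_square_def power2_eq_square algebra_simps)
      then show ?thesis by simp
    next
      case 4
      then have "pos_square y - pos_square s - 2 * max 0 s * (y - s) = 0" by (simp add: pos_square_def)
      then show ?thesis by simp
    qed
  qed
  then have "\<bar>pos_square y - pos_square s - 2 * max 0 s * (y - s)\<bar> / \<bar>y - s\<bar> \<le> (y - s)\<^sup>2 / \<bar>y - s\<bar>"
    by (intro divide_right_mono) auto
  also have "\<dots> = \<bar>y - s\<bar>" using \<open>y \<noteq> s\<close> by (simp add: power2_eq_square nonzero_divide_eq_eq)
  finally show "norm (pos_square y - pos_square s - 2 * max 0 s * (y - s)) / norm (y - s) \<le> \<bar>y - s\<bar>" by simp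
qed simp

text \<open>Equal to one on the disc of radius \<open>sqrt a\<close> and to zero outside the disc of radius \<open>sqrt (a + 1)\<close>.\<close>

definition cutoff :: "real \<Rightarrow> real^2 \<Rightarrow> real" where
  "cutoff a x = pos_square (1 - pos_square ((norm x)\<^sup>2 - a))"

definition cutoff_deriv :: "real \<Rightarrow> real^2 \<Rightarrow> real^2 \<Rightarrow> real" where
  "cutoff_deriv a x h = 2 * max 0 (1 - pos_square ((norm x)\<^sup>2 - a)) * (- (2 * max 0 ((norm x)\<^sup>2 - a) * (2 * (x \<bullet> h))))"

lemma cutoff_has_derivative: "(cutoff a has_derivative cutoff_deriv a x) (at x)"
proof -
  have 1: "((\<lambda>x. (norm x)\<^sup>2 - a) has_derivative (\<lambda>h. 2 * (x \<bullet> h))) (at x)" for x :: "real^2"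
    unfolding power2_norm_eq_inner by (auto intro!: derivative_eq_intros simp: inner_commute)
  have p: "(pos_square has_derivative (\<lambda>h. 2 * max 0 s * h)) (at s)" for s
    using pos_square_has_derivative[of s] by (simp add: has_field_derivative_def)
  have 2: "((\<lambda>x. 1 - pos_square ((norm x)\<^sup>2 - a)) has_derivative (\<lambda>h. - (2 * max 0 ((norm x)\<^sup>2 - a) * (2 * (x \<bullet> h))))) (at x)"
    by (rule has_derivative_eq_rhs[OF has_derivative_diff[OF has_derivative_const has_derivative_compose[OF 1 p]]]) simp
  show ?thesis unfolding cutoff_def[abs_def] cutoff_deriv_def[abs_def]
    by (rule has_derivative_compose[OF 2 p])
qed

lemma continuous_cutoff_deriv: "continuous_on UNIV (\<lambda>x. cutoff_deriv a x h)"
  unfolding cutoff_deriv_def pos_square_def by (intro continuous_intros)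

lemma cutoff_inside: "(norm x)\<^sup>2 \<le> a \<Longrightarrow> cutoff a x = 1" "(norm x)\<^sup>2 \<le> a \<Longrightarrow> cutoff_deriv a x h = 0"
  by (simp_all add: cutoff_def cutoff_deriv_def pos_square_def max_def)

lemma cutoff_outside: "(norm x)\<^sup>2 \<ge> a + 1 \<Longrightarrow> cutoff a x = 0"
proof -
  assume "(norm x)\<^sup>2 \<ge> a + 1"
  then have "pos_square ((norm x)\<^sup>2 - a) \<ge> 1" by (simp add: pos_square_def max_def)
  then show "cutoff a x = 0" unfolding cutoff_def by (simp add: pos_square_def max_def)
qed

lemma cutoff_test_function:
  fixes a :: real
  assumes der: "\<And>x. (f has_derivative f' x) (at x)" and cont: "\<And>h. continuous_on UNIV (\<lambda>x. f' x h)"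
  defines "\<psi> \<equiv> \<lambda>p::real \<times> (real^2). cutoff a (snd p) * f (snd p)"
  shows "test_function \<psi>"
    and "frechet_derivative \<psi> (at (t, x)) (1, v) = cutoff a x * f' x v + cutoff_deriv a x v * f x"
proof -
  define \<psi>' where "\<psi>' p h = cutoff a (snd p) * f' (snd p) (snd h) + cutoff_deriv a (snd p) (snd h) * f (snd p)" for p h :: "real \<times> (real^2)"
  have snd: "(snd has_derivative snd) (at p)" for p :: "real \<times> (real^2)"
    by (rule bounded_linear.has_derivative[OF bounded_linear_snd has_derivative_ident])
  have D: "(\<psi> has_derivative \<psi>' p) (at p)" for p
    unfolding \<psi>_def \<psi>'_def
    by (rule has_derivative_mult[OF has_derivative_compose[OF snd cutoff_has_derivative] has_derivative_compose[OF snd der]])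
  have F: "frechet_derivative \<psi> (at p) = \<psi>' p" for p using frechet_derivative_at[OF D] by simp
  have cf: "continuous_on UNIV f" "continuous_on UNIV (cutoff a)"
    using der cutoff_has_derivative by (meson continuous_at_imp_continuous_on has_derivative_continuous)+
  show "test_function \<psi>"
    unfolding test_function_def
  proof (intro conjI allI)
    show "\<psi> differentiable (at p)" for p using D[of p] unfolding differentiable_def by blast
    show "continuous_on UNIV (\<lambda>p. frechet_derivative \<psi> (at p) h)" for h
      unfolding F \<psi>'_def
      by (intro continuous_intros continuous_on_compose2[OF cont] continuous_on_compose2[OF continuous_cutoff_deriv]
          continuous_on_compose2[OF cf(1)] continuous_on_compose2[OF cf(2)]) auto
    show "\<exists>r. \<forall>t x. norm x > r \<longrightarrow> \<psi> (t, x) = 0"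
    proof (intro exI[of _ "sqrt (\<bar>a\<bar> + 1)"] allI impI)
      fix t and x :: "real^2" assume "sqrt (\<bar>a\<bar> + 1) < norm x"
      then have "(sqrt (\<bar>a\<bar> + 1))\<^sup>2 \<le> (norm x)\<^sup>2" by (intro power_mono) auto
      then have "cutoff a x = 0" by (intro cutoff_outside) auto
      then show "\<psi> (t, x) = 0" by (simp add: \<psi>_def)
    qed
  qed
  show "frechet_derivative \<psi> (at (t, x)) (1, v) = cutoff a x * f' x v + cutoff_deriv a x v * f x"
    by (simp add: F \<psi>'_def)
qed

locale patch =
  fixes R :: real and \<Omega>0 :: "(real^2) set" and w :: "real \<Rightarrow> real^2 \<Rightarrow> real"
    and u :: "real \<Rightarrow> real^2 \<Rightarrow> real^2" and \<phi> :: "real^2 \<Rightarrow> real \<Rightarrow> real^2"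
  assumes R_pos: "R > 0" and meas0: "\<Omega>0 \<in> sets lebesgue" and in_ball: "\<Omega>0 \<subseteq> ball 0 R"
    and sol: "vortex_patch_solution \<Omega>0 w u \<phi>"
begin

definition \<Omega> :: "real \<Rightarrow> (real^2) set" where "\<Omega> t = (\<lambda>x. \<phi> x t) ` \<Omega>0"

lemma yudovich: "yudovich_solution (indicat_real \<Omega>0) w u" and flow: "is_flow u \<phi>"
  and w_eq: "t \<ge> 0 \<Longrightarrow> w t = indicat_real (\<Omega> t)"
  using sol by (auto simp: vortex_patch_solution_def \<Omega>_def)

lemma u_eq: "t \<ge> 0 \<Longrightarrow> u t x = biot_savart (indicat_real (\<Omega> t)) x"
  using yudovich w_eq by (simp add: yudovich_solution_def)

lemma flow_0 [simp]: "\<phi> x 0 = x" and flow_continuous: "continuous_on {0..} (\<phi> x)"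
  and flow_deriv: "t > 0 \<Longrightarrow> (\<phi> x has_vector_derivative u t (\<phi> x t)) (at t)"
  using flow by (simp_all add: is_flow_def)

lemma \<Omega>_0 [simp]: "\<Omega> 0 = \<Omega>0" by (simp add: \<Omega>_def)

lemma \<Omega>0_lmeasurable: "\<Omega>0 \<in> lmeasurable"
  using meas0 in_ball by (meson bounded_ball bounded_set_imp_lmeasurable bounded_subset)

lemma area_bound_ex: "\<exists>M. \<forall>t\<in>{0..T}. \<Omega> t \<in> lmeasurable \<and> area (\<Omega> t) \<le> M"
proof -
  obtain M where M: "\<forall>t\<in>{0..max T 1}. integrable lebesgue (w t) \<and> (LINT x|lebesgue. \<bar>w t x\<bar>) \<le> M"
    using yudovich unfolding yudovich_solution_def by (metis less_max_iff_disj zero_less_one)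
  show ?thesis
  proof (intro exI ballI)
    fix t assume "t \<in> {0..T}"
    then have t: "t \<in> {0..max T 1}" "t \<ge> 0" by auto
    have i: "integrable lebesgue (indicat_real (\<Omega> t))" using M t w_eq by auto
    then have "emeasure lebesgue (\<Omega> t) < \<infinity>" "\<Omega> t \<in> sets lebesgue"
      using integrable_indicator_iff[of lebesgue "\<Omega> t"] borel_measurable_integrable[OF i] by (auto simp: borel_measurable_indicator_iff)
    then have "\<Omega> t \<in> lmeasurable" unfolding fmeasurable_def by blast
    moreover have "area (\<Omega> t) \<le> M" using M t w_eq by auto
    ultimately show "\<Omega> t \<in> lmeasurable \<and> area (\<Omega> t) \<le> M" ..
  qed
qed

lemma \<Omega>_lmeasurable: "t \<ge> 0 \<Longrightarrow> \<Omega> t \<in> lmeasurable"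
  using area_bound_ex[of t] by auto

lemma u_bound: "t \<ge> 0 \<Longrightarrow> norm (u t x) \<le> 3 * sqrt (area (\<Omega> t))"
  using norm_biot_savart_le[OF \<Omega>_lmeasurable] u_eq by simp

text \<open>The mean value inequality for a trajectory after subtraction of a uniform motion with velocity \<open>c\<close>.
  With \<open>c = 0\<close> it bounds the speed; with \<open>c\<close> the velocity of an Euler step it bounds the
  local error of the scheme.\<close>

lemma flow_increment:
  assumes "0 \<le> s" "s \<le> t" and le: "\<And>\<tau>. \<tau> \<in> {s<..<t} \<Longrightarrow> norm (u \<tau> (\<phi> x \<tau>) - c) \<le> B"
  shows "norm (\<phi> x t - \<phi> x s - (t - s) *\<^sub>R c) \<le> (t - s) * B"
proof (cases "s = t")
  case False
  then have st: "s < t" using assms by simp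
  have "norm ((\<phi> x t - t *\<^sub>R c) - (\<phi> x s - s *\<^sub>R c)) \<le> t * B - s * B"
  proof (rule differentiable_bound_general[OF st, where f = "\<lambda>\<tau>. \<phi> x \<tau> - \<tau> *\<^sub>R c" and \<phi> = "\<lambda>\<tau>. \<tau> * B"
        and f' = "\<lambda>\<tau>. u \<tau> (\<phi> x \<tau>) - c" and \<phi>' = "\<lambda>_. B"])
    show "continuous_on {s..t} (\<lambda>\<tau>. \<phi> x \<tau> - \<tau> *\<^sub>R c)"
      using assms(1) by (intro continuous_intros continuous_on_subset[OF flow_continuous]) auto
    show "continuous_on {s..t} (\<lambda>\<tau>. \<tau> * B)" by (intro continuous_intros)
    fix \<tau> assume \<tau>: "s < \<tau>" "\<tau> < t"
    then have "\<tau> > 0" using assms(1) by simp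
    show "((\<lambda>\<tau>. \<phi> x \<tau> - \<tau> *\<^sub>R c) has_vector_derivative u \<tau> (\<phi> x \<tau>) - c) (at \<tau>)"
      using has_vector_derivative_diff[OF flow_deriv[OF \<open>\<tau> > 0\<close>]
          has_vector_derivative_scaleR[OF DERIV_ident has_vector_derivative_const]] by simp
    show "((\<lambda>\<tau>. \<tau> * B) has_vector_derivative B) (at \<tau>)"
      by (auto intro!: derivative_eq_intros)
    show "norm (u \<tau> (\<phi> x \<tau>) - c) \<le> B" using \<tau> by (intro le) auto
  qed
  then show ?thesis by (simp add: algebra_simps)
qed simp

lemma \<Omega>_bounded_ex: "\<exists>r. \<forall>t\<in>{0..T}. \<Omega> t \<subseteq> ball 0 r"
proof -
  obtain M where M: "\<And>t. t \<in> {0..T} \<Longrightarrow> area (\<Omega> t) \<le> M" using area_bound_ex[of T] by blast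
  have "\<Omega> t \<subseteq> ball 0 (R + T * (3 * sqrt M) + 1)" if t: "t \<in> {0..T}" for t
  proof
    fix y assume "y \<in> \<Omega> t"
    then obtain x where x: "x \<in> \<Omega>0" "y = \<phi> x t" by (auto simp: \<Omega>_def)
    have M0: "M \<ge> 0" using M[OF t] by (smt (verit) measure_nonneg)
    have "norm (\<phi> x t - \<phi> x 0 - (t - 0) *\<^sub>R 0) \<le> (t - 0) * (3 * sqrt M)"
    proof (rule flow_increment)
      fix \<tau> assume "\<tau> \<in> {0<..<t}"
      then have \<tau>: "\<tau> \<in> {0..T}" "\<tau> \<ge> 0" using t by auto
      have "norm (u \<tau> (\<phi> x \<tau>)) \<le> 3 * sqrt (area (\<Omega> \<tau>))" by (rule u_bound[OF \<tau>(2)])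
      also have "\<dots> \<le> 3 * sqrt M" using M[OF \<tau>(1)] by simp
      finally show "norm (u \<tau> (\<phi> x \<tau>) - 0) \<le> 3 * sqrt M" by simp
    qed (use t in auto)
    also have "\<dots> \<le> T * (3 * sqrt M)" using t M0 by (simp add: mult_right_mono)
    finally have "norm (y - x) \<le> T * (3 * sqrt M)" using x by simp
    moreover have "norm x < R" using x in_ball by auto
    moreover have "norm y \<le> norm x + norm (y - x)" by (metis norm_triangle_sub)
    ultimately show "y \<in> ball 0 (R + T * (3 * sqrt M) + 1)" by simp
  qed
  then show ?thesis by blast
qed

text \<open>The weak formulation, freed of the compact support of the test function: at times up to \<open>T\<close>
  the patch stays in a fixed disc, on which a cutoff is identically one.\<close>

lemma weak_evolution:
  assumes T: "T > 0" and der: "\<And>x. (f has_derivative f' x) (at x)" and cont: "\<And>h. continuous_on UNIV (\<lambda>x. f' x h)"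
  shows "(LINT x|lebesgue. f x * indicat_real (\<Omega> T) x) - (LINT x|lebesgue. f x * indicat_real \<Omega>0 x) =
     (LINT t:{0..T}|lebesgue. LINT x|lebesgue. f' x (u t x) * indicat_real (\<Omega> t) x)"
proof -
  obtain r where r: "\<And>t. t \<in> {0..T} \<Longrightarrow> \<Omega> t \<subseteq> ball 0 r" using \<Omega>_bounded_ex[of T] by blast
  define \<psi> where "\<psi> = (\<lambda>p::real \<times> (real^2). cutoff (r\<^sup>2) (snd p) * f (snd p))"
  have sq: "(norm x)\<^sup>2 \<le> r\<^sup>2" if "x \<in> \<Omega> t" "t \<in> {0..T}" for x t
    using r[OF that(2)] that(1) by (intro power_mono) auto
  have tf: "test_function \<psi>" unfolding \<psi>_def by (rule cutoff_test_function(1)[OF der cont])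
  have fd: "frechet_derivative \<psi> (at (t, x)) (1, v) = cutoff (r\<^sup>2) x * f' x v + cutoff_deriv (r\<^sup>2) x v * f x" for t x v
    unfolding \<psi>_def by (rule cutoff_test_function(2)[OF der cont])
  have "(LINT x|lebesgue. \<psi> (T, x) * w T x) - (LINT x|lebesgue. \<psi> (0, x) * indicat_real \<Omega>0 x) =
        (LINT t:{0..T}|lebesgue. LINT x|lebesgue. frechet_derivative \<psi> (at (t, x)) (1, u t x) * w t x)"
    using yudovich tf T unfolding yudovich_solution_def by blast
  also have "(\<lambda>x. \<psi> (T, x) * w T x) = (\<lambda>x. f x * indicat_real (\<Omega> T) x)"
    using T sq[of _ T] by (auto simp: fun_eq_iff \<psi>_def w_eq indicator_def cutoff_inside)
  also have "(\<lambda>x. \<psi> (0, x) * indicat_real \<Omega>0 x) = (\<lambda>x. f x * indicat_real \<Omega>0 x)"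
    using T sq[of _ 0] by (auto simp: fun_eq_iff \<psi>_def indicator_def cutoff_inside)
  also have "(LINT t:{0..T}|lebesgue. LINT x|lebesgue. frechet_derivative \<psi> (at (t, x)) (1, u t x) * w t x) =
     (LINT t:{0..T}|lebesgue. LINT x|lebesgue. f' x (u t x) * indicat_real (\<Omega> t) x)"
  proof (rule set_lebesgue_integral_cong)
    show "\<forall>t. t \<in> {0..T} \<longrightarrow> (LINT x|lebesgue. frechet_derivative \<psi> (at (t, x)) (1, u t x) * w t x) =
       (LINT x|lebesgue. f' x (u t x) * indicat_real (\<Omega> t) x)"
    proof (intro allI impI Bochner_Integration.integral_cong refl)
      fix t x assume "t \<in> {0..T}"
      then show "frechet_derivative \<psi> (at (t, x)) (1, u t x) * w t x = f' x (u t x) * indicat_real (\<Omega> t) x"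
        using sq[of x t] by (auto simp: fd w_eq indicator_def cutoff_inside)
    qed
  qed simp
  finally show ?thesis .
qed

text \<open>Joint measurability of the vorticity makes the right-hand side of the weak formulation a
  measurable function of time; the velocity is recomputed from a Borel version of the vorticity.\<close>

lemma rate_measurable:
  assumes cont: "\<And>h. continuous_on UNIV (\<lambda>x. f' x h)" and lin: "\<And>x. bounded_linear (f' x)"
  shows "(\<lambda>t. if t \<in> {0..} then LINT x|lebesgue. f' x (u t x) * indicat_real (\<Omega> t) x else 0) \<in> borel_measurable lebesgue"
proof -
  define W where "W p = (if p \<in> {0..} \<times> UNIV then (\<lambda>(t, x). w t x) p else 0)" for p :: "real \<times> (real^2)"
  have "W \<in> borel_measurable lebesgue"
    unfolding W_def
  proof (rule borel_measurable_if_I)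
    show "(\<lambda>(t, x). w t x) \<in> borel_measurable (lebesgue_on ({0..} \<times> UNIV))"
      using yudovich by (simp add: yudovich_solution_def)
    have "closed ({0..} \<times> UNIV :: (real \<times> (real^2)) set)" by (intro closed_Times) auto
    then show "({0..} \<times> UNIV :: (real \<times> (real^2)) set) \<in> sets lebesgue" by (rule lebesgue_closedin[of UNIV, simplified]) 
  qed
  then obtain g where g: "g \<in> borel_measurable lborel" and ae: "AE p in lborel. W p = g p"
    using completion_ex_borel_measurable_real by blast
  have g' [measurable]: "g \<in> borel_measurable (borel \<Otimes>\<^sub>M borel)" using g by (simp add: borel_prod)
  have "AE p in lborel \<Otimes>\<^sub>M lborel. W p = g p" using ae by (subst lborel_prod)
  then have aet: "AE t in lborel. AE x in lborel. W (t, x) = g (t, x)" by (rule lborel_pair.AE_pair)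
  define U where "U t x = (LINT y|lborel. g (t, y) *\<^sub>R biot_savart_kernel (x - y))" for t x
  have U [measurable]: "(\<lambda>p. U (fst p) (snd p)) \<in> borel_measurable (borel \<Otimes>\<^sub>M borel)"
    unfolding U_def by measurable
  have [measurable]: "(\<lambda>x. f' x h) \<in> borel_measurable borel" for h
    by (rule borel_measurable_continuous_onI[OF cont])
  have [measurable]: "(\<lambda>x::real^2. x $ i) \<in> borel_measurable borel" for i
    by (intro borel_measurable_continuous_onI continuous_intros)
  define G where "G t = (if t \<in> {0..} then LINT x|lborel. (U t x $ 1 * f' x (axis 1 1) + U t x $ 2 * f' x (axis 2 1)) * g (t, x) else 0)" for t
  have U2: "(\<lambda>p. (U (fst p) (snd p) $ 1 * f' (snd p) (axis 1 1) + U (fst p) (snd p) $ 2 * f' (snd p) (axis 2 1)) * g p) \<in> borel_measurable (borel \<Otimes>\<^sub>M borel)"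
    by measurable
  have "(\<lambda>t. LINT x|lborel. (U t x $ 1 * f' x (axis 1 1) + U t x $ 2 * f' x (axis 2 1)) * g (t, x)) \<in> borel_measurable borel"
    using U2 by (intro lborel.borel_measurable_lebesgue_integral) (simp add: case_prod_beta cong: measurable_cong_sets)
  then have "G \<in> borel_measurable borel"
    unfolding G_def by measurable
  then have Gm: "G \<in> borel_measurable lebesgue" by (intro measurable_completion) simp
  have "AE t in lborel. G t = (if t \<in> {0..} then LINT x|lebesgue. f' x (u t x) * indicat_real (\<Omega> t) x else 0)"
    using aet
  proof eventually_elim
    case (elim t)
    show ?case
    proof (cases "t \<ge> 0")
      case True
      then have "AE x in lborel. indicat_real (\<Omega> t) x = g (t, x)" using elim by (simp add: W_def w_eq)
      then have ae: "AE x in lebesgue. indicat_real (\<Omega> t) x = g (t, x)" by (rule AE_completion)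
      have gm: "(\<lambda>x. g (t, x)) \<in> borel_measurable borel" by measurable
      have wm: "indicat_real (\<Omega> t) \<in> borel_measurable lebesgue"
        using \<Omega>_lmeasurable[OF True] by (intro borel_measurable_indicator) (auto dest: fmeasurableD)
      have km: "(\<lambda>y. biot_savart_kernel (x - y)) \<in> borel_measurable lebesgue" for x
        by (intro measurable_lebesgue_if_borel) measurable
      have uU: "u t x = U t x" for x
      proof -
        have "u t x = (LINT y|lebesgue. indicat_real (\<Omega> t) y *\<^sub>R biot_savart_kernel (x - y))"
          using True by (simp add: u_eq biot_savart_def)
        also have "\<dots> = (LINT y|lebesgue. g (t, y) *\<^sub>R biot_savart_kernel (x - y))"
        proof (rule integral_cong_AE)
          show "(\<lambda>y. indicat_real (\<Omega> t) y *\<^sub>R biot_savart_kernel (x - y)) \<in> borel_measurable lebesgue"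
            by (intro borel_measurable_scaleR wm km)
          show "(\<lambda>y. g (t, y) *\<^sub>R biot_savart_kernel (x - y)) \<in> borel_measurable lebesgue"
            by (intro borel_measurable_scaleR measurable_lebesgue_if_borel gm km)
          show "AE y in lebesgue. indicat_real (\<Omega> t) y *\<^sub>R biot_savart_kernel (x - y) = g (t, y) *\<^sub>R biot_savart_kernel (x - y)"
            using ae by eventually_elim simp
        qed
        also have "\<dots> = U t x" unfolding U_def
          by (rule integral_completion) (simp, measurable)
        finally show ?thesis .
      qed
      have fv: "f' x v = v $ 1 * f' x (axis 1 1) + v $ 2 * f' x (axis 2 1)" for x v
      proof -
        have "v = v $ 1 *\<^sub>R axis 1 1 + v $ 2 *\<^sub>R axis 2 1" by (simp add: vec_eq_iff forall_2 axis_def)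
        then have "f' x v = f' x (v $ 1 *\<^sub>R axis 1 1 + v $ 2 *\<^sub>R axis 2 1)" by simp
        then show ?thesis by (simp only: linear_simps[OF lin] real_scaleR_def)
      qed
      have Um: "(\<lambda>x. U t x) \<in> borel_measurable borel"
        using measurable_compose[OF measurable_Pair1'[of t borel borel] U] by simp
      have m: "(\<lambda>x. (U t x $ 1 * f' x (axis 1 1) + U t x $ 2 * f' x (axis 2 1)) * g (t, x)) \<in> borel_measurable borel"
        using Um gm by measurable
      have m0: "(\<lambda>x. U t x $ 1 * f' x (axis 1 1) + U t x $ 2 * f' x (axis 2 1)) \<in> borel_measurable borel"
        using Um by measurable
      have "(LINT x|lebesgue. f' x (u t x) * indicat_real (\<Omega> t) x) =
          (LINT x|lebesgue. (U t x $ 1 * f' x (axis 1 1) + U t x $ 2 * f' x (axis 2 1)) * g (t, x))"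
        unfolding uU fv[of _ "U t _"]
      proof (rule integral_cong_AE)
        show "(\<lambda>x. (U t x $ 1 * f' x (axis 1 1) + U t x $ 2 * f' x (axis 2 1)) * indicat_real (\<Omega> t) x) \<in> borel_measurable lebesgue"
          by (intro borel_measurable_times measurable_lebesgue_if_borel m0 wm)
        show "(\<lambda>x. (U t x $ 1 * f' x (axis 1 1) + U t x $ 2 * f' x (axis 2 1)) * g (t, x)) \<in> borel_measurable lebesgue"
          by (intro measurable_lebesgue_if_borel m)
        show "AE x in lebesgue. (U t x $ 1 * f' x (axis 1 1) + U t x $ 2 * f' x (axis 2 1)) * indicat_real (\<Omega> t) x =
           (U t x $ 1 * f' x (axis 1 1) + U t x $ 2 * f' x (axis 2 1)) * g (t, x)"
          using ae by eventually_elim simp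
      qed
      also have "\<dots> = (LINT x|lborel. (U t x $ 1 * f' x (axis 1 1) + U t x $ 2 * f' x (axis 2 1)) * g (t, x))"
        using m by (intro integral_completion) simp
      finally show ?thesis using True by (simp add: G_def)
    qed (simp add: G_def)
  qed
  then have "AE t in lebesgue. G t = (if t \<in> {0..} then LINT x|lebesgue. f' x (u t x) * indicat_real (\<Omega> t) x else 0)"
    by (rule AE_completion)
  then show ?thesis by (rule borel_measurable_lebesgue_AE[OF Gm])
qed

text \<open>The weak formulation determines the change from time \<open>0\<close> only.  Subtracting its instances at two
  times requires the rate to be integrable in time, which holds because it is measurable and bounded.\<close>

lemma weak_evolution_lipschitz:
  assumes s: "0 \<le> s" "s \<le> t"
    and der: "\<And>x. (f has_derivative f' x) (at x)" and cont: "\<And>h. continuous_on UNIV (\<lambda>x. f' x h)"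
    and B: "\<And>\<tau> x. \<tau> \<in> {0..t} \<Longrightarrow> x \<in> \<Omega> \<tau> \<Longrightarrow> \<bar>f' x (u \<tau> x)\<bar> \<le> B" "B \<ge> 0"
    and m: "\<And>\<tau>. \<tau> \<in> {0..t} \<Longrightarrow> area (\<Omega> \<tau>) \<le> m"
  shows "\<bar>(LINT x|lebesgue. f x * indicat_real (\<Omega> t) x) - (LINT x|lebesgue. f x * indicat_real (\<Omega> s) x)\<bar> \<le> B * m * (t - s)"
proof (cases "s = t")
  case False
  then have t: "t > 0" using s by simp
  define F where "F \<tau> = (LINT x|lebesgue. f' x (u \<tau> x) * indicat_real (\<Omega> \<tau>) x)" for \<tau>
  define A where "A \<tau> = (LINT x|lebesgue. f x * indicat_real (\<Omega> \<tau>) x)" for \<tau>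
  have Fb: "\<bar>F \<tau>\<bar> \<le> B * m" if "\<tau> \<in> {0..t}" for \<tau>
  proof (cases "integrable lebesgue (\<lambda>x. f' x (u \<tau> x) * indicat_real (\<Omega> \<tau>) x)")
    case True
    have l: "\<Omega> \<tau> \<in> lmeasurable" using that by (intro \<Omega>_lmeasurable) auto
    have "norm (F \<tau>) \<le> (LINT x|lebesgue. B * indicat_real (\<Omega> \<tau>) x)"
      unfolding F_def
      by (intro Bochner_Integration.integral_norm_bound_integral True integrable_mult_right integrable_indicator_lmeasurable l)
        (use B(1)[OF that] in \<open>auto simp: indicator_def\<close>)
    also have "\<dots> = B * area (\<Omega> \<tau>)" by simp
    also have "\<dots> \<le> B * m" using m[OF that] B(2) by (rule mult_left_mono)
    finally show ?thesis by simp
  next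
    case False
    have "m \<ge> 0" using m[OF that] measure_nonneg order_trans by blast
    then show ?thesis using False B(2) by (simp add: F_def not_integrable_integral_eq)
  qed
  have Fm: "(\<lambda>\<tau>. if \<tau> \<in> {0..} then F \<tau> else 0) \<in> borel_measurable lebesgue"
    unfolding F_def by (rule rate_measurable[OF cont has_derivative_bounded_linear[OF der]])
  \<comment> \<open>Integrability allows the integrals up to \<open>s\<close> and up to \<open>t\<close> to be subtracted.\<close>
  have Fi: "set_integrable lebesgue {a..b} F" if "0 \<le> a" "b \<le> t" for a b
    unfolding set_integrable_def
  proof (rule Bochner_Integration.integrable_bound[of _ "\<lambda>\<tau>. (B * m) * indicat_real {a..b} \<tau>"])
    show "integrable lebesgue (\<lambda>\<tau>. (B * m) * indicat_real {a..b} \<tau>)"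
      by (intro integrable_mult_right integrable_indicator_lmeasurable lmeasurable_interval)
    have "(\<lambda>\<tau>. indicat_real {a..b} \<tau> *\<^sub>R (if \<tau> \<in> {0..} then F \<tau> else 0)) \<in> borel_measurable lebesgue"
      by (intro borel_measurable_scaleR borel_measurable_indicator Fm) simp
    moreover have "(\<lambda>\<tau>. indicat_real {a..b} \<tau> *\<^sub>R (if \<tau> \<in> {0..} then F \<tau> else 0)) = (\<lambda>\<tau>. indicat_real {a..b} \<tau> *\<^sub>R F \<tau>)"
      using that by (auto simp: indicator_def fun_eq_iff)
    ultimately show "(\<lambda>\<tau>. indicat_real {a..b} \<tau> *\<^sub>R F \<tau>) \<in> borel_measurable lebesgue" by simp
    show "AE \<tau> in lebesgue. norm (indicat_real {a..b} \<tau> *\<^sub>R F \<tau>) \<le> norm ((B * m) * indicat_real {a..b} \<tau>)"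
      using Fb that by (intro AE_I2) (auto simp: indicator_def intro: order_trans[OF Fb abs_ge_self])
  qed
  have ev: "A b - A 0 = (LINT \<tau>:{0..b}|lebesgue. F \<tau>)" if "0 \<le> b" for b
  proof (cases "b = 0")
    case True
    have "AE \<tau>::real in lebesgue. \<tau> \<notin> {0}"
      by (intro AE_not_in) (simp add: negligible_iff_null_sets[symmetric])
    then have "AE \<tau> in lebesgue. indicat_real {0..b} \<tau> *\<^sub>R F \<tau> = 0"
      by eventually_elim (use True in auto)
    then have "(LINT \<tau>:{0..b}|lebesgue. F \<tau>) = 0"
      unfolding set_lebesgue_integral_def by (rule integral_eq_zero_AE)
    then show ?thesis using True by simp
  next
    case False
    then show ?thesis using weak_evolution[OF _ der cont, of b] that by (simp add: A_def F_def)
  qed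
  have "A t - A s = (LINT \<tau>:{0..t}|lebesgue. F \<tau>) - (LINT \<tau>:{0..s}|lebesgue. F \<tau>)"
    using ev[of t] ev[of s] s by simp
  also have "\<dots> = (LINT \<tau>|lebesgue. indicat_real {0..t} \<tau> *\<^sub>R F \<tau> - indicat_real {0..s} \<tau> *\<^sub>R F \<tau>)"
    unfolding set_lebesgue_integral_def
    using Fi[of 0 t] Fi[of 0 s] s by (subst Bochner_Integration.integral_diff) (auto simp: set_integrable_def)
  also have "norm \<dots> \<le> (LINT \<tau>|lebesgue. (B * m) * indicat_real {s..t} \<tau>)"
  proof (rule Bochner_Integration.integral_norm_bound_integral)
    show "integrable lebesgue (\<lambda>\<tau>. indicat_real {0..t} \<tau> *\<^sub>R F \<tau> - indicat_real {0..s} \<tau> *\<^sub>R F \<tau>)"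
      using Fi[of 0 t] Fi[of 0 s] s by (intro Bochner_Integration.integrable_diff) (auto simp: set_integrable_def)
    have "0 \<le> B * m" using Fb[of 0] t by auto
    then show "norm (indicat_real {0..t} \<tau> *\<^sub>R F \<tau> - indicat_real {0..s} \<tau> *\<^sub>R F \<tau>) \<le> (B * m) * indicat_real {s..t} \<tau>" for \<tau>
      using Fb[of \<tau>] s by (auto simp: indicator_def)
    show "integrable lebesgue (\<lambda>\<tau>. (B * m) * indicat_real {s..t} \<tau>)"
      by (intro integrable_mult_right integrable_indicator_lmeasurable lmeasurable_interval)
  qed
  also have "\<dots> = B * m * (t - s)" using s by simp
  finally show ?thesis by (simp add: A_def)
qed simp

end

section \<open>Conserved quantities and stability of the disc\<close>

text \<open>A patch exerts no torque on itself, because the kernel is odd and orthogonal to its argument.\<close>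

lemma self_torque_zero:
  assumes A: "A \<in> lmeasurable" and r: "A \<subseteq> ball 0 r"
  shows "(LINT x|lebesgue. (x \<bullet> biot_savart (indicat_real A) x) * indicat_real A x) = 0"
proof -
  define M where "M = lebesgue_on A"
  have sA: "A \<in> sets lebesgue" using A by (rule fmeasurableD)
  have spM: "space M = A" by (simp add: M_def)
  have "emeasure M (space M) = emeasure lebesgue A"
    unfolding spM unfolding M_def using sA by (subst emeasure_restrict_space) auto
  also have "\<dots> = ennreal (area A)" by (rule emeasure_eq_measure2[OF A])
  finally have "emeasure M (space M) \<noteq> \<infinity>" by simp
  then interpret M: finite_measure M by (rule finite_measureI)
  interpret P: pair_sigma_finite M M ..
  have id: "(\<lambda>x. x) \<in> M \<rightarrow>\<^sub>M borel"
    unfolding M_def by (intro measurable_restrict_space1 measurable_lebesgue_if_borel) simp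
  have f [measurable]: "fst \<in> M \<Otimes>\<^sub>M M \<rightarrow>\<^sub>M borel" by (rule measurable_compose[OF measurable_fst id])
  have s [measurable]: "snd \<in> M \<Otimes>\<^sub>M M \<rightarrow>\<^sub>M borel" by (rule measurable_compose[OF measurable_snd id])
  have red: "(LINT y|M. h y) = (LINT y|lebesgue. indicat_real A y *\<^sub>R h y)" for h :: "real^2 \<Rightarrow> real"
    using sA by (simp add: M_def integral_restrict_space)
  have iK: "integrable M (\<lambda>y. 1 / norm (x - y))" for x
    using inverse_dist_integrable(1)[OF A, of x] sA by (simp add: M_def integrable_restrict_space)
  have IK: "(LINT y|M. 1 / norm (x - y)) \<le> (1 + 4 * pi) * sqrt (area A)" for x
    using inverse_dist_integrable(2)[OF A, of x] by (simp add: red)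
  have K: "integrable (M \<Otimes>\<^sub>M M) (\<lambda>p. v p \<bullet> biot_savart_kernel (fst p - snd p))"
    if [measurable]: "v \<in> M \<Otimes>\<^sub>M M \<rightarrow>\<^sub>M borel" and v: "\<And>p. p \<in> space (M \<Otimes>\<^sub>M M) \<Longrightarrow> norm (v p) \<le> r" for v
  proof -
    have "integrable (M \<Otimes>\<^sub>M M) (\<lambda>p. 1 / norm (fst p - snd p))"
    proof (rule P.Fubini_integrable)
      show "(\<lambda>p. 1 / norm (fst p - snd p)) \<in> borel_measurable (M \<Otimes>\<^sub>M M)" by measurable
      have 1: "(\<lambda>x. LINT y|M. norm (1 / norm (fst (x, y) - snd (x, y)))) \<in> borel_measurable M"
        by (rule M.borel_measurable_lebesgue_integral) (simp add: case_prod_beta, measurable)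
      show "integrable M (\<lambda>x. LINT y|M. norm (1 / norm (fst (x, y) - snd (x, y))))"
        by (rule M.integrable_const_bound[OF _ 1, where B = "(1 + 4 * pi) * sqrt (area A)"]) (use IK in \<open>auto intro!: AE_I2\<close>)
      show "AE x in M. integrable M (\<lambda>y. 1 / norm (fst (x, y) - snd (x, y)))" using iK by simp
    qed
    then have "integrable (M \<Otimes>\<^sub>M M) (\<lambda>p. r * (1 / norm (fst p - snd p)))" by (rule integrable_mult_right)
    then show ?thesis
    proof (rule Bochner_Integration.integrable_bound)
      show "(\<lambda>p. v p \<bullet> biot_savart_kernel (fst p - snd p)) \<in> borel_measurable (M \<Otimes>\<^sub>M M)" by measurable
      show "AE p in M \<Otimes>\<^sub>M M. norm (v p \<bullet> biot_savart_kernel (fst p - snd p)) \<le> norm (r * (1 / norm (fst p - snd p)))"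
      proof (rule AE_I2)
        fix p assume p: "p \<in> space (M \<Otimes>\<^sub>M M)"
        have "\<bar>v p \<bullet> biot_savart_kernel (fst p - snd p)\<bar> \<le> norm (v p) * norm (biot_savart_kernel (fst p - snd p))"
          by (rule Cauchy_Schwarz_ineq2)
        also have "\<dots> \<le> r * (1 / norm (fst p - snd p))"
        proof (rule mult_mono)
          have "1 / (2 * pi) * (1 / norm (fst p - snd p)) \<le> 1 * (1 / norm (fst p - snd p))"
            using pi_ge_two by (intro mult_right_mono) (auto simp: divide_simps)
          then show "norm (biot_savart_kernel (fst p - snd p)) \<le> 1 / norm (fst p - snd p)"
            by (simp add: norm_biot_savart_kernel)
        qed (use order_trans[OF norm_ge_zero v[OF p]] v[OF p] in auto)
        finally show "norm (v p \<bullet> biot_savart_kernel (fst p - snd p)) \<le> norm (r * (1 / norm (fst p - snd p)))"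
          by (simp add: abs_if split: if_splits)
      qed
    qed
  qed
  define g where "g p = fst p \<bullet> biot_savart_kernel (fst p - snd p)" for p :: "(real^2) \<times> (real^2)"
  define g' where "g' p = snd p \<bullet> biot_savart_kernel (fst p - snd p)" for p :: "(real^2) \<times> (real^2)"
  have g: "integrable (M \<Otimes>\<^sub>M M) g" unfolding g_def[abs_def]
    by (rule K) (use r in \<open>auto simp: space_pair_measure spM intro: less_imp_le\<close>)
  have g': "integrable (M \<Otimes>\<^sub>M M) g'" unfolding g'_def[abs_def]
    by (rule K) (use r in \<open>auto simp: space_pair_measure spM intro: less_imp_le\<close>)
  have odd: "biot_savart_kernel (x - y) = - biot_savart_kernel (y - x)" for x y
    using linear_neg[OF bounded_linear.linear[OF perp_linear], of "y - x"] by (simp add: biot_savart_kernel_def norm_minus_commute)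
  have orth: "z \<bullet> biot_savart_kernel z = 0" for z
    by (simp add: biot_savart_kernel_def perp_def inner_vec_def UNIV_2)
  have "g = g'"
  proof
    show "g p = g' p" for p using orth[of "fst p - snd p"] by (simp add: g_def g'_def inner_diff_left)
  qed
  then have "integral\<^sup>L (M \<Otimes>\<^sub>M M) g = integral\<^sup>L (M \<Otimes>\<^sub>M M) g'" by simp
  also have "\<dots> = (LINT y|M. LINT x|M. g' (x, y))"
    using P.integral_snd[of "\<lambda>x y. g' (x, y)"] g' by simp
  also have "\<dots> = (LINT y|M. LINT x|M. - g (y, x))"
  proof -
    have "g' (x, y) = - g (y, x)" for x y using odd[of x y] by (simp add: g_def g'_def)
    then show ?thesis by simp
  qed
  also have "\<dots> = - (LINT y|M. LINT x|M. g (y, x))" by simp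
  also have "(LINT y|M. LINT x|M. g (y, x)) = integral\<^sup>L (M \<Otimes>\<^sub>M M) g"
    by (rule P.integral_fst'[OF g])
  finally have zero: "integral\<^sup>L (M \<Otimes>\<^sub>M M) g = 0" by simp
  have inner: "x \<bullet> biot_savart (indicat_real A) x = (LINT y|M. g (x, y))" for x
  proof -
    have "x \<bullet> biot_savart (indicat_real A) x = (LINT y|lebesgue. x \<bullet> (indicat_real A y *\<^sub>R biot_savart_kernel (x - y)))"
      unfolding biot_savart_def
      by (rule integral_bounded_linear[OF bounded_linear_inner_right integrable_kernel[OF A], symmetric])
    then show ?thesis by (simp add: red g_def)
  qed
  have "(LINT x|lebesgue. (x \<bullet> biot_savart (indicat_real A) x) * indicat_real A x) = (LINT x|M. LINT y|M. g (x, y))"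
    by (simp add: red inner mult.commute)
  also have "\<dots> = 0" using zero P.integral_fst'[OF g] by simp
  finally show ?thesis .
qed

text \<open>For \<open>\<eta> \<le> 1\<close> the area is exactly \<open>2 * pi * \<eta>\<close>.  For larger \<open>\<eta>\<close> the inner disc has disappeared and
  the area is \<open>pi * (1 + \<eta>)\<close>.\<close>

lemma measure_annulus_le:
  assumes "\<eta> > 0"
  shows "{x::real^2. \<bar>(norm x)\<^sup>2 - 1\<bar> < \<eta>} \<in> lmeasurable"
    and "area {x::real^2. \<bar>(norm x)\<^sup>2 - 1\<bar> < \<eta>} \<le> 2 * pi * \<eta>"
proof -
  let ?S = "{x::real^2. \<bar>(norm x)\<^sup>2 - 1\<bar> < \<eta>}"
  let ?a = "sqrt (max 0 (1 - \<eta>))" and ?b = "sqrt (1 + \<eta>)"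
  have o: "open ?S" by (intro open_Collect_less continuous_intros)
  have sub: "?S \<subseteq> ball 0 ?b - ball 0 ?a"
  proof
    fix x :: "real^2" assume x: "x \<in> ?S"
    have "norm x < ?b" using x by (intro real_less_rsqrt) auto
    moreover have "?a \<le> norm x" using x by (intro real_le_lsqrt) auto
    ultimately show "x \<in> ball 0 ?b - ball 0 ?a" by simp
  qed
  then have "bounded ?S" by (meson bounded_ball bounded_diff bounded_subset)
  then show lS: "?S \<in> lmeasurable" using o by (rule lmeasurable_open)
  have "area ?S \<le> area (ball (0::real^2) ?b - ball 0 ?a)"
    using sub lS by (intro measure_mono_fmeasurable fmeasurable.Diff) (auto dest: fmeasurableD)
  also have "\<dots> = area (ball (0::real^2) ?b) - area (ball (0::real^2) ?a)"
  proof (rule measurable_measure_Diff)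
    have "?a \<le> ?b" using assms by simp
    then show "ball (0::real^2) ?a \<subseteq> ball 0 ?b" by (rule subset_ball)
  qed auto
  also have "\<dots> = pi * (1 + \<eta>) - pi * max 0 (1 - \<eta>)"
    using measure_ball_plane[of ?b "0::real^2"] measure_ball_plane[of ?a "0::real^2"] assms by simp
  also have "\<dots> = pi * ((1 + \<eta>) - max 0 (1 - \<eta>))" by (simp add: right_diff_distrib)
  also have "\<dots> \<le> pi * (2 * \<eta>)" by (intro mult_left_mono) auto
  finally show "area ?S \<le> 2 * pi * \<eta>" by simp
qed

lemma integrable_bounded_weight:
  fixes g :: "real^2 \<Rightarrow> real"
  assumes A: "A \<in> lmeasurable" and g: "continuous_on UNIV g" and B: "\<And>x. x \<in> A \<Longrightarrow> \<bar>g x\<bar> \<le> B"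
  shows "integrable lebesgue (\<lambda>x. g x * indicat_real A x)"
proof (rule Bochner_Integration.integrable_bound)
  show "integrable lebesgue (\<lambda>x. B * indicat_real A x)" by (intro integrable_mult_right integrable_indicator_lmeasurable A)
  show "(\<lambda>x. g x * indicat_real A x) \<in> borel_measurable lebesgue"
    using A by (intro borel_measurable_times borel_measurable_indicator measurable_lebesgue_if_borel borel_measurable_continuous_onI g)
      (auto dest: fmeasurableD)
  show "AE x in lebesgue. norm (g x * indicat_real A x) \<le> norm (B * indicat_real A x)"
    using B by (intro AE_I2) (auto simp: indicator_def intro: order_trans[OF B abs_ge_self])
qed

text \<open>Area can be moved cheaply only near the unit circle, where the weight vanishes linearly;
  the threshold that balances the two parts is the square root of the weighted area.\<close>

lemma measure_le_sqrt_weighted: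
  fixes B :: "(real^2) set"
  assumes B: "B \<in> lmeasurable" "bounded B"
    and G: "(LINT x|lebesgue. \<bar>(norm x)\<^sup>2 - 1\<bar> * indicat_real B x) \<le> G"
  shows "area B \<le> 8 * sqrt G"
proof -
  obtain r where r: "\<And>x. x \<in> B \<Longrightarrow> norm x \<le> r" using B(2) by (auto simp: bounded_iff)
  have i: "integrable lebesgue (\<lambda>x. \<bar>(norm x)\<^sup>2 - 1\<bar> * indicat_real B x)"
  proof (rule integrable_bounded_weight[OF B(1), of _ "r\<^sup>2 + 1"])
    show "\<bar>\<bar>(norm x)\<^sup>2 - 1\<bar>\<bar> \<le> r\<^sup>2 + 1" if "x \<in> B" for x
      using power_mono[OF r[OF that], of 2] by (simp add: abs_le_iff)
  qed (intro continuous_intros)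
  have "0 \<le> (LINT x|lebesgue. \<bar>(norm x)\<^sup>2 - 1\<bar> * indicat_real B x)" by (intro integral_nonneg_AE AE_I2) auto
  then have G0: "G \<ge> 0" using G by linarith
  have key: "\<eta> * area B \<le> 2 * pi * \<eta>\<^sup>2 + G" if \<eta>: "\<eta> > 0" for \<eta>
  proof -
    let ?S = "{x::real^2. \<bar>(norm x)\<^sup>2 - 1\<bar> < \<eta>}"
    have "(LINT x|lebesgue. \<eta> * indicat_real B x) \<le> (LINT x|lebesgue. \<bar>(norm x)\<^sup>2 - 1\<bar> * indicat_real B x + \<eta> * indicat_real ?S x)"
      using \<eta> by (intro integral_mono Bochner_Integration.integrable_add i integrable_mult_right integrable_indicator_lmeasurable B measure_annulus_le(1))
        (auto simp: indicator_def)
    also have "\<dots> = (LINT x|lebesgue. \<bar>(norm x)\<^sup>2 - 1\<bar> * indicat_real B x) + \<eta> * area ?S"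
      by (subst Bochner_Integration.integral_add)
        (auto intro!: i integrable_mult_right integrable_indicator_lmeasurable measure_annulus_le(1) \<eta>)
    also have "\<dots> \<le> G + \<eta> * (2 * pi * \<eta>)"
      using \<eta> by (intro add_mono G mult_left_mono measure_annulus_le(2)) auto
    finally show ?thesis by (simp add: power2_eq_square algebra_simps)
  qed
  show ?thesis
  proof (cases "G = 0")
    case True
    have "area B \<le> 0 + e" if "e > 0" for e
    proof -
      define \<eta> where "\<eta> = e / (2 * pi)"
      have \<eta>: "\<eta> > 0" using that by (simp add: \<eta>_def)
      have "\<eta> * area B \<le> \<eta> * (2 * pi * \<eta>)" using key[OF \<eta>] True by (simp add: power2_eq_square mult_ac)
      then have "area B \<le> 2 * pi * \<eta>" using \<eta> by simp
      then show ?thesis by (simp add: \<eta>_def)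
    qed
    then show ?thesis using True by (simp add: field_le_epsilon)
  next
    case False
    define \<eta> where "\<eta> = sqrt G"
    have \<eta>: "\<eta> > 0" "\<eta>\<^sup>2 = G" using False G0 by (auto simp: \<eta>_def)
    have "\<eta> * area B \<le> \<eta> * ((2 * pi + 1) * \<eta>)"
      using key[OF \<eta>(1)] \<eta>(2) by (simp add: power2_eq_square algebra_simps)
    then have "area B \<le> (2 * pi + 1) * \<eta>" using \<eta>(1) by simp
    also have "\<dots> \<le> 8 * \<eta>" using pi_approx \<eta>(1) by (intro mult_right_mono) auto
    finally show ?thesis by (simp add: \<eta>_def)
  qed
qed

text \<open>The weight \<open>|x|^2 - 1\<close> is negative exactly inside the disc, where the symmetric difference consists
  of points missing from \<open>A\<close>, and nonnegative outside, where it consists of points of \<open>A\<close>.  Its absolute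
  value on the symmetric difference is thus its product with the difference of the two indicators, which is linear in the indicator of \<open>A\<close>.\<close>

lemma sym_diff_weight:
  fixes A :: "(real^2) set"
  assumes A: "A \<in> lmeasurable" "bounded A"
  shows "(LINT x|lebesgue. \<bar>(norm x)\<^sup>2 - 1\<bar> * indicat_real (sym_diff (ball 0 1) A) x) =
    (LINT x|lebesgue. (norm x)\<^sup>2 * indicat_real A x) - area A
     - (LINT x|lebesgue. ((norm x)\<^sup>2 - 1) * indicat_real (ball (0::real^2) 1) x)"
proof -
  obtain r where r: "\<And>x. x \<in> A \<Longrightarrow> norm x \<le> r" using A(2) by (auto simp: bounded_iff)
  have i1: "integrable lebesgue (\<lambda>x. (norm x)\<^sup>2 * indicat_real A x)"
    by (rule integrable_bounded_weight[OF A(1), of _ "r\<^sup>2"]) (auto intro!: continuous_intros power_mono r)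
  have i2: "integrable lebesgue (\<lambda>x::real^2. ((norm x)\<^sup>2 - 1) * indicat_real (ball 0 1) x)"
    by (rule integrable_bounded_weight[of _ _ 1]) (auto intro!: continuous_intros simp: abs_le_iff power_le_one)
  have "(LINT x|lebesgue. \<bar>(norm x)\<^sup>2 - 1\<bar> * indicat_real (sym_diff (ball 0 1) A) x) =
     (LINT x|lebesgue. (norm x)\<^sup>2 * indicat_real A x - indicat_real A x - ((norm x)\<^sup>2 - 1) * indicat_real (ball 0 1) x)"
  proof (intro Bochner_Integration.integral_cong refl)
    fix x :: "real^2"
    have "(norm x)\<^sup>2 < 1 \<longleftrightarrow> norm x < 1" using abs_square_less_1[of "norm x"] by simp
    then show "\<bar>(norm x)\<^sup>2 - 1\<bar> * indicat_real (sym_diff (ball 0 1) A) x =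
      (norm x)\<^sup>2 * indicat_real A x - indicat_real A x - ((norm x)\<^sup>2 - 1) * indicat_real (ball 0 1) x"
      by (auto simp: indicator_def)
  qed
  also have "\<dots> = (LINT x|lebesgue. (norm x)\<^sup>2 * indicat_real A x) - area A
     - (LINT x|lebesgue. ((norm x)\<^sup>2 - 1) * indicat_real (ball (0::real^2) 1) x)"
    by (simp add: Bochner_Integration.integral_diff Bochner_Integration.integrable_diff i1 i2 integrable_indicator_lmeasurable A)
  finally show ?thesis .
qed

context patch
begin

lemma area_conserved: assumes "t \<ge> 0" shows "area (\<Omega> t) = area \<Omega>0"
proof (cases "t = 0")
  case False
  then have "t > 0" using assms by simp
  from weak_evolution[OF this, of "\<lambda>_. 1" "\<lambda>_ _. 0"] show ?thesis
    by (simp add: set_lebesgue_integral_def)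
qed simp

lemma \<Omega>_bounded: assumes "t \<ge> 0" shows "bounded (\<Omega> t)"
proof -
  obtain r where "\<Omega> t \<subseteq> ball 0 r" using \<Omega>_bounded_ex[of t] assms by (meson atLeastAtMost_iff order_refl)
  then show ?thesis by (rule bounded_subset[OF bounded_ball])
qed

lemma moment_conserved:
  assumes "t \<ge> 0"
  shows "(LINT x|lebesgue. (norm x)\<^sup>2 * indicat_real (\<Omega> t) x) = (LINT x|lebesgue. (norm x)\<^sup>2 * indicat_real \<Omega>0 x)"
proof (cases "t = 0")
  case False
  then have t: "t > 0" using assms by simp
  have "(LINT x|lebesgue. (norm x)\<^sup>2 * indicat_real (\<Omega> t) x) - (LINT x|lebesgue. (norm x)\<^sup>2 * indicat_real \<Omega>0 x) =
     (LINT \<tau>:{0..t}|lebesgue. LINT x|lebesgue. (2 * (x \<bullet> u \<tau> x)) * indicat_real (\<Omega> \<tau>) x)"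
  proof (rule weak_evolution[OF t])
    show "((\<lambda>x. (norm x)\<^sup>2) has_derivative (\<lambda>h. 2 * (x \<bullet> h))) (at x)" for x :: "real^2"
      unfolding power2_norm_eq_inner by (auto intro!: derivative_eq_intros simp: inner_commute)
  qed (intro continuous_intros)
  also have "\<dots> = (LINT \<tau>:{0..t}|lebesgue. 0)"
  proof (rule set_lebesgue_integral_cong)
    show "\<forall>\<tau>. \<tau> \<in> {0..t} \<longrightarrow> (LINT x|lebesgue. (2 * (x \<bullet> u \<tau> x)) * indicat_real (\<Omega> \<tau>) x) = 0"
    proof (intro allI impI)
      fix \<tau> assume \<tau>: "\<tau> \<in> {0..t}"
      obtain r where r: "\<Omega> \<tau> \<subseteq> ball 0 r" using \<Omega>_bounded_ex[of t] \<tau> by blast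
      have "(LINT x|lebesgue. (2 * (x \<bullet> u \<tau> x)) * indicat_real (\<Omega> \<tau>) x) =
         2 * (LINT x|lebesgue. (x \<bullet> biot_savart (indicat_real (\<Omega> \<tau>)) x) * indicat_real (\<Omega> \<tau>) x)"
        using \<tau> by (simp add: u_eq mult.assoc)
      also have "\<dots> = 0" using self_torque_zero[OF \<Omega>_lmeasurable r] \<tau> by simp
      finally show "(LINT x|lebesgue. (2 * (x \<bullet> u \<tau> x)) * indicat_real (\<Omega> \<tau>) x) = 0" .
    qed
  qed simp
  also have "\<dots> = 0" by (simp add: set_lebesgue_integral_def)
  finally show ?thesis by simp
qed simp

definition \<delta> :: real where "\<delta> = area (sym_diff (ball 0 1) \<Omega>0)"

lemma \<delta>_nonneg: "\<delta> \<ge> 0" by (simp add: \<delta>_def)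

text \<open>The weighted area of the symmetric difference keeps its initial value, which is at most
  \<open>(R^2 + 1) * \<delta>\<close> because the initial set lies in the disc of radius \<open>R\<close>.\<close>

lemma disc_stability:
  assumes "t \<ge> 0"
  shows "area (sym_diff (ball 0 1) (\<Omega> t)) \<le> 8 * sqrt ((R\<^sup>2 + 1) * \<delta>)"
proof (rule measure_le_sqrt_weighted)
  show "sym_diff (ball 0 1) (\<Omega> t) \<in> lmeasurable"
    by (intro fmeasurable.Un fmeasurable.Diff lmeasurable_ball \<Omega>_lmeasurable assms)
  show "bounded (sym_diff (ball 0 1) (\<Omega> t))"
    using \<Omega>_bounded[OF assms] by (intro bounded_Un[THEN iffD2] conjI bounded_diff) auto
  have b0: "bounded \<Omega>0" using in_ball by (rule bounded_subset[OF bounded_ball])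
  have S0: "sym_diff (ball 0 1) \<Omega>0 \<in> lmeasurable"
    by (intro fmeasurable.Un fmeasurable.Diff lmeasurable_ball \<Omega>0_lmeasurable)
  have w0: "\<bar>(norm x)\<^sup>2 - 1\<bar> \<le> R\<^sup>2 + 1" if "x \<in> sym_diff (ball 0 1) \<Omega>0" for x
  proof -
    have "norm x < 1 \<or> norm x < R" using that in_ball by auto
    then have "(norm x)\<^sup>2 \<le> 1 \<or> (norm x)\<^sup>2 \<le> R\<^sup>2"
      using power_mono[of "norm x" 1 2] power_mono[of "norm x" R 2] by auto
    moreover have "0 \<le> (norm x)\<^sup>2" "0 \<le> R\<^sup>2" by simp_all
    ultimately show ?thesis unfolding abs_le_iff by linarith
  qed
  have "(LINT x|lebesgue. \<bar>(norm x)\<^sup>2 - 1\<bar> * indicat_real (sym_diff (ball 0 1) (\<Omega> t)) x) =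
     (LINT x|lebesgue. \<bar>(norm x)\<^sup>2 - 1\<bar> * indicat_real (sym_diff (ball 0 1) \<Omega>0) x)"
    by (simp add: sym_diff_weight \<Omega>_lmeasurable \<Omega>_bounded \<Omega>0_lmeasurable b0 assms area_conserved moment_conserved)
  also have "\<dots> \<le> (LINT x|lebesgue. (R\<^sup>2 + 1) * indicat_real (sym_diff (ball 0 1) \<Omega>0) x)"
  proof (intro integral_mono integrable_mult_right integrable_indicator_lmeasurable S0)
    show "integrable lebesgue (\<lambda>x. \<bar>(norm x)\<^sup>2 - 1\<bar> * indicat_real (sym_diff (ball 0 1) \<Omega>0) x)"
      by (rule integrable_bounded_weight[OF S0, of _ "R\<^sup>2 + 1"]) (use w0 in \<open>auto intro!: continuous_intros\<close>)
    show "\<bar>(norm x)\<^sup>2 - 1\<bar> * indicat_real (sym_diff (ball 0 1) \<Omega>0) x \<le> (R\<^sup>2 + 1) * indicat_real (sym_diff (ball 0 1) \<Omega>0) x" for x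
      using w0[of x] by (auto simp: indicator_def)
  qed
  also have "\<dots> = (R\<^sup>2 + 1) * \<delta>" by (simp add: \<delta>_def)
  finally show "(LINT x|lebesgue. \<bar>(norm x)\<^sup>2 - 1\<bar> * indicat_real (sym_diff (ball 0 1) (\<Omega> t)) x) \<le> (R\<^sup>2 + 1) * \<delta>" .
qed

definition speed :: real where "speed = 3 * sqrt (area \<Omega>0)"

lemma speed_nonneg: "speed \<ge> 0" by (simp add: speed_def)

lemma u_le_speed: "t \<ge> 0 \<Longrightarrow> norm (u t x) \<le> speed"
  using u_bound[of t x] by (simp add: area_conserved speed_def)

lemma flow_lipschitz: assumes "0 \<le> s" "s \<le> t" shows "norm (\<phi> x t - \<phi> x s) \<le> (t - s) * speed"
proof -
  have "norm (\<phi> x t - \<phi> x s - (t - s) *\<^sub>R 0) \<le> (t - s) * speed"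
    using assms by (intro flow_increment) (auto intro: u_le_speed)
  then show ?thesis by simp
qed

lemma u_close_to_rotation:
  assumes "t \<ge> 0" "norm x < 1"
  shows "norm (u t x - (1 / 2) *\<^sub>R perp x) \<le> 3 * sqrt (8 * sqrt ((R\<^sup>2 + 1) * \<delta>))"
proof -
  have "norm (u t x - (1 / 2) *\<^sub>R perp x) = norm (biot_savart (indicat_real (ball 0 1)) x - biot_savart (indicat_real (\<Omega> t)) x)"
    using assms by (simp add: u_eq biot_savart_disc norm_minus_commute)
  also have "\<dots> \<le> 3 * sqrt (area (sym_diff (ball 0 1) (\<Omega> t)))"
    by (intro biot_savart_diff_le \<Omega>_lmeasurable assms lmeasurable_ball)
  also have "\<dots> \<le> 3 * sqrt (8 * sqrt ((R\<^sup>2 + 1) * \<delta>))" using disc_stability[OF assms(1)] by simp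
  finally show ?thesis .
qed

end

section \<open>Preimages under the flow\<close>

lemma lipschitz_time_space_continuous:
  fixes F :: "real \<Rightarrow> 'a::real_normed_vector \<Rightarrow> 'b::real_normed_vector"
  assumes space: "\<And>t x y. t \<ge> 0 \<Longrightarrow> norm (F t x - F t y) \<le> L * norm (x - y)"
    and time: "\<And>s t x. 0 \<le> s \<Longrightarrow> s \<le> t \<Longrightarrow> norm (F t x - F s x) \<le> C * (t - s)"
    and nn: "L \<ge> 0" "C \<ge> 0"
  shows "continuous_on ({0..} \<times> UNIV) (\<lambda>(t, x). F t x)"
proof (rule lipschitz_on_continuous_on[where L = "L + C"], rule lipschitz_onI)
  fix p q :: "real \<times> 'a" assume "p \<in> {0..} \<times> UNIV" "q \<in> {0..} \<times> UNIV"
  then obtain t x s y where p: "p = (t, x)" "t \<ge> 0" and q: "q = (s, y)" "s \<ge> 0" by auto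
  have time': "norm (F t y - F s y) \<le> C * \<bar>t - s\<bar>"
    using time[of s t y] time[of t s y] p q by (cases "s \<le> t") (auto simp: norm_minus_commute)
  have "norm (F t x - F s y) \<le> norm (F t x - F t y) + norm (F t y - F s y)"
    using norm_triangle_ineq[of "F t x - F t y" "F t y - F s y"] by simp
  also have "\<dots> \<le> L * norm (x - y) + C * \<bar>t - s\<bar>" by (intro add_mono space time' p)
  also have "\<dots> \<le> L * dist p q + C * dist p q"
    using norm_snd_le[of "x - y" "t - s"] norm_fst_le[of "t - s" "x - y"] nn p q
    by (intro add_mono mult_left_mono) (auto simp: dist_norm)
  finally show "dist (case p of (t, x) \<Rightarrow> F t x) (case q of (t, x) \<Rightarrow> F t x) \<le> (L + C) * dist p q"
    by (simp add: p q dist_norm algebra_simps)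
qed (use nn in auto)

lemma continuous_on_if_approximable:
  fixes f :: "'a::metric_space \<Rightarrow> 'b::real_normed_vector"
  assumes "\<And>\<epsilon>. \<epsilon> > 0 \<Longrightarrow> \<exists>g. continuous_on S g \<and> (\<forall>x\<in>S. norm (g x - f x) < \<epsilon>)"
  shows "continuous_on S f"
proof -
  have "\<exists>g. continuous_on S g \<and> (\<forall>x\<in>S. norm (g x - f x) < 1 / real (Suc n))" for n
    by (rule assms) simp
  then obtain g where g: "\<And>n. continuous_on S (g n)" "\<And>n x. x \<in> S \<Longrightarrow> norm (g n x - f x) < 1 / real (Suc n)"
    by metis
  have "uniform_limit S g f sequentially"
  proof (rule uniform_limitI)
    fix e :: real assume "e > 0"
    then obtain N where N: "1 / real (Suc N) < e" using nat_approx_posE by blast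
    show "\<forall>\<^sub>F n in sequentially. \<forall>x\<in>S. dist (g n x) (f x) < e"
      using eventually_ge_at_top[of N]
    proof eventually_elim
      case (elim n)
      have "1 / real (Suc n) \<le> 1 / real (Suc N)" using elim by (intro frac_le) auto
      then show ?case using g(2)[of _ n] N by (force simp: dist_norm)
    qed
  qed
  then show ?thesis
    by (intro uniform_limit_theorem[of _ g]) (auto simp: g)
qed

context patch
begin

text \<open>The components of the mollified kernel are smooth functions with bounded gradient, so they may be
  inserted into the weak formulation.  The constant depends on \<open>e\<close>; this is harmless since the step
  of the Euler scheme is chosen after \<open>e\<close>.\<close>

lemma reg_velocity_time_lipschitz:
  assumes e: "e > 0" and st: "0 \<le> s" "s \<le> t"
  shows "norm (reg_velocity e (\<Omega> t) x - reg_velocity e (\<Omega> s) x) \<le> 2 * (1 / e\<^sup>2 * speed * area \<Omega>0) * (t - s)"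
proof -
  have component: "\<bar>(reg_velocity e (\<Omega> t) x - reg_velocity e (\<Omega> s) x) $ i\<bar> \<le> (1 / e\<^sup>2 * speed) * area \<Omega>0 * (t - s)" for i
  proof -
    let ?f = "\<lambda>z. reg_kernel e (x - z) $ i" and ?f' = "\<lambda>z h. - (reg_kernel_deriv e (x - z) h $ i)"
    have eq: "reg_velocity e (\<Omega> \<tau>) x $ i = (LINT z|lebesgue. ?f z * indicat_real (\<Omega> \<tau>) z)" if "\<tau> \<ge> 0" for \<tau>
      unfolding reg_velocity_def
      using integral_bounded_linear[OF bounded_linear_vec_nth integrable_reg_kernel[OF e \<Omega>_lmeasurable[OF that]], of x i]
      by (simp add: mult.commute)
    have lin: "bounded_linear (reg_kernel_deriv e z)" for z
      by (rule has_derivative_bounded_linear[OF reg_kernel_has_derivative[OF e]])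
    have "\<bar>(LINT z|lebesgue. ?f z * indicat_real (\<Omega> t) z) - (LINT z|lebesgue. ?f z * indicat_real (\<Omega> s) z)\<bar>
      \<le> (1 / e\<^sup>2 * speed) * area \<Omega>0 * (t - s)"
    proof (rule weak_evolution_lipschitz[OF st])
      show "(?f has_derivative ?f' z) (at z)" for z
      proof -
        have "((\<lambda>z. x - z) has_derivative (\<lambda>h. - h)) (at z)" by (auto intro!: derivative_eq_intros)
        from bounded_linear.has_derivative[OF bounded_linear_vec_nth has_derivative_compose[OF this reg_kernel_has_derivative[OF e]], of i]
        show ?thesis by (simp add: linear_neg[OF bounded_linear.linear[OF lin]])
      qed
      show "continuous_on UNIV (\<lambda>z. ?f' z h)" for h
        by (intro continuous_intros continuous_on_compose2[OF continuous_on_reg_kernel_deriv[OF e]]) auto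
      show "\<bar>?f' z (u \<tau> z)\<bar> \<le> 1 / e\<^sup>2 * speed" if "\<tau> \<in> {0..t}" for \<tau> z
      proof -
        have "\<bar>?f' z (u \<tau> z)\<bar> \<le> norm (reg_kernel_deriv e (x - z) (u \<tau> z))"
          using component_le_norm_cart by simp
        also have "\<dots> \<le> 1 / e\<^sup>2 * norm (u \<tau> z)" by (rule norm_reg_kernel_deriv_le_const[OF e])
        also have "\<dots> \<le> 1 / e\<^sup>2 * speed" using u_le_speed that by (intro mult_left_mono) auto
        finally show ?thesis .
      qed
      show "0 \<le> 1 / e\<^sup>2 * speed" using speed_nonneg by simp
      show "area (\<Omega> \<tau>) \<le> area \<Omega>0" if "\<tau> \<in> {0..t}" for \<tau>
        using that by (simp add: area_conserved)
    qed
    then show ?thesis using st by (simp add: eq)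
  qed
  have "norm (reg_velocity e (\<Omega> t) x - reg_velocity e (\<Omega> s) x) \<le>
     \<bar>(reg_velocity e (\<Omega> t) x - reg_velocity e (\<Omega> s) x) $ 1\<bar> + \<bar>(reg_velocity e (\<Omega> t) x - reg_velocity e (\<Omega> s) x) $ 2\<bar>"
    using norm_le_l1_cart[of "reg_velocity e (\<Omega> t) x - reg_velocity e (\<Omega> s) x"] unfolding sum_2 .
  also have "\<dots> \<le> 2 * (1 / e\<^sup>2 * speed * area \<Omega>0) * (t - s)"
    using component[of 1] component[of 2] by simp
  finally show ?thesis .
qed

text \<open>The Lipschitz constant in space of the velocity mollified at scale \<open>2 ^ (-p)\<close>; it does not depend on time because area
  is conserved.\<close>

definition Lip :: "nat \<Rightarrow> real" where "Lip p = area \<Omega>0 + 4 * pi * (p + 1)"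

lemma Lip_pos: "Lip p > 0"
  unfolding Lip_def by (intro add_nonneg_pos mult_pos_pos) auto

lemma reg_velocity_space_lipschitz:
  "t \<ge> 0 \<Longrightarrow> norm (reg_velocity (1 / 2 ^ p) (\<Omega> t) x - reg_velocity (1 / 2 ^ p) (\<Omega> t) y) \<le> Lip p * norm (x - y)"
  using reg_velocity_lipschitz[OF \<Omega>_lmeasurable, of t p x y] by (simp add: area_conserved Lip_def)

lemma u_diff_reg_velocity:
  "t \<ge> 0 \<Longrightarrow> norm (u t x - reg_velocity (1 / 2 ^ p) (\<Omega> t) x) \<le> (6 + area \<Omega>0) * sqrt (1 / 2 ^ p)"
  using biot_savart_diff_reg_velocity[of "1 / 2 ^ p" "\<Omega> t" x] by (simp add: \<Omega>_lmeasurable u_eq area_conserved)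

lemma velocity_continuous: "continuous_on ({0..} \<times> UNIV) (\<lambda>(t, x). u t x)"
proof (rule continuous_on_if_approximable)
  fix \<epsilon> :: real assume \<epsilon>: "\<epsilon> > 0"
  define m where "m = 6 + area \<Omega>0"
  have m: "m > 0" by (simp add: m_def add_pos_nonneg)
  obtain p where p: "(1 / 2) ^ p < (\<epsilon> / m)\<^sup>2"
    using real_arch_pow_inv[of "(\<epsilon> / m)\<^sup>2" "1 / 2"] \<epsilon> m by auto
  have "sqrt (1 / 2 ^ p) < \<epsilon> / m"
    using p \<epsilon> m by (intro real_less_lsqrt) (auto simp: power_one_over)
  then have small: "m * sqrt (1 / 2 ^ p) < \<epsilon>" using m by (simp add: field_simps)
  show "\<exists>g. continuous_on ({0..} \<times> UNIV) g \<and> (\<forall>q\<in>{0..} \<times> UNIV. norm (g q - (case q of (t, x) \<Rightarrow> u t x)) < \<epsilon>)"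
  proof (intro exI conjI ballI)
    show "continuous_on ({0..} \<times> UNIV) (\<lambda>(t, x). reg_velocity (1 / 2 ^ p) (\<Omega> t) x)"
      by (rule lipschitz_time_space_continuous[OF reg_velocity_space_lipschitz reg_velocity_time_lipschitz])
        (use Lip_pos[of p] speed_nonneg in auto)
    fix q :: "real \<times> (real^2)" assume "q \<in> {0..} \<times> UNIV"
    then show "norm ((case q of (t, x) \<Rightarrow> reg_velocity (1 / 2 ^ p) (\<Omega> t) x) - (case q of (t, x) \<Rightarrow> u t x)) < \<epsilon>"
      using u_diff_reg_velocity[of "fst q" "snd q" p] small by (auto simp: norm_minus_commute m_def)
  qed
qed

text \<open>The explicit Euler scheme with \<open>k\<close> steps of length \<open>h\<close> for the mollified velocity, started at time \<open>s\<close>.\<close>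

primrec euler :: "real \<Rightarrow> real \<Rightarrow> real \<Rightarrow> nat \<Rightarrow> real^2 \<Rightarrow> real^2" where
  "euler e s h 0 y = y"
| "euler e s h (Suc k) y = euler e s h k y + h *\<^sub>R reg_velocity e (\<Omega> (s + real k * h)) (euler e s h k y)"

lemma euler_continuous:
  assumes "s \<ge> 0" "h \<ge> 0"
  shows "continuous_on UNIV (euler (1 / 2 ^ p) s h k)"
proof (induction k)
  case 0
  have "euler (1 / 2 ^ p) s h 0 = (\<lambda>y. y)" by (rule ext) simp
  then show ?case by simp
next
  case (Suc k)
  have c: "continuous_on UNIV (reg_velocity (1 / 2 ^ p) (\<Omega> (s + real k * h)))"
    using reg_velocity_has_derivative[OF _ \<Omega>_lmeasurable, of "1 / 2 ^ p" "s + real k * h"] assms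
    by (auto intro!: continuous_at_imp_continuous_on has_derivative_continuous)
  have "euler (1 / 2 ^ p) s h (Suc k) = (\<lambda>y. euler (1 / 2 ^ p) s h k y + h *\<^sub>R reg_velocity (1 / 2 ^ p) (\<Omega> (s + real k * h)) (euler (1 / 2 ^ p) s h k y))"
    by (rule ext) simp
  then show ?case by (auto intro!: continuous_intros Suc continuous_on_compose2[OF c Suc])
qed

text \<open>Each step contributes a factor that differs from one by a multiple of \<open>h^2\<close>.\<close>

lemma euler_vimage:
  assumes s: "s \<ge> 0" and h: "h \<ge> 0" "h * Lip p \<le> 1 / 2" and U: "open U" "bounded U"
  shows "open (euler (1 / 2 ^ p) s h k -` U) \<and> bounded (euler (1 / 2 ^ p) s h k -` U) \<and>
    (1 - 2 * (h * Lip p)\<^sup>2) ^ k * area (euler (1 / 2 ^ p) s h k -` U) \<le> area U"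
  using U
proof (induction k arbitrary: U)
  case 0
  have "euler (1 / 2 ^ p) s h 0 -` U = U" by auto
  then show ?case using 0 by simp
next
  case (Suc k)
  let ?v = "reg_velocity (1 / 2 ^ p) (\<Omega> (s + real k * h))"
  let ?v' = "reg_velocity_deriv (1 / 2 ^ p) (\<Omega> (s + real k * h))"
  let ?E = "\<lambda>x. x + h *\<^sub>R ?v x"
  have t: "s + real k * h \<ge> 0" using s h by simp
  note lm = \<Omega>_lmeasurable[OF t]
  have e: "(1::real) / 2 ^ p > 0" by simp
  note E = measure_vimage_euler_step[where v = ?v and v' = ?v' and L = "Lip p" and \<eta> = h and U = U
      and M = "area (\<Omega> (s + real k * h)) / (1 / 2 ^ p)"]
  have E1: "open (?E -` U)" "bounded (?E -` U)" "(1 - 2 * (h * Lip p)\<^sup>2) * area (?E -` U) \<le> area U"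
    by (rule E; (rule reg_velocity_has_derivative[OF e lm] reg_velocity_deriv_trace[OF e lm] norm_reg_velocity_le[OF e lm] h Suc.prems)?;
      use norm_reg_velocity_deriv_le[OF lm, of p] area_conserved[OF t] in \<open>simp add: Lip_def\<close>)+
  have eq: "euler (1 / 2 ^ p) s h (Suc k) -` U = euler (1 / 2 ^ p) s h k -` (?E -` U)" by auto
  note IH = Suc.IH[OF E1(1,2)]
  have q: "0 \<le> 1 - 2 * (h * Lip p)\<^sup>2"
  proof -
    have "(h * Lip p)\<^sup>2 \<le> (1 / 2)\<^sup>2" using h Lip_pos[of p] by (intro power_mono) auto
    then show ?thesis by (simp add: power2_eq_square)
  qed
  have "(1 - 2 * (h * Lip p)\<^sup>2) ^ Suc k * area (euler (1 / 2 ^ p) s h (Suc k) -` U)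
     = (1 - 2 * (h * Lip p)\<^sup>2) * ((1 - 2 * (h * Lip p)\<^sup>2) ^ k * area (euler (1 / 2 ^ p) s h k -` (?E -` U)))"
    unfolding eq by simp
  also have "\<dots> \<le> (1 - 2 * (h * Lip p)\<^sup>2) * area (?E -` U)"
    using IH q by (intro mult_left_mono) auto
  also have "\<dots> \<le> area U" by (rule E1(3))
  finally show ?case using IH unfolding eq by blast
qed

text \<open>The difference between the velocity along a trajectory during a step of length \<open>h\<close> and the velocity
  used by the Euler step: mollification, motion of the particle, and change of the field in time.\<close>

definition scheme_error :: "nat \<Rightarrow> real \<Rightarrow> real" where
  "scheme_error p h = (6 + area \<Omega>0) * sqrt (1 / 2 ^ p)
     + (Lip p * speed + 2 * (1 / (1 / 2 ^ p)\<^sup>2 * speed * area \<Omega>0)) * h"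

lemma scheme_error_nonneg: "h \<ge> 0 \<Longrightarrow> scheme_error p h \<ge> 0"
  unfolding scheme_error_def using Lip_pos[of p] speed_nonneg
  by (intro add_nonneg_nonneg mult_nonneg_nonneg) auto

lemma euler_consistency:
  assumes a: "a \<ge> 0" and h: "h \<ge> 0"
  shows "norm (\<phi> x (a + h) - \<phi> x a - h *\<^sub>R reg_velocity (1 / 2 ^ p) (\<Omega> a) (\<phi> x a)) \<le> h * scheme_error p h"
proof -
  let ?U = "\<lambda>\<tau>. reg_velocity (1 / 2 ^ p) (\<Omega> \<tau>)"
  have "norm (\<phi> x (a + h) - \<phi> x a - ((a + h) - a) *\<^sub>R ?U a (\<phi> x a)) \<le> ((a + h) - a) * scheme_error p h"
  proof (rule flow_increment)
    fix \<tau> assume "\<tau> \<in> {a<..<a + h}"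
    then have \<tau>: "a \<le> \<tau>" "\<tau> \<le> a + h" "\<tau> \<ge> 0" using a by auto
    have e: "(1::real) / 2 ^ p > 0" by simp
    have "norm (\<phi> x \<tau> - \<phi> x a) \<le> (\<tau> - a) * speed" by (rule flow_lipschitz) (use a \<tau> in auto)
    also have "\<dots> \<le> h * speed" using \<tau> speed_nonneg by (intro mult_right_mono) auto
    finally have mv: "norm (\<phi> x \<tau> - \<phi> x a) \<le> h * speed" .
    have 1: "norm (u \<tau> (\<phi> x \<tau>) - ?U \<tau> (\<phi> x \<tau>)) \<le> (6 + area \<Omega>0) * sqrt (1 / 2 ^ p)"
      by (rule u_diff_reg_velocity[OF \<tau>(3)])
    have 2: "norm (?U \<tau> (\<phi> x \<tau>) - ?U \<tau> (\<phi> x a)) \<le> Lip p * (h * speed)"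
      using reg_velocity_space_lipschitz[OF \<tau>(3)] mult_left_mono[OF mv less_imp_le[OF Lip_pos[of p]]] order_trans by blast
    have "norm (?U \<tau> (\<phi> x a) - ?U a (\<phi> x a)) \<le> 2 * (1 / (1 / 2 ^ p)\<^sup>2 * speed * area \<Omega>0) * (\<tau> - a)"
      by (rule reg_velocity_time_lipschitz[OF e a \<tau>(1)])
    also have "\<dots> \<le> 2 * (1 / (1 / 2 ^ p)\<^sup>2 * speed * area \<Omega>0) * h"
      using \<tau> speed_nonneg by (intro mult_left_mono) auto
    finally have 3: "norm (?U \<tau> (\<phi> x a) - ?U a (\<phi> x a)) \<le> 2 * (1 / (1 / 2 ^ p)\<^sup>2 * speed * area \<Omega>0) * h" .
    have "u \<tau> (\<phi> x \<tau>) - ?U a (\<phi> x a) = (u \<tau> (\<phi> x \<tau>) - ?U \<tau> (\<phi> x \<tau>)) + (?U \<tau> (\<phi> x \<tau>) - ?U \<tau> (\<phi> x a)) + (?U \<tau> (\<phi> x a) - ?U a (\<phi> x a))"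
      by simp
    also have "norm \<dots> \<le> (6 + area \<Omega>0) * sqrt (1 / 2 ^ p) + Lip p * (h * speed) + 2 * (1 / (1 / 2 ^ p)\<^sup>2 * speed * area \<Omega>0) * h"
      by (intro norm_triangle_mono 1 2 3)
    also have "\<dots> = scheme_error p h" by (simp add: scheme_error_def algebra_simps)
    finally show "norm (u \<tau> (\<phi> x \<tau>) - ?U a (\<phi> x a)) \<le> scheme_error p h" .
  qed (use a h in auto)
  then show ?thesis by simp
qed

text \<open>The discrete Gronwall inequality; each step multiplies the error by \<open>1 + h * Lip p\<close> and adds
  \<open>h * scheme_error p h\<close>.\<close>

lemma euler_error:
  assumes s: "s \<ge> 0" and h: "h \<ge> 0"
  shows "norm (euler (1 / 2 ^ p) s h k (\<phi> x s) - \<phi> x (s + real k * h)) \<le> real k * h * scheme_error p h * (1 + h * Lip p) ^ k"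
proof (induction k)
  case (Suc k)
  define z where "z = euler (1 / 2 ^ p) s h k (\<phi> x s)"
  define a where "a = s + real k * h"
  let ?U = "reg_velocity (1 / 2 ^ p) (\<Omega> a)" and ?q = "1 + h * Lip p"
  have a: "a \<ge> 0" using s h by (simp add: a_def)
  have a': "s + real (Suc k) * h = a + h" by (simp add: a_def algebra_simps)
  have q: "?q \<ge> 1" using h Lip_pos[of p] by simp
  have IH: "norm (z - \<phi> x a) \<le> real k * h * scheme_error p h * ?q ^ k" using Suc by (simp add: z_def a_def)
  have "euler (1 / 2 ^ p) s h (Suc k) (\<phi> x s) - \<phi> x (s + real (Suc k) * h) =
     (z - \<phi> x a) + h *\<^sub>R (?U z - ?U (\<phi> x a)) + - (\<phi> x (a + h) - \<phi> x a - h *\<^sub>R ?U (\<phi> x a))"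
    unfolding a' by (simp add: z_def a_def algebra_simps)
  also have "norm \<dots> \<le> norm (z - \<phi> x a) + h * (Lip p * norm (z - \<phi> x a)) + h * scheme_error p h"
  proof (intro norm_triangle_mono)
    show "norm (h *\<^sub>R (?U z - ?U (\<phi> x a))) \<le> h * (Lip p * norm (z - \<phi> x a))"
      using reg_velocity_space_lipschitz[OF a, of p z "\<phi> x a"] h by (simp add: mult_left_mono)
    show "norm (- (\<phi> x (a + h) - \<phi> x a - h *\<^sub>R ?U (\<phi> x a))) \<le> h * scheme_error p h"
      unfolding norm_minus_cancel by (rule euler_consistency[OF a h])
  qed simp
  also have "\<dots> = norm (z - \<phi> x a) * ?q + h * scheme_error p h" by (simp add: algebra_simps)
  also have "\<dots> \<le> (real k * h * scheme_error p h * ?q ^ k) * ?q + h * scheme_error p h * ?q ^ Suc k"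
  proof (intro add_mono mult_right_mono IH)
    have "h * scheme_error p h * 1 \<le> h * scheme_error p h * ?q ^ Suc k"
      using q h scheme_error_nonneg[OF h] by (intro mult_left_mono one_le_power) auto
    then show "h * scheme_error p h \<le> h * scheme_error p h * ?q ^ Suc k" by simp
  qed (use q in simp)
  also have "\<dots> = real (Suc k) * h * scheme_error p h * ?q ^ Suc k" by (simp add: algebra_simps)
  finally show ?case .
qed simp

text \<open>Up to this time the Gronwall factor \<open>exp (Lip p * t)\<close> grows more slowly in \<open>p\<close> than the
  mollification error decays.\<close>

definition short_time :: real where "short_time = 1 / (4 * (area \<Omega>0 + 4 * pi))"

lemma short_time_pos: "short_time > 0"
  by (simp add: short_time_def add_nonneg_pos)

lemma Lip_short_time: "Lip p * short_time \<le> (real p + 1) / 4"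
proof -
  have "Lip p \<le> (area \<Omega>0 + 4 * pi) * (real p + 1)"
    unfolding Lip_def by (simp add: algebra_simps)
  then have "Lip p * short_time \<le> (area \<Omega>0 + 4 * pi) * (real p + 1) * short_time"
    using short_time_pos by (intro mult_right_mono) auto
  also have "\<dots> = (real p + 1) / 4"
  proof -
    have "area \<Omega>0 + 4 * pi > 0" by (simp add: add_nonneg_pos)
    then show ?thesis by (simp add: short_time_def field_simps)
  qed
  finally show ?thesis .
qed

text \<open>The product is a multiple of the \<open>p\<close>-th power of \<open>sqrt (1/2) * exp (1/4)\<close>, which is less than one
  because \<open>exp (1/2) < 2\<close>.\<close>

lemma mollification_beats_gronwall:
  "(\<lambda>p. c * (sqrt (1 / 2 ^ p) * exp ((real p + 1) / 4))) \<longlonglongrightarrow> 0"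
proof -
  define \<rho> where "\<rho> = sqrt (1 / 2) * exp (1 / 4 :: real)"
  have "exp (1 / 2 :: real) \<le> 1 + 1 / 2 + (1 / 2)\<^sup>2" by (rule exp_bound) auto
  then have "exp (1 / 2 :: real) < 2" by (simp add: power2_eq_square)
  moreover have "\<rho>\<^sup>2 = 1 / 2 * exp (1 / 2)"
    by (simp add: \<rho>_def power_mult_distrib exp_double[symmetric])
  ultimately have "\<rho>\<^sup>2 < 1" by simp
  then have "\<bar>\<rho>\<bar> < 1" by (simp add: abs_square_less_1)
  then have "(\<lambda>p. \<rho> ^ p) \<longlonglongrightarrow> 0" by (intro LIMSEQ_power_zero) simp
  then have lim: "(\<lambda>p. c * exp (1 / 4) * \<rho> ^ p) \<longlonglongrightarrow> c * exp (1 / 4) * 0" by (intro tendsto_mult_left)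
  have eq: "c * (sqrt (1 / 2 ^ p) * exp ((real p + 1) / 4)) = c * exp (1 / 4) * \<rho> ^ p" for p
  proof -
    have "exp ((real p + 1) / 4) = exp (1 / 4) * exp (1 / 4) ^ p"
      by (simp add: exp_of_nat_mult[symmetric] exp_add[symmetric] add_divide_distrib add.commute)
    moreover have "sqrt (1 / 2 ^ p) = sqrt (1 / 2) ^ p"
      by (simp add: real_sqrt_power[symmetric] power_one_over)
    ultimately show ?thesis by (simp add: \<rho>_def power_mult_distrib)
  qed
  show ?thesis unfolding eq using lim by simp
qed

text \<open>First \<open>p\<close> is chosen to make the mollification part of the error small, then the number of steps to make
  the discretisation error and the change of area small.  The approximating map acts on positions at
  time \<open>s\<close>, so it can be composed with the flow up to time \<open>s\<close>.\<close>

lemma short_time_approximation: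
  assumes s: "s \<ge> 0" and t: "s \<le> t" "t \<le> s + short_time" and \<epsilon>: "\<epsilon> > 0"
  shows "\<exists>g. continuous_on UNIV g \<and> (\<forall>x. norm (g (\<phi> x s) - \<phi> x t) < \<epsilon>) \<and>
    (\<forall>U. open U \<longrightarrow> bounded U \<longrightarrow> open (g -` U) \<and> bounded (g -` U) \<and>
       (1 - \<epsilon>) * area (g -` U) \<le> area U)"
proof -
  define \<tau> where "\<tau> = t - s"
  have \<tau>: "0 \<le> \<tau>" "\<tau> \<le> short_time" using t by (auto simp: \<tau>_def)
  define c where "c = short_time * (6 + area \<Omega>0)"
  have "\<forall>\<^sub>F p in sequentially. c * (sqrt (1 / 2 ^ p) * exp ((real p + 1) / 4)) < \<epsilon> / 2"
    using mollification_beats_gronwall[of c] \<epsilon> by (intro order_tendstoD(2)) auto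
  then obtain p where p: "c * (sqrt (1 / 2 ^ p) * exp ((real p + 1) / 4)) < \<epsilon> / 2"
    by (meson eventually_sequentially order_refl)
  define d where "d = Lip p * speed + 2 * (1 / (1 / 2 ^ p)\<^sup>2 * speed * area \<Omega>0)"
  have err: "scheme_error p h = (6 + area \<Omega>0) * sqrt (1 / 2 ^ p) + d * h" for h
    by (simp add: scheme_error_def d_def)
  have inv: "(\<lambda>N. K * inverse (real (Suc N))) \<longlonglongrightarrow> 0" for K :: real
    using tendsto_mult_right_zero[OF LIMSEQ_inverse_real_of_nat] by simp
  have "\<forall>\<^sub>F N in sequentially. (\<tau> * d * \<tau> * exp (Lip p * \<tau>)) * inverse (real (Suc N)) < \<epsilon> / 2"
    using inv \<epsilon> by (intro order_tendstoD(2)[of _ 0]) auto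
  moreover have "\<forall>\<^sub>F N in sequentially. (\<tau> * Lip p) * inverse (real (Suc N)) < 1 / 2"
    using inv by (intro order_tendstoD(2)[of _ 0]) auto
  moreover have "\<forall>\<^sub>F N in sequentially. (2 * (\<tau> * Lip p)\<^sup>2) * inverse (real (Suc N)) < \<epsilon>"
    using inv \<epsilon> by (intro order_tendstoD(2)[of _ 0]) auto
  ultimately have "\<forall>\<^sub>F N in sequentially. (\<tau> * d * \<tau> * exp (Lip p * \<tau>)) * inverse (real (Suc N)) < \<epsilon> / 2 \<and>
     (\<tau> * Lip p) * inverse (real (Suc N)) < 1 / 2 \<and> (2 * (\<tau> * Lip p)\<^sup>2) * inverse (real (Suc N)) < \<epsilon>"
    by eventually_elim auto
  then obtain N0 where N0: "(\<tau> * d * \<tau> * exp (Lip p * \<tau>)) * inverse (real (Suc N0)) < \<epsilon> / 2"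
     "(\<tau> * Lip p) * inverse (real (Suc N0)) < 1 / 2" "(2 * (\<tau> * Lip p)\<^sup>2) * inverse (real (Suc N0)) < \<epsilon>"
    using eventually_happens'[OF sequentially_bot] by blast
  define N where "N = Suc N0"
  define h where "h = \<tau> / real N"
  have N: "real N > 0" by (simp add: N_def)
  have h: "h \<ge> 0" "real N * h = \<tau>" "h = \<tau> * inverse (real N)"
    using \<tau> N by (simp_all add: h_def divide_inverse mult.left_commute[of "real N"])
  have hL: "h * Lip p \<le> 1 / 2" using N0(2) by (simp add: h(3) N_def mult_ac)
  let ?g = "euler (1 / 2 ^ p) s h N"
  show ?thesis
  proof (intro exI[of _ ?g] conjI allI impI)
    show "continuous_on UNIV ?g" by (rule euler_continuous[OF s h(1)])
    fix x
    have "norm (?g (\<phi> x s) - \<phi> x t) \<le> real N * h * scheme_error p h * (1 + h * Lip p) ^ N"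
      using euler_error[OF s h(1), of p N x] by (simp add: h(2) \<tau>_def)
    also have "\<dots> \<le> \<tau> * scheme_error p h * exp (Lip p * \<tau>)"
      unfolding h(2)
    proof (rule mult_left_mono)
      have "(1 + h * Lip p) ^ N \<le> exp (h * Lip p) ^ N"
        using h(1) Lip_pos[of p] by (intro power_mono) (auto simp: exp_ge_add_one_self add_nonneg_nonneg)
      also have "\<dots> = exp (Lip p * (real N * h))" by (simp add: exp_of_nat_mult[symmetric] mult_ac)
      finally show "(1 + h * Lip p) ^ N \<le> exp (Lip p * \<tau>)" by (simp only: h(2))
      show "0 \<le> \<tau> * scheme_error p h" using \<tau> scheme_error_nonneg[OF h(1)] by simp
    qed
    also have "\<dots> = \<tau> * ((6 + area \<Omega>0) * (sqrt (1 / 2 ^ p) * exp (Lip p * \<tau>)))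
       + (\<tau> * d * \<tau> * exp (Lip p * \<tau>)) * inverse (real N)"
      by (simp add: err h(3) algebra_simps)
    also have "\<tau> * ((6 + area \<Omega>0) * (sqrt (1 / 2 ^ p) * exp (Lip p * \<tau>)))
        \<le> short_time * ((6 + area \<Omega>0) * (sqrt (1 / 2 ^ p) * exp ((real p + 1) / 4)))"
    proof (intro mult_mono)
      have "Lip p * \<tau> \<le> Lip p * short_time" using \<tau> Lip_pos[of p] by (intro mult_left_mono) auto
      then show "exp (Lip p * \<tau>) \<le> exp ((real p + 1) / 4)" using Lip_short_time[of p] by simp
    qed (use \<tau> short_time_pos in auto)
    also have "\<dots> = c * (sqrt (1 / 2 ^ p) * exp ((real p + 1) / 4))" by (simp add: c_def)
    finally show "norm (?g (\<phi> x s) - \<phi> x t) < \<epsilon>" using p N0(1) by (simp add: N_def)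
  next
    fix U :: "(real^2) set" assume U: "open U" "bounded U"
    note V = euler_vimage[OF s h(1) hL U, of N]
    show "open (?g -` U)" "bounded (?g -` U)" using V by auto
    have "1 - \<epsilon> \<le> (1 - 2 * (h * Lip p)\<^sup>2) ^ N"
    proof -
      have "(h * Lip p)\<^sup>2 \<le> (1 / 2)\<^sup>2" using hL h(1) Lip_pos[of p] by (intro power_mono) auto
      then have "1 + real N * (- (2 * (h * Lip p)\<^sup>2)) \<le> (1 + (- (2 * (h * Lip p)\<^sup>2))) ^ N"
        by (intro Bernoulli_inequality) (simp add: power2_eq_square)
      moreover have "real N * (2 * (h * Lip p)\<^sup>2) = (2 * (\<tau> * Lip p)\<^sup>2) * inverse (real N)"
        using N by (simp add: h_def power2_eq_square field_simps)
      ultimately show ?thesis using N0(3) by (simp add: N_def)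
    qed
    then have "(1 - \<epsilon>) * area (?g -` U) \<le> (1 - 2 * (h * Lip p)\<^sup>2) ^ N * area (?g -` U)"
      by (intro mult_right_mono) auto
    then show "(1 - \<epsilon>) * area (?g -` U) \<le> area U" using V by linarith
  qed
qed

text \<open>Stated for preimages of open sets: these are open, hence measurable, and the preimage under a composition is
  the preimage of a preimage, so that steps can be chained.\<close>

definition area_nonincreasing :: "real \<Rightarrow> bool" where
  "area_nonincreasing t \<longleftrightarrow> continuous_on UNIV (\<lambda>x. \<phi> x t) \<and>
     (\<forall>U. open U \<longrightarrow> bounded U \<longrightarrow> area ((\<lambda>x. \<phi> x t) -` U) \<le> area U)"

lemma flow_vimage_bounded:
  assumes "t \<ge> 0" "bounded U" shows "bounded ((\<lambda>x. \<phi> x t) -` U)"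
proof -
  obtain r where r: "\<And>y. y \<in> U \<Longrightarrow> norm y \<le> r" using assms(2) by (auto simp: bounded_iff)
  have "norm x \<le> r + t * speed" if "\<phi> x t \<in> U" for x
    using flow_lipschitz[of 0 t x] assms(1) r[OF that] norm_triangle_ineq4[of "\<phi> x t" "\<phi> x t - x"] by simp
  then show ?thesis by (auto simp: bounded_iff)
qed

text \<open>A point whose position at time \<open>t\<close> lies well inside \<open>U\<close> is mapped into \<open>U\<close> by a close approximation
  \<open>g\<close> of the flow from \<open>s\<close> to \<open>t\<close>.  So its position at time \<open>s\<close> lies in the preimage of \<open>U\<close>
  under \<open>g\<close>, whose area is almost bounded by that of \<open>U\<close>, and the hypothesis at time \<open>s\<close> applies to that
  preimage.  Exhausting \<open>U\<close> from inside concludes.\<close>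

lemma area_nonincreasing_step:
  assumes P: "area_nonincreasing s" and s: "s \<ge> 0" and t: "s \<le> t" "t \<le> s + short_time"
  shows "area_nonincreasing t"
proof -
  have cs: "continuous_on UNIV (\<lambda>x. \<phi> x s)" using P by (simp add: area_nonincreasing_def)
  have t0: "t \<ge> 0" using s t by simp
  note approx = short_time_approximation[OF s t]
  have ct: "continuous_on UNIV (\<lambda>x. \<phi> x t)"
  proof (rule continuous_on_if_approximable)
    fix \<epsilon> :: real assume "\<epsilon> > 0"
    then obtain g where g: "continuous_on UNIV g" "\<forall>x. norm (g (\<phi> x s) - \<phi> x t) < \<epsilon>" using approx by blast
    then show "\<exists>g. continuous_on UNIV g \<and> (\<forall>x\<in>UNIV. norm (g x - \<phi> x t) < \<epsilon>)"
      by (intro exI[of _ "\<lambda>x. g (\<phi> x s)"]) (auto intro: continuous_on_compose2[OF g(1) cs])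
  qed
  have "area ((\<lambda>x. \<phi> x t) -` U) \<le> area U" if U: "open U" "bounded U" for U
  proof -
    \<comment> \<open>Points whose distance from the complement of \<open>U\<close> is at least \<open>\<eta>\<close>.\<close>
    define core where "core \<eta> = - (\<Union>z\<in>-U. ball z \<eta>)" for \<eta>
    have core_iff: "y \<in> core \<eta> \<longleftrightarrow> (\<forall>z. z \<notin> U \<longrightarrow> \<eta> \<le> dist z y)" for y \<eta>
      by (auto simp: core_def not_less)
    have core_closed: "closed (core \<eta>)" for \<eta> unfolding core_def by (intro closed_Compl open_UN) auto
    have core_sub: "core \<eta> \<subseteq> U" if "\<eta> > 0" for \<eta> using that by (auto simp: core_def) (metis ComplI dist_self)
    let ?pre = "\<lambda>\<eta>. (\<lambda>x. \<phi> x t) -` core \<eta>"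
    have pre_meas: "?pre \<eta> \<in> lmeasurable" if "\<eta> > 0" for \<eta>
    proof -
      have "closed (?pre \<eta>)" using core_closed ct by (simp add: continuous_closed_vimage continuous_on_eq_continuous_at)
      moreover have "bounded (?pre \<eta>)"
        using flow_vimage_bounded[OF t0 U(2)] by (rule bounded_subset) (use core_sub[OF that] in auto)
      ultimately show ?thesis using bounded_set_imp_lmeasurable by (simp add: lmeasurable_compact compact_eq_bounded_closed)
    qed
    have le: "(1 - \<epsilon>) * area (?pre \<eta>) \<le> area U" if \<epsilon>: "0 < \<epsilon>" "\<epsilon> \<le> \<eta>" "\<epsilon> < 1" for \<epsilon> \<eta>
    proof -
      obtain g where g: "\<forall>x. norm (g (\<phi> x s) - \<phi> x t) < \<epsilon>"
        "open (g -` U)" "bounded (g -` U)" "(1 - \<epsilon>) * area (g -` U) \<le> area U"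
        using approx[OF \<epsilon>(1)] U by blast
      have sub: "?pre \<eta> \<subseteq> (\<lambda>x. \<phi> x s) -` (g -` U)"
      proof
        fix x assume x: "x \<in> ?pre \<eta>"
        show "x \<in> (\<lambda>x. \<phi> x s) -` (g -` U)"
        proof (rule ccontr)
          assume "x \<notin> (\<lambda>x. \<phi> x s) -` (g -` U)"
          then have "g (\<phi> x s) \<in> -U" by simp
          moreover have "dist (g (\<phi> x s)) (\<phi> x t) < \<eta>" using g(1) \<epsilon>(2) by (metis dist_norm less_le_trans)
          ultimately show False using x by (auto simp: core_def)
        qed
      qed
      have lm: "(\<lambda>x. \<phi> x s) -` (g -` U) \<in> lmeasurable"
        using flow_vimage_bounded[OF s g(3)] g(2) cs
        by (intro lmeasurable_open) (auto simp: continuous_on_open_vimage)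
      have "area (?pre \<eta>) \<le> area ((\<lambda>x. \<phi> x s) -` (g -` U))"
        using pre_meas \<epsilon> sub lm by (intro measure_mono_fmeasurable) (auto dest: fmeasurableD)
      also have "\<dots> \<le> area (g -` U)" using P g(2,3) by (simp add: area_nonincreasing_def)
      finally have "(1 - \<epsilon>) * area (?pre \<eta>) \<le> (1 - \<epsilon>) * area (g -` U)"
        using \<epsilon>(3) by (intro mult_left_mono) auto
      then show ?thesis using g(4) by linarith
    qed
    have le': "area (?pre \<eta>) \<le> area U" if \<eta>: "\<eta> > 0" for \<eta>
    proof (rule field_le_mult_one_interval)
      fix z :: real assume z: "0 < z" "z < 1"
      define \<epsilon> where "\<epsilon> = min \<eta> (1 - z)"
      have "z * area (?pre \<eta>) \<le> (1 - \<epsilon>) * area (?pre \<eta>)"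
        by (intro mult_right_mono) (auto simp: \<epsilon>_def)
      also have "\<dots> \<le> area U"
        by (rule le) (use z \<eta> in \<open>auto simp: \<epsilon>_def\<close>)
      finally show "z * area (?pre \<eta>) \<le> area U" .
    qed
    let ?P = "\<lambda>n. ?pre (1 / real (Suc n))"
    have un: "(\<Union>n. ?P n) = (\<lambda>x. \<phi> x t) -` U"
    proof (intro equalityI subsetI)
      fix x assume "x \<in> (\<lambda>x. \<phi> x t) -` U"
      then obtain e where e: "e > 0" "ball (\<phi> x t) e \<subseteq> U" using U(1) open_contains_ball by blast
      obtain n where n: "1 / real (Suc n) < e" using nat_approx_posE[OF e(1)] by blast
      have "\<phi> x t \<in> core (1 / real (Suc n))"
        unfolding core_iff
      proof (intro allI impI)
        fix z assume "z \<notin> U"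
        then have "z \<notin> ball (\<phi> x t) e" using e(2) by blast
        then show "1 / real (Suc n) \<le> dist z (\<phi> x t)" using n by (simp add: dist_commute)
      qed
      then show "x \<in> (\<Union>n. ?P n)" by auto
    next
      fix x assume "x \<in> (\<Union>n. ?P n)"
      then obtain n where "\<phi> x t \<in> core (1 / real (Suc n))" by auto
      then show "x \<in> (\<lambda>x. \<phi> x t) -` U" using core_sub[of "1 / real (Suc n)"] by auto
    qed
    have "incseq ?P"
    proof (rule incseq_SucI)
      fix n
      have "1 / real (Suc (Suc n)) \<le> 1 / real (Suc n)" by (intro frac_le) auto
      then have "core (1 / real (Suc n)) \<subseteq> core (1 / real (Suc (Suc n)))"
        unfolding core_def by (intro Compl_anti_mono UN_mono subset_ball) auto
      then show "?P n \<subseteq> ?P (Suc n)" by auto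
    qed
    moreover have "range ?P \<subseteq> sets lebesgue" using pre_meas by (auto dest!: fmeasurableD simp del: of_nat_Suc)
    moreover have "emeasure lebesgue (\<Union>n. ?P n) \<noteq> \<infinity>"
    proof -
      have V: "(\<lambda>x. \<phi> x t) -` U \<in> lmeasurable"
        using flow_vimage_bounded[OF t0 U(2)] U(1) ct by (intro lmeasurable_open) (auto simp: continuous_on_open_vimage)
      show ?thesis unfolding un infinity_ennreal_def by (rule fmeasurableD2[OF V])
    qed
    ultimately have "(\<lambda>n. area (?P n)) \<longlonglongrightarrow> area (\<Union>n. ?P n)"
      by (intro Lim_measure_incseq) auto
    then show ?thesis unfolding un
      by (rule LIMSEQ_le_const2) (use le' in auto)
  qed
  then show ?thesis using ct by (simp add: area_nonincreasing_def)
qed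

text \<open>The length of a short step does not depend on the time at which it starts, so finitely many of them
  reach any time.\<close>

lemma area_nonincreasing_all: assumes "t \<ge> 0" shows "area_nonincreasing t"
proof -
  have upto: "area_nonincreasing t" if "0 \<le> t" "t \<le> real n * short_time" for n t
    using that
  proof (induction n arbitrary: t)
    case 0
    then have "t = 0" by simp
    then show ?case by (simp add: area_nonincreasing_def vimage_def)
  next
    case (Suc n)
    show ?case
    proof (cases "t \<le> real n * short_time")
      case False
      have "area_nonincreasing (real n * short_time)" using short_time_pos by (intro Suc.IH) auto
      then show ?thesis
        by (rule area_nonincreasing_step) (use False Suc.prems short_time_pos in \<open>auto simp: algebra_simps\<close>)
    qed (use Suc in auto)
  qed
  obtain n :: nat where "t < real n * short_time" using ex_less_of_nat_mult[OF short_time_pos] by auto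
  then show ?thesis by (intro upto[of t n] assms) simp
qed

end

section \<open>Winding numbers\<close>

text \<open>Chebyshev's inequality with the threshold that balances size and measure.  For \<open>q = 0\<close> it says that
  the function vanishes almost everywhere, which covers initial data that agree with the disc up to a null set.\<close>

lemma chebyshev_sqrt:
  assumes f [measurable]: "f \<in> borel_measurable M" and T: "T > 0" and q: "q \<ge> 0"
    and int: "(\<integral>\<^sup>+x. f x \<partial>M) \<le> ennreal (T * q\<^sup>2)"
  shows "emeasure M {x \<in> space M. f x > ennreal (T * q)} \<le> ennreal q"
proof (cases "q = 0")
  case True
  then have "(\<integral>\<^sup>+x. f x \<partial>M) = 0" using int by simp
  then have "AE x in M. f x = 0" by (simp add: nn_integral_0_iff_AE)
  then have "emeasure M {x \<in> space M. f x > 0} = 0"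
    by (subst emeasure_eq_0_AE) (auto elim: eventually_mono)
  then show ?thesis using True by simp
next
  case False
  let ?S = "{x \<in> space M. f x > ennreal (T * q)}"
  have "ennreal (T * q) * emeasure M ?S = (\<integral>\<^sup>+x. ennreal (T * q) * indicator ?S x \<partial>M)"
    by (subst nn_integral_cmult_indicator) auto
  also have "\<dots> \<le> (\<integral>\<^sup>+x. f x \<partial>M)"
    by (intro nn_integral_mono) (auto simp: indicator_def less_imp_le)
  also have "\<dots> \<le> ennreal (T * q) * ennreal q"
    using int T q by (simp add: ennreal_mult[symmetric] power2_eq_square mult.assoc)
  finally show ?thesis using False T q by (subst (asm) ennreal_mult_le_mult_iff) auto
qed

context patch
begin

text \<open>The bound of \<open>u_close_to_rotation\<close>, of order \<open>\<delta> powr (1/4)\<close>.\<close>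

definition deviation :: real where "deviation = 3 * sqrt (8 * sqrt ((R\<^sup>2 + 1) * \<delta>))"

text \<open>The bound of \<open>disc_stability\<close>, of order \<open>\<delta> powr (1/2)\<close>.\<close>

definition outside_area :: real where "outside_area = 8 * sqrt ((R\<^sup>2 + 1) * \<delta>)"

lemma deviation_nonneg: "deviation \<ge> 0" and outside_area_nonneg: "outside_area \<ge> 0"
  using \<delta>_nonneg by (auto simp: deviation_def outside_area_def intro!: mult_nonneg_nonneg add_nonneg_nonneg)

text \<open>A majorant of the error of the angular velocity along trajectories: near the origin the
  deviation from rigid rotation is divided by the distance, outside the disc nothing is gained.\<close>

definition angular_error :: "real \<Rightarrow> real^2 \<Rightarrow> ennreal" where
  "angular_error s x = ennreal deviation * inverse (ennreal (norm (\<phi> x s)))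
     + ennreal (speed + 1 / 2) * indicator {y. norm y \<ge> 1} (\<phi> x s)"

lemma angular_velocity_error:
  assumes s: "s \<ge> 0" and ne: "\<phi> x s \<noteq> 0"
  shows "ennreal \<bar>tangential_velocity u s (\<phi> x s) / norm (\<phi> x s) - 1 / 2\<bar> \<le> angular_error s x"
proof -
  define y where "y = \<phi> x s"
  define n where "n = norm y"
  have n: "n > 0" using ne by (simp add: n_def y_def)
  have tv: "tangential_velocity u s y / n = (u s y \<bullet> perp y) / n\<^sup>2"
    by (simp add: tangential_velocity_def n_def power2_eq_square)
  have pp: "perp y \<bullet> perp y = n\<^sup>2"
    by (simp add: dot_square_norm n_def)
  show ?thesis
  proof (cases "n < 1")
    case True
    have eq: "(u s y - (1 / 2) *\<^sub>R perp y) \<bullet> perp y = u s y \<bullet> perp y - n\<^sup>2 / 2"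
      by (simp add: inner_diff_left pp)
    have "(X - n\<^sup>2 / 2) / n\<^sup>2 = X / n\<^sup>2 - 1 / 2" for X using n by (simp add: diff_divide_distrib)
    then have "tangential_velocity u s y / n - 1 / 2 = ((u s y - (1 / 2) *\<^sub>R perp y) \<bullet> perp y) / n\<^sup>2"
      by (simp only: tv eq)
    then have "\<bar>tangential_velocity u s y / n - 1 / 2\<bar> = \<bar>(u s y - (1 / 2) *\<^sub>R perp y) \<bullet> perp y\<bar> / n\<^sup>2"
      by (simp add: abs_div)
    also have "\<dots> \<le> (norm (u s y - (1 / 2) *\<^sub>R perp y) * norm (perp y)) / n\<^sup>2"
      by (intro divide_right_mono Cauchy_Schwarz_ineq2) auto
    also have "\<dots> = norm (u s y - (1 / 2) *\<^sub>R perp y) / n"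
      using n by (simp add: n_def power2_eq_square)
    also have "\<dots> \<le> deviation / n"
      using u_close_to_rotation[OF s, of y] True n by (intro divide_right_mono) (auto simp: n_def deviation_def)
    finally have le: "\<bar>tangential_velocity u s y / n - 1 / 2\<bar> \<le> deviation * inverse n" unfolding divide_inverse[of deviation n] .
    have "ennreal \<bar>tangential_velocity u s y / n - 1 / 2\<bar> \<le> ennreal (deviation * inverse n)"
      using le by (rule ennreal_leI)
    also have "\<dots> = ennreal deviation * inverse (ennreal n)"
      using n deviation_nonneg by (simp add: ennreal_mult inverse_ennreal)
    also have "\<dots> \<le> angular_error s x" by (simp add: angular_error_def y_def n_def)
    finally show ?thesis by (simp add: y_def n_def)
  next
    case False
    have "\<bar>u s y \<bullet> perp y\<bar> \<le> norm (u s y) * norm (perp y)" by (rule Cauchy_Schwarz_ineq2)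
    also have "\<dots> \<le> speed * n" using u_le_speed[OF s, of y] by (simp add: n_def mult_right_mono)
    finally have "\<bar>u s y \<bullet> perp y\<bar> / n\<^sup>2 \<le> speed * n / n\<^sup>2" by (intro divide_right_mono) auto
    also have "\<dots> = speed / n" using n by (simp add: power2_eq_square)
    also have "\<dots> \<le> speed / 1" using False speed_nonneg by (intro divide_left_mono) auto
    finally have "\<bar>(u s y \<bullet> perp y) / n\<^sup>2\<bar> \<le> speed" by (simp add: abs_div)
    then have le: "\<bar>tangential_velocity u s y / n - 1 / 2\<bar> \<le> speed + 1 / 2" unfolding tv by linarith
    then have "ennreal \<bar>tangential_velocity u s y / n - 1 / 2\<bar> \<le> ennreal (speed + 1 / 2)" by (rule ennreal_leI)
    also have "\<dots> \<le> angular_error s x" using False by (simp add: angular_error_def y_def n_def)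
    finally show ?thesis by (simp add: y_def n_def)
  qed
qed

text \<open>The flow is Lipschitz in time and continuous in the starting point.  Time is truncated at zero to obtain a function
  on all of space-time; the trajectories obey the flow equation for nonnegative times only.\<close>

lemma flow_jointly_continuous: "continuous_on UNIV (\<lambda>p. \<phi> (snd p) (max 0 (fst p)))"
  unfolding continuous_on_iff
proof (intro ballI allI impI)
  fix p :: "real \<times> (real^2)" and \<epsilon> :: real assume \<epsilon>: "\<epsilon> > 0"
  define s where "s = max 0 (fst p)"
  have s: "s \<ge> 0" by (simp add: s_def)
  have "continuous_on UNIV (\<lambda>x. \<phi> x s)" using area_nonincreasing_all[OF s] by (simp add: area_nonincreasing_def)
  then obtain d where d: "d > 0" "\<And>x. dist x (snd p) < d \<Longrightarrow> dist (\<phi> x s) (\<phi> (snd p) s) < \<epsilon> / 2"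
    unfolding continuous_on_iff using \<epsilon> by (metis UNIV_I half_gt_zero)
  define d' where "d' = min d (\<epsilon> / (2 * (speed + 1)))"
  have sp: "speed + 1 > 0" using speed_nonneg by simp
  show "\<exists>d>0. \<forall>q\<in>UNIV. dist q p < d \<longrightarrow> dist (\<phi> (snd q) (max 0 (fst q))) (\<phi> (snd p) (max 0 (fst p))) < \<epsilon>"
  proof (intro exI[of _ d'] conjI ballI impI)
    show "d' > 0" using d(1) \<epsilon> sp by (simp add: d'_def)
    fix q assume q: "dist q p < d'"
    define t where "t = max 0 (fst q)"
    have t: "t \<ge> 0" by (simp add: t_def)
    have ts: "\<bar>t - s\<bar> \<le> dist q p"
      using dist_fst_le[of q p] by (auto simp: t_def s_def dist_real_def)
    have "norm (\<phi> (snd q) t - \<phi> (snd q) s) \<le> \<bar>t - s\<bar> * speed"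
      using flow_lipschitz[of s t "snd q"] flow_lipschitz[of t s "snd q"] s t
      by (cases "s \<le> t") (auto simp: norm_minus_commute)
    also have "\<dots> \<le> dist q p * (speed + 1)" using ts speed_nonneg by (intro mult_mono) auto
    also have "\<dots> < d' * (speed + 1)" using q sp by (intro mult_strict_right_mono)
    also have "\<dots> \<le> \<epsilon> / (2 * (speed + 1)) * (speed + 1)" using sp by (intro mult_right_mono) (auto simp: d'_def)
    also have "\<dots> = \<epsilon> / 2" using sp by (simp add: field_simps)
    finally have 1: "dist (\<phi> (snd q) t) (\<phi> (snd q) s) < \<epsilon> / 2" by (simp add: dist_norm)
    have "dist (snd q) (snd p) < d" using q dist_snd_le[of q p] by (simp add: d'_def)
    then have 2: "dist (\<phi> (snd q) s) (\<phi> (snd p) s) < \<epsilon> / 2" by (rule d(2))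
    show "dist (\<phi> (snd q) (max 0 (fst q))) (\<phi> (snd p) (max 0 (fst p))) < \<epsilon>"
      using dist_triangle[of "\<phi> (snd q) t" "\<phi> (snd p) s" "\<phi> (snd q) s"] 1 2 by (simp add: t_def s_def)
  qed
qed

lemma flow_vimage_ball:
  assumes s: "s \<ge> 0" and r: "r \<ge> 0"
  shows "{x. norm (\<phi> x s) < r} \<in> lmeasurable" "area {x. norm (\<phi> x s) < r} \<le> pi * r\<^sup>2"
    "open {x. norm (\<phi> x s) < r}"
proof -
  have P: "area_nonincreasing s" by (rule area_nonincreasing_all[OF s])
  have eq: "{x. norm (\<phi> x s) < r} = (\<lambda>x. \<phi> x s) -` ball 0 r" by auto
  show o: "open {x. norm (\<phi> x s) < r}"
    unfolding eq using P by (auto simp: area_nonincreasing_def continuous_on_open_vimage)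
  show "{x. norm (\<phi> x s) < r} \<in> lmeasurable"
    using flow_vimage_bounded[OF s bounded_ball, of 0 r] o unfolding eq by (rule lmeasurable_open)
  have "area {x. norm (\<phi> x s) < r} \<le> area (ball (0::real^2) r)"
    using P unfolding eq by (simp add: area_nonincreasing_def)
  then show "area {x. norm (\<phi> x s) < r} \<le> pi * r\<^sup>2" unfolding measure_ball_plane[OF r] .
qed

abbreviation particles :: "(real^2) measure" where "particles \<equiv> lebesgue_on \<Omega>0"

lemma emeasure_particles: "S \<subseteq> \<Omega>0 \<Longrightarrow> emeasure particles S = emeasure lebesgue S"
  using meas0 by (intro emeasure_restrict_space) auto

lemma finite_particles: "finite_measure particles"
proof (rule finite_measureI)
  have "emeasure particles (space particles) = emeasure lebesgue \<Omega>0"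
    using emeasure_particles[of \<Omega>0] by simp
  also have "\<dots> = ennreal (area \<Omega>0)" by (rule emeasure_eq_measure2[OF \<Omega>0_lmeasurable])
  finally show "emeasure particles (space particles) \<noteq> \<infinity>" by simp
qed

lemma flow_measurable: assumes "s \<ge> 0" shows "(\<lambda>x. \<phi> x s) \<in> borel_measurable particles"
  using area_nonincreasing_all[OF assms] unfolding area_nonincreasing_def
  by (intro measurable_restrict_space1 measurable_lebesgue_if_borel borel_measurable_continuous_onI) auto

text \<open>The preimage of a small disc around the origin is no larger than the disc.\<close>

lemma inverse_distance_average:
  assumes s: "s \<ge> 0"
  shows "(\<integral>\<^sup>+x. inverse (ennreal (norm (\<phi> x s))) \<partial>particles) \<le> ennreal ((1 + 4 * pi) * sqrt (area \<Omega>0))"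
proof (rule nn_integral_inverse_le)
  show "(\<lambda>x. norm (\<phi> x s)) \<in> borel_measurable particles"
    using flow_measurable[OF s] by measurable
  show "emeasure particles {x \<in> space particles. norm (\<phi> x s) < r} \<le> ennreal (pi * r\<^sup>2)" if "r > 0" for r
  proof -
    have "emeasure particles {x \<in> space particles. norm (\<phi> x s) < r} = emeasure lebesgue {x \<in> space particles. norm (\<phi> x s) < r}"
      by (intro emeasure_particles) auto
    also have "\<dots> \<le> emeasure lebesgue {x. norm (\<phi> x s) < r}"
      using flow_vimage_ball(1)[OF s, of r] that by (intro emeasure_mono) (auto dest: fmeasurableD)
    also have "\<dots> = ennreal (area {x. norm (\<phi> x s) < r})"
      using flow_vimage_ball(1)[OF s, of r] that by (intro emeasure_eq_measure2) auto
    also have "\<dots> \<le> ennreal (pi * r\<^sup>2)" using flow_vimage_ball(2)[OF s, of r] that by (intro ennreal_leI) auto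
    finally show ?thesis .
  qed
  have "emeasure particles (space particles) = emeasure lebesgue \<Omega>0" using emeasure_particles[of \<Omega>0] by simp
  also have "\<dots> = ennreal (area \<Omega>0)" by (rule emeasure_eq_measure2[OF \<Omega>0_lmeasurable])
  finally show "emeasure particles (space particles) \<le> ennreal (area \<Omega>0)" by simp
qed auto

text \<open>Particles outside the unit disc occupy the part of the current patch outside the disc; an open
  superset of that part transfers its area back to the initial positions.\<close>

lemma outside_particles:
  assumes s: "s \<ge> 0"
  shows "emeasure particles {x \<in> space particles. norm (\<phi> x s) \<ge> 1} \<le> ennreal outside_area"
proof -
  let ?X = "{x \<in> space particles. norm (\<phi> x s) \<ge> 1}"
  let ?Y = "\<Omega> s - ball 0 1"
  have Y: "?Y \<in> lmeasurable" by (intro fmeasurable.Diff \<Omega>_lmeasurable s lmeasurable_ball)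
  obtain r where r: "\<Omega> s \<subseteq> ball 0 r" using \<Omega>_bounded_ex[of s] s by (meson atLeastAtMost_iff order_refl)
  have "sym_diff (ball 0 1) (\<Omega> s) \<in> lmeasurable"
    by (intro fmeasurable.Un fmeasurable.Diff \<Omega>_lmeasurable s lmeasurable_ball)
  then have "area ?Y \<le> area (sym_diff (ball 0 1) (\<Omega> s))"
    using Y by (intro measure_mono_fmeasurable) (auto dest: fmeasurableD)
  then have Y': "area ?Y \<le> outside_area"
    using disc_stability[OF s] by (simp add: outside_area_def)
  show ?thesis
  proof (rule ennreal_le_epsilon)
    fix e :: real assume e: "e > 0"
    obtain V where V: "open V" "?Y \<subseteq> V" "V - ?Y \<in> lmeasurable" "emeasure lebesgue (V - ?Y) < ennreal e"
      using sets_lebesgue_outer_open[OF fmeasurableD[OF Y] e] by blast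
    have "area (V - ?Y) < e"
      using V(4) unfolding emeasure_eq_measure2[OF V(3)] by (simp add: ennreal_less_iff)
    moreover have "area (?Y \<union> (V - ?Y)) \<le> area ?Y + area (V - ?Y)"
      using Y V(3) by (intro measure_Un_le) (auto dest: fmeasurableD)
    moreover have VY: "?Y \<union> (V - ?Y) = V" using V(2) by blast
    ultimately have mV: "area V < area ?Y + e" by simp
    have lV: "V \<in> lmeasurable" using fmeasurable.Un[OF Y V(3)] unfolding VY .
    define V' where "V' = V \<inter> ball 0 r"
    have oV: "open V'" "bounded V'" using V(1) by (auto simp: V'_def intro: bounded_subset[OF bounded_ball])
    have P: "area_nonincreasing s" by (rule area_nonincreasing_all[OF s])
    have o: "open ((\<lambda>x. \<phi> x s) -` V')"
      using P oV(1) by (simp add: area_nonincreasing_def continuous_on_open_vimage)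
    have lm: "(\<lambda>x. \<phi> x s) -` V' \<in> lmeasurable"
      by (rule lmeasurable_open[OF flow_vimage_bounded[OF s oV(2)] o])
    have "emeasure particles ?X = emeasure lebesgue ?X" by (intro emeasure_particles) auto
    also have "\<dots> \<le> emeasure lebesgue ((\<lambda>x. \<phi> x s) -` V')"
    proof (rule emeasure_mono)
      show "?X \<subseteq> (\<lambda>x. \<phi> x s) -` V'"
      proof
        fix x assume x: "x \<in> ?X"
        then have "\<phi> x s \<in> \<Omega> s" by (auto simp: \<Omega>_def)
        then show "x \<in> (\<lambda>x. \<phi> x s) -` V'" using x V(2) r by (auto simp: V'_def)
      qed
    qed (use lm in \<open>auto dest: fmeasurableD\<close>)
    also have "\<dots> = ennreal (area ((\<lambda>x. \<phi> x s) -` V'))" by (rule emeasure_eq_measure2[OF lm])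
    also have "\<dots> \<le> ennreal (area V)"
    proof (rule ennreal_leI)
      have "area ((\<lambda>x. \<phi> x s) -` V') \<le> area V'" using P oV by (simp add: area_nonincreasing_def)
      also have "\<dots> \<le> area V" using V(1) lV by (intro measure_mono_fmeasurable) (auto simp: V'_def)
      finally show "area ((\<lambda>x. \<phi> x s) -` V') \<le> area V" .
    qed
    also have "\<dots> \<le> ennreal (outside_area + e)" using mV Y' by (intro ennreal_leI) auto
    also have "\<dots> = ennreal outside_area + ennreal e" using e outside_area_nonneg by (intro ennreal_plus) auto
    finally show "emeasure particles ?X \<le> ennreal outside_area + ennreal e" .
  qed
qed

definition mean_error :: real where
  "mean_error = deviation * ((1 + 4 * pi) * sqrt (area \<Omega>0)) + (speed + 1 / 2) * outside_area"

lemma mean_error_nonneg: "mean_error \<ge> 0"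
  unfolding mean_error_def using deviation_nonneg speed_nonneg outside_area_nonneg
  by (intro add_nonneg_nonneg mult_nonneg_nonneg) auto

lemma angular_error_average:
  assumes s: "s \<ge> 0"
  shows "(\<integral>\<^sup>+x. angular_error s x \<partial>particles) \<le> ennreal mean_error"
proof -
  note [measurable] = flow_measurable[OF s]
  let ?X = "{x \<in> space particles. norm (\<phi> x s) \<ge> 1}"
  have X [measurable]: "?X \<in> sets particles" by measurable
  have iv: "(\<lambda>x. inverse (ennreal (norm (\<phi> x s)))) \<in> borel_measurable particles" by measurable
  have "(\<integral>\<^sup>+x. angular_error s x \<partial>particles) =
     (\<integral>\<^sup>+x. ennreal deviation * inverse (ennreal (norm (\<phi> x s))) + ennreal (speed + 1 / 2) * indicator ?X x \<partial>particles)"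
    unfolding angular_error_def by (intro nn_integral_cong) (auto simp: indicator_def)
  also have "\<dots> = (\<integral>\<^sup>+x. ennreal deviation * inverse (ennreal (norm (\<phi> x s))) \<partial>particles)
      + (\<integral>\<^sup>+x. ennreal (speed + 1 / 2) * indicator ?X x \<partial>particles)"
    by (rule nn_integral_add) measurable
  also have "\<dots> = ennreal deviation * (\<integral>\<^sup>+x. inverse (ennreal (norm (\<phi> x s))) \<partial>particles) + ennreal (speed + 1 / 2) * emeasure particles ?X"
    by (simp only: nn_integral_cmult[OF iv] nn_integral_cmult_indicator[OF X])
  also have "\<dots> \<le> ennreal deviation * ennreal ((1 + 4 * pi) * sqrt (area \<Omega>0)) + ennreal (speed + 1 / 2) * ennreal outside_area"
    by (intro add_mono mult_left_mono inverse_distance_average outside_particles s) auto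
  also have "\<dots> = ennreal mean_error"
    unfolding mean_error_def using deviation_nonneg speed_nonneg outside_area_nonneg
    by (simp add: ennreal_mult[symmetric] ennreal_plus[symmetric] del: ennreal_plus)
  finally show ?thesis .
qed

definition total_error :: "real \<Rightarrow> real^2 \<Rightarrow> ennreal" where
  "total_error T x = (\<integral>\<^sup>+s. angular_error s x \<partial>lebesgue_on {0..T})"

text \<open>Tonelli's theorem exchanges the integral over particles, which is bounded at each time, with the integral over time.\<close>

lemma total_error_average:
  assumes T: "T > 0"
  shows "total_error T \<in> borel_measurable particles"
    and "(\<integral>\<^sup>+x. total_error T x \<partial>particles) \<le> ennreal (T * mean_error)"
proof -
  define J where "J = lebesgue_on {0..T}"
  have emJ: "emeasure J (space J) = ennreal T"
  proof -
    have "emeasure J (space J) = emeasure lebesgue {0..T}" unfolding J_def by (subst emeasure_restrict_space) auto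
    then show ?thesis using T by simp
  qed
  interpret J: finite_measure J by (rule finite_measureI) (simp add: emJ)
  interpret P: finite_measure particles by (rule finite_particles)
  interpret Q: pair_sigma_finite J particles ..
  have spJ: "space J = {0..T}" by (simp add: J_def)
  have idJ: "(\<lambda>s. s) \<in> J \<rightarrow>\<^sub>M borel"
    unfolding J_def by (intro measurable_restrict_space1 measurable_lebesgue_if_borel) simp
  have idP: "(\<lambda>x. x) \<in> particles \<rightarrow>\<^sub>M borel"
    by (intro measurable_restrict_space1 measurable_lebesgue_if_borel) simp
  have pr: "(\<lambda>p. (fst p, snd p)) \<in> J \<Otimes>\<^sub>M particles \<rightarrow>\<^sub>M borel \<Otimes>\<^sub>M borel"
    by (intro measurable_Pair measurable_compose[OF measurable_fst idJ] measurable_compose[OF measurable_snd idP])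
  have "(\<lambda>p. \<phi> (snd p) (max 0 (fst p))) \<in> borel_measurable (borel \<Otimes>\<^sub>M borel)"
    unfolding borel_prod by (rule borel_measurable_continuous_onI[OF flow_jointly_continuous])
  from measurable_compose[OF pr this]
  have m0 [measurable]: "(\<lambda>p. \<phi> (snd p) (max 0 (fst p))) \<in> J \<Otimes>\<^sub>M particles \<rightarrow>\<^sub>M borel" by simp
  have m1: "(\<lambda>p. ennreal deviation * inverse (ennreal (norm (\<phi> (snd p) (max 0 (fst p)))))
     + ennreal (speed + 1 / 2) * indicator {y. norm y \<ge> 1} (\<phi> (snd p) (max 0 (fst p)))) \<in> borel_measurable (J \<Otimes>\<^sub>M particles)"
    by measurable
  have m: "(\<lambda>(s, x). angular_error s x) \<in> borel_measurable (J \<Otimes>\<^sub>M particles)"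
  proof (rule measurable_cong[THEN iffD2, OF _ m1])
    fix p assume "p \<in> space (J \<Otimes>\<^sub>M particles)"
    then have "fst p \<ge> 0" by (auto simp: space_pair_measure spJ)
    then show "(case p of (s, x) \<Rightarrow> angular_error s x) = ennreal deviation * inverse (ennreal (norm (\<phi> (snd p) (max 0 (fst p)))))
     + ennreal (speed + 1 / 2) * indicator {y. norm y \<ge> 1} (\<phi> (snd p) (max 0 (fst p)))"
      by (simp add: angular_error_def case_prod_beta max_def)
  qed
  have m': "(\<lambda>(x, s). angular_error s x) \<in> borel_measurable (particles \<Otimes>\<^sub>M J)"
    using measurable_pair_swap[OF m] by (simp add: case_prod_beta)
  show "total_error T \<in> borel_measurable particles"
    unfolding total_error_def[abs_def] J_def[symmetric]
    by (rule J.borel_measurable_nn_integral[OF m'])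
  have "(\<integral>\<^sup>+x. total_error T x \<partial>particles) = (\<integral>\<^sup>+s. \<integral>\<^sup>+x. angular_error s x \<partial>particles \<partial>J)"
    unfolding total_error_def J_def[symmetric] by (rule Q.Fubini'[OF m])
  also have "\<dots> \<le> (\<integral>\<^sup>+s. ennreal mean_error \<partial>J)"
    by (intro nn_integral_mono angular_error_average) (auto simp: spJ)
  also have "\<dots> = ennreal (T * mean_error)"
    using T mean_error_nonneg by (simp add: emJ ennreal_mult mult.commute)
  finally show "(\<integral>\<^sup>+x. total_error T x \<partial>particles) \<le> ennreal (T * mean_error)" .
qed

definition bad :: "real \<Rightarrow> (real^2) set" where
  "bad T = {x \<in> \<Omega>0. total_error T x > ennreal (T * sqrt mean_error)}"

lemma bad_small:
  assumes T: "T > 0"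
  shows "bad T \<in> lmeasurable" "area (bad T) \<le> sqrt mean_error"
proof -
  note [measurable] = total_error_average(1)[OF T]
  have eq: "bad T = {x \<in> space particles. total_error T x > ennreal (T * sqrt mean_error)}" by (simp add: bad_def)
  have "bad T \<in> sets particles" unfolding eq by measurable
  then have s: "bad T \<in> sets lebesgue" using meas0 by (simp add: sets_restrict_space_iff)
  have sub: "bad T \<subseteq> \<Omega>0" by (auto simp: bad_def)
  then show l: "bad T \<in> lmeasurable" using s \<Omega>0_lmeasurable fmeasurableI2 by blast
  have "emeasure particles (bad T) \<le> ennreal (sqrt mean_error)"
    unfolding eq using total_error_average[OF T] T mean_error_nonneg by (intro chebyshev_sqrt) auto
  then have "ennreal (area (bad T)) \<le> ennreal (sqrt mean_error)"
    using emeasure_particles[OF sub] emeasure_eq_measure2[OF l] by simp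
  then show "area (bad T) \<le> sqrt mean_error"
    using mean_error_nonneg by simp
qed

text \<open>A trajectory at the origin at some time up to \<open>n\<close> is close to the origin at one of the times
  \<open>k * n / N\<close>; there are \<open>N + 1\<close> of these and each costs area of order \<open>1 / N ^ 2\<close>.\<close>

lemma origin_hitting_negligible: "negligible {x. \<exists>t\<ge>0. \<phi> x t = 0}"
proof -
  have "negligible {x. \<exists>t\<in>{0..real n}. \<phi> x t = 0}" for n :: nat
    unfolding negligible_outer_le
  proof (intro allI impI)
    fix e :: real assume e: "e > 0"
    define K where "K = pi * ((speed + 1) * real n)\<^sup>2"
    have "(\<lambda>N. (2 * K) * inverse (real (Suc N))) \<longlonglongrightarrow> 0"
      using tendsto_mult_right_zero[OF LIMSEQ_inverse_real_of_nat] by simp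
    then have "\<forall>\<^sub>F N in sequentially. (2 * K) * inverse (real (Suc N)) < e"
      using e by (intro order_tendstoD(2)[of _ 0]) auto
    then obtain N0 where N0: "(2 * K) * inverse (real (Suc N0)) < e"
      using eventually_happens'[OF sequentially_bot] by blast
    define N where "N = real (Suc N0)"
    have N: "N \<ge> 1" by (simp add: N_def)
    define h where "h = real n / N"
    define r where "r = (speed + 1) * h"
    have h: "h \<ge> 0" using N by (simp add: h_def)
    have r: "r \<ge> 0" using h speed_nonneg by (simp add: r_def)
    let ?V = "\<lambda>k::nat. {x. norm (\<phi> x (real k * h)) < r}"
    have V: "?V k \<in> lmeasurable" "area (?V k) \<le> pi * r\<^sup>2" for k
      using flow_vimage_ball[of "real k * h" r] h r by auto
    show "\<exists>T. {x. \<exists>t\<in>{0..real n}. \<phi> x t = 0} \<subseteq> T \<and> T \<in> lmeasurable \<and> area T \<le> e"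
    proof (cases "n = 0")
      case True
      have "{x. \<exists>t\<in>{0..real n}. \<phi> x t = 0} = {0}" using True by auto
      then show ?thesis using e lmeasurable_compact[OF compact_sing] by (intro exI[of _ "{0}"]) auto
    next
      case False
      then have h: "h > 0" using N by (simp add: h_def)
      show ?thesis
      proof (intro exI[of _ "\<Union>k\<le>Suc N0. ?V k"] conjI)
        show "{x. \<exists>t\<in>{0..real n}. \<phi> x t = 0} \<subseteq> (\<Union>k\<le>Suc N0. ?V k)"
        proof
          fix x assume "x \<in> {x. \<exists>t\<in>{0..real n}. \<phi> x t = 0}"
          then obtain t where t: "0 \<le> t" "t \<le> real n" "\<phi> x t = 0" by auto
          define k where "k = nat \<lfloor>t / h\<rfloor>"
          have k: "real k \<le> t / h" "t / h < real k + 1" using t h by (auto simp: k_def)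
          have kh: "real k * h \<le> t" "t - real k * h < h"
            using k h by (simp_all add: field_simps)
          have "t / h \<le> real n / h" using t h by (intro divide_right_mono) auto
          also have "\<dots> = N" using False N by (simp add: h_def)
          finally have "k \<le> Suc N0" using k(1) unfolding N_def by linarith
          moreover have "norm (\<phi> x (real k * h)) < r"
          proof -
            have "norm (\<phi> x t - \<phi> x (real k * h)) \<le> (t - real k * h) * speed"
              using kh h by (intro flow_lipschitz) auto
            also have "\<dots> \<le> h * speed" using kh speed_nonneg by (intro mult_right_mono) auto
            also have "\<dots> < r" using h by (simp add: r_def algebra_simps)
            finally show ?thesis using t(3) by simp
          qed
          ultimately show "x \<in> (\<Union>k\<le>Suc N0. ?V k)" by auto
        qed
        show "(\<Union>k\<le>Suc N0. ?V k) \<in> lmeasurable" by (intro fmeasurable.finite_UN V) auto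
        have "area (\<Union>k\<le>Suc N0. ?V k) \<le> (\<Sum>k\<le>Suc N0. area (?V k))"
          by (intro measure_UNION_le) (auto intro: fmeasurableD V)
        also have "\<dots> \<le> (\<Sum>k\<le>Suc N0. pi * r\<^sup>2)" by (intro sum_mono V)
        also have "\<dots> = (N + 1) * (pi * r\<^sup>2)" by (simp add: N_def)
        also have "\<dots> \<le> (2 * N) * (pi * r\<^sup>2)" using N by (intro mult_right_mono) auto
        also have "\<dots> = (2 * K) * inverse N"
          using N by (simp add: r_def h_def K_def power2_eq_square field_simps)
        also have "\<dots> \<le> e" using N0 by (simp add: N_def)
        finally show "area (\<Union>k\<le>Suc N0. ?V k) \<le> e" .
      qed
    qed
  qed
  then have "negligible (\<Union>n. {x. \<exists>t\<in>{0..real n}. \<phi> x t = 0})" by (intro negligible_countable_Union) auto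
  moreover have "{x. \<exists>t\<ge>0. \<phi> x t = 0} \<subseteq> (\<Union>n. {x. \<exists>t\<in>{0..real n}. \<phi> x t = 0})"
  proof clarify
    fix x t assume "0 \<le> t" "\<phi> x t = 0"
    moreover obtain n where "t \<le> real n" using real_arch_simple by blast
    ultimately show "x \<in> (\<Union>n. {x. \<exists>t\<in>{0..real n}. \<phi> x t = 0})" by (intro UN_I[of n]) auto
  qed
  ultimately show ?thesis by (rule negligible_subset)
qed

text \<open>Away from the origin the angular velocity is a continuous function of time, so its integral exists, and
  the deviation from \<open>T / 2\<close> is bounded by the integral of the majorant.\<close>

lemma winding_error:
  assumes T: "T > 0" and x: "x \<in> \<Omega>0" "x \<notin> bad T" and ne: "\<And>t. t \<in> {0..T} \<Longrightarrow> \<phi> x t \<noteq> 0"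
  shows "\<bar>winding_up_to u \<phi> x T / T - 1 / (4 * pi)\<bar> \<le> sqrt mean_error"
proof -
  define a where "a s = tangential_velocity u s (\<phi> x s) / norm (\<phi> x s)" for s
  have cphi: "continuous_on {0..T} (\<phi> x)" by (rule continuous_on_subset[OF flow_continuous]) auto
  have "continuous_on {0..T} (\<lambda>s. (s, \<phi> x s))" by (intro continuous_intros cphi)
  moreover have "(\<lambda>s. (s, \<phi> x s)) ` {0..T} \<subseteq> {0..} \<times> UNIV" by auto
  ultimately have cu: "continuous_on {0..T} (\<lambda>s. u s (\<phi> x s))"
    using continuous_on_compose2[OF velocity_continuous] by fastforce
  have ca: "continuous_on {0..T} a"
    unfolding a_def tangential_velocity_def
    by (intro continuous_intros cu cphi continuous_on_compose2[OF linear_continuous_on[OF perp_linear] cphi])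
      (use ne in auto)
  have ia: "a integrable_on {0..T}" using ca by (rule integrable_continuous_real)
  have cb: "continuous_on {0..T} (\<lambda>s. \<bar>a s - 1 / 2\<bar>)" by (intro continuous_intros ca)
  have ib: "(\<lambda>s. \<bar>a s - 1 / 2\<bar>) integrable_on {0..T}" using cb by (rule integrable_continuous_real)
  have "ennreal (integral {0..T} (\<lambda>s. \<bar>a s - 1 / 2\<bar>)) = (\<integral>\<^sup>+s. indicator {0..T} s * ennreal \<bar>a s - 1 / 2\<bar> \<partial>lborel)"
    using nn_integral_has_integral_lebesgue[OF _ integrable_integral[OF ib]]
    by (simp add: ennreal_indicator[symmetric] ennreal_mult'[symmetric])
  also have "\<dots> = (\<integral>\<^sup>+s. ennreal \<bar>a s - 1 / 2\<bar> * indicator {0..T} s \<partial>lebesgue)"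
    by (simp add: nn_integral_completion mult.commute)
  also have "\<dots> = (\<integral>\<^sup>+s. ennreal \<bar>a s - 1 / 2\<bar> \<partial>lebesgue_on {0..T})"
    by (subst nn_integral_restrict_space) auto
  also have "\<dots> \<le> total_error T x"
    unfolding total_error_def
  proof (intro nn_integral_mono)
    fix s assume "s \<in> space (lebesgue_on {0..T})"
    then have "s \<in> {0..T}" by simp
    then show "ennreal \<bar>a s - 1 / 2\<bar> \<le> angular_error s x"
      unfolding a_def using ne by (intro angular_velocity_error) auto
  qed
  also have "\<dots> \<le> ennreal (T * sqrt mean_error)" using x by (auto simp: bad_def)
  finally have int: "integral {0..T} (\<lambda>s. \<bar>a s - 1 / 2\<bar>) \<le> T * sqrt mean_error"
    using T mean_error_nonneg by (simp add: ennreal_le_iff)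
  have "\<bar>integral {0..T} a - T / 2\<bar> = \<bar>integral {0..T} (\<lambda>s. a s - 1 / 2)\<bar>"
    using T by (subst Henstock_Kurzweil_Integration.integral_diff[OF ia integrable_const_ivl]) simp
  also have "\<dots> \<le> integral {0..T} (\<lambda>s. \<bar>a s - 1 / 2\<bar>)"
    using integral_norm_bound_integral[OF integrable_diff[OF ia integrable_const_ivl] ib, of "1 / 2"] by simp
  finally have *: "\<bar>integral {0..T} a - T / 2\<bar> \<le> T * sqrt mean_error" using int by linarith
  have "winding_up_to u \<phi> x T / T - 1 / (4 * pi) = 1 / (2 * pi * T) * (integral {0..T} a - T / 2)"
    using T by (simp add: winding_up_to_def a_def[abs_def] field_simps)
  then have "\<bar>winding_up_to u \<phi> x T / T - 1 / (4 * pi)\<bar> = 1 / (2 * pi * T) * \<bar>integral {0..T} a - T / 2\<bar>"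
    using T by (simp add: abs_mult)
  also have "\<dots> \<le> 1 / (2 * pi * T) * (T * sqrt mean_error)" using T by (intro mult_left_mono *) auto
  also have "\<dots> = 1 / (2 * pi) * sqrt mean_error" using T by simp
  also have "\<dots> \<le> 1 * sqrt mean_error"
    using pi_ge_two mean_error_nonneg by (intro mult_right_mono) (auto simp: divide_simps)
  finally show ?thesis by simp
qed

lemma remove_bad:
  assumes B: "B \<in> lmeasurable" "area B \<le> q"
  defines "H \<equiv> \<Omega>0 - B - {x. \<exists>t\<ge>0. \<phi> x t = 0}"
  shows "H \<in> sets lebesgue" "H \<subseteq> \<Omega>0" "area H \<ge> area \<Omega>0 - q"
    "\<And>x t. x \<in> H \<Longrightarrow> t \<ge> 0 \<Longrightarrow> \<phi> x t \<noteq> 0"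
proof -
  let ?Z = "{x. \<exists>t\<ge>0. \<phi> x t = 0}"
  have Z: "?Z \<in> lmeasurable" "area ?Z = 0"
    using origin_hitting_negligible by (auto simp: negligible_iff_measure)
  show "H \<in> sets lebesgue" unfolding H_def
    using meas0 B Z by (intro sets.Diff) (auto dest: fmeasurableD)
  have H: "H \<in> lmeasurable" unfolding H_def by (intro fmeasurable.Diff \<Omega>0_lmeasurable B Z)
  show "H \<subseteq> \<Omega>0" by (auto simp: H_def)
  have "area \<Omega>0 \<le> area (H \<union> B \<union> ?Z)"
    using H B Z meas0 by (intro measure_mono_fmeasurable fmeasurable.Un) (auto simp: H_def)
  also have "\<dots> \<le> area (H \<union> B) + area ?Z"
    using H B Z by (intro measure_Un_le) (auto dest: fmeasurableD)
  also have "\<dots> \<le> area H + area B + area ?Z"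
    using H B by (intro add_right_mono measure_Un_le) (auto dest: fmeasurableD)
  finally show "area H \<ge> area \<Omega>0 - q" using B(2) Z(2) by simp
  show "\<And>x t. x \<in> H \<Longrightarrow> t \<ge> 0 \<Longrightarrow> \<phi> x t \<noteq> 0" by (auto simp: H_def)
qed

text \<open>The bad sets at different times may be unrelated, so only points that are bad at all late integer
  times can be excluded; for the others the limit inferior is small along integers.\<close>

definition eventually_bad :: "(real^2) set" where
  "eventually_bad = (\<Union>m. \<Inter>n\<in>{m..}. bad (real (Suc n)))"

text \<open>The sets of points that are bad at all late integer times increase to their union.\<close>

lemma eventually_bad_small:
  "eventually_bad \<in> lmeasurable" "area eventually_bad \<le> sqrt mean_error"
proof -
  let ?A = "\<lambda>m. \<Inter>n\<in>{m..}. bad (real (Suc n))"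
  have b: "bad (real (Suc n)) \<in> lmeasurable" "area (bad (real (Suc n))) \<le> sqrt mean_error" for n
    using bad_small[of "real (Suc n)"] by simp_all
  have A: "?A m \<in> sets lebesgue" for m
    by (rule sets.countable_INT'') (auto intro: fmeasurableD b(1) simp del: of_nat_Suc)
  have le: "area (?A m) \<le> sqrt mean_error" for m
  proof -
    have "area (?A m) \<le> area (bad (real (Suc m)))"
      by (intro measure_mono_fmeasurable A b) auto
    then show ?thesis using b(2)[of m] by linarith
  qed
  have sub: "eventually_bad \<subseteq> \<Omega>0" by (auto simp: eventually_bad_def bad_def)
  have "eventually_bad \<in> sets lebesgue" unfolding eventually_bad_def using A by (intro sets.countable_UN) blast
  then show l: "eventually_bad \<in> lmeasurable" using sub \<Omega>0_lmeasurable fmeasurableI2 by blast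
  have "incseq ?A" by (rule incseq_SucI) auto
  moreover have "range ?A \<subseteq> sets lebesgue" using A by blast
  moreover have "emeasure lebesgue (\<Union>m. ?A m) \<noteq> \<infinity>"
    using fmeasurableD2[OF l] unfolding eventually_bad_def infinity_ennreal_def .
  ultimately have "(\<lambda>m. area (?A m)) \<longlonglongrightarrow> area (\<Union>m. ?A m)"
    by (intro Lim_measure_incseq)
  then show "area eventually_bad \<le> sqrt mean_error"
    unfolding eventually_bad_def by (rule LIMSEQ_le_const2) (use le in auto)
qed

lemma most_particles_at_time:
  assumes T: "T > 0" and q: "sqrt mean_error \<le> q"
  shows "\<exists>H. H \<in> sets lebesgue \<and> H \<subseteq> \<Omega>0 \<and> area H \<ge> area \<Omega>0 - q \<and>
    (\<forall>x\<in>H. (\<forall>t\<in>{0..T}. \<phi> x t \<noteq> 0) \<and> \<bar>winding_up_to u \<phi> x T / T - 1 / (4 * pi)\<bar> \<le> q)"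
proof -
  note H = remove_bad[OF bad_small(1)[OF T] order_trans[OF bad_small(2)[OF T] q]]
  show ?thesis
  proof (rule exI, intro conjI ballI)
    show "\<Omega>0 - bad T - {x. \<exists>t\<ge>0. \<phi> x t = 0} \<in> sets lebesgue" by (rule H(1))
    show "\<Omega>0 - bad T - {x. \<exists>t\<ge>0. \<phi> x t = 0} \<subseteq> \<Omega>0" by (rule H(2))
    show "area \<Omega>0 - q \<le> area (\<Omega>0 - bad T - {x. \<exists>t\<ge>0. \<phi> x t = 0})" by (rule H(3))
    fix x assume x: "x \<in> \<Omega>0 - bad T - {x. \<exists>t\<ge>0. \<phi> x t = 0}"
    show "\<phi> x t \<noteq> 0" if "t \<in> {0..T}" for t using H(4)[OF x] that by auto
    show "\<bar>winding_up_to u \<phi> x T / T - 1 / (4 * pi)\<bar> \<le> q"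
      by (rule order_trans[OF winding_error[OF T] q]) (use x in auto)
  qed
qed

lemma most_particles_liminf:
  assumes q: "sqrt mean_error \<le> q"
  shows "\<exists>H. H \<in> sets lebesgue \<and> H \<subseteq> \<Omega>0 \<and> area H \<ge> area \<Omega>0 - q \<and>
    (\<forall>x\<in>H. (\<forall>t\<ge>0. \<phi> x t \<noteq> 0) \<and>
      Liminf at_top (\<lambda>t::real. ereal \<bar>winding_up_to u \<phi> x t / t - 1 / (4 * pi)\<bar>) \<le> ereal q)"
proof -
  note H = remove_bad[OF eventually_bad_small(1) order_trans[OF eventually_bad_small(2) q]]
  show ?thesis
  proof (rule exI, intro conjI ballI)
    show "\<Omega>0 - eventually_bad - {x. \<exists>t\<ge>0. \<phi> x t = 0} \<in> sets lebesgue" by (rule H(1))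
    show "\<Omega>0 - eventually_bad - {x. \<exists>t\<ge>0. \<phi> x t = 0} \<subseteq> \<Omega>0" by (rule H(2))
    show "area \<Omega>0 - q \<le> area (\<Omega>0 - eventually_bad - {x. \<exists>t\<ge>0. \<phi> x t = 0})" by (rule H(3))
    fix x assume x: "x \<in> \<Omega>0 - eventually_bad - {x. \<exists>t\<ge>0. \<phi> x t = 0}"
    show ne: "\<forall>t\<ge>0. \<phi> x t \<noteq> 0" using H(4)[OF x] by auto
    show "Liminf at_top (\<lambda>t::real. ereal \<bar>winding_up_to u \<phi> x t / t - 1 / (4 * pi)\<bar>) \<le> ereal q"
    proof (rule Liminf_least)
      fix P :: "real \<Rightarrow> bool" assume "eventually P at_top"
      then obtain t0 where t0: "\<And>t. t \<ge> t0 \<Longrightarrow> P t" by (auto simp: eventually_at_top_linorder)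
      obtain m where m: "t0 \<le> real m" using real_arch_simple by blast
      obtain n where n: "n \<ge> m" "x \<notin> bad (real (Suc n))" using x by (auto simp: eventually_bad_def)
      have "P (real (Suc n))" using m n by (intro t0) simp
      moreover have "\<bar>winding_up_to u \<phi> x (real (Suc n)) / real (Suc n) - 1 / (4 * pi)\<bar> \<le> q"
        by (rule order_trans[OF winding_error q]) (use x n ne in auto)
      ultimately show "(INF t\<in>Collect P. ereal \<bar>winding_up_to u \<phi> x t / t - 1 / (4 * pi)\<bar>) \<le> ereal q"
        by (intro INF_lower2[of "real (Suc n)"]) auto
    qed
  qed
qed

lemma mean_error_le:
  assumes "\<delta> \<le> 1"
  shows "mean_error \<le> (3 * sqrt (8 * sqrt (R\<^sup>2 + 1)) * ((1 + 4 * pi) * (2 * R)) + (6 * R + 1 / 2) * (8 * sqrt (R\<^sup>2 + 1))) * sqrt (sqrt \<delta>)"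
proof -
  have m: "sqrt (area \<Omega>0) \<le> 2 * R"
  proof -
    have "area \<Omega>0 \<le> area (ball (0::real^2) R)"
      using in_ball meas0 by (intro measure_mono_fmeasurable) auto
    also have "\<dots> = pi * R\<^sup>2" using R_pos by (intro measure_ball_plane) auto
    also have "\<dots> \<le> 4 * R\<^sup>2" using pi_less_4 by (intro mult_right_mono) auto
    finally have "sqrt (area \<Omega>0) \<le> sqrt (4 * R\<^sup>2)" by (rule real_sqrt_le_mono)
    then show ?thesis using R_pos by (simp add: real_sqrt_mult)
  qed
  have dev: "deviation = 3 * sqrt (8 * sqrt (R\<^sup>2 + 1)) * sqrt (sqrt \<delta>)"
    by (simp add: deviation_def real_sqrt_mult)
  have "sqrt \<delta> \<le> 1" using assms by simp
  then have "sqrt \<delta> * sqrt \<delta> \<le> 1 * sqrt \<delta>" using \<delta>_nonneg by (intro mult_right_mono) auto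
  then have "sqrt (sqrt \<delta> * sqrt \<delta>) \<le> sqrt (sqrt \<delta>)" by simp
  then have root: "sqrt \<delta> \<le> sqrt (sqrt \<delta>)" using \<delta>_nonneg by simp
  have out: "outside_area \<le> 8 * sqrt (R\<^sup>2 + 1) * sqrt (sqrt \<delta>)"
    using root by (simp add: outside_area_def real_sqrt_mult mult_left_mono)
  have "mean_error \<le> 3 * sqrt (8 * sqrt (R\<^sup>2 + 1)) * sqrt (sqrt \<delta>) * ((1 + 4 * pi) * (2 * R))
     + (6 * R + 1 / 2) * (8 * sqrt (R\<^sup>2 + 1) * sqrt (sqrt \<delta>))"
    unfolding mean_error_def
  proof (rule add_mono)
    have "deviation * ((1 + 4 * pi) * sqrt (area \<Omega>0)) \<le> deviation * ((1 + 4 * pi) * (2 * R))"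
      by (intro mult_left_mono m deviation_nonneg) (simp add: add_nonneg_nonneg)
    then show "deviation * ((1 + 4 * pi) * sqrt (area \<Omega>0)) \<le> 3 * sqrt (8 * sqrt (R\<^sup>2 + 1)) * sqrt (sqrt \<delta>) * ((1 + 4 * pi) * (2 * R))"
      by (simp only: dev)
    have "speed + 1 / 2 \<le> 6 * R + 1 / 2" using m by (simp add: speed_def)
    then show "(speed + 1 / 2) * outside_area \<le> (6 * R + 1 / 2) * (8 * sqrt (R\<^sup>2 + 1) * sqrt (sqrt \<delta>))"
      using out R_pos outside_area_nonneg by (intro mult_mono) auto
  qed
  then show ?thesis by (simp add: algebra_simps)
qed

end

text \<open>The square root of a mean error of order \<open>d powr (1/4)\<close> gives the exponent \<open>1/8\<close>, which is larger than \<open>1/12\<close>.\<close>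

lemma eighth_root_le_powr:
  fixes d :: real
  assumes "0 \<le> d" "d \<le> 1"
  shows "sqrt (sqrt (sqrt d)) \<le> d powr (1 / 12)"
proof -
  have "sqrt (sqrt (sqrt d)) = ((d powr (1 / 2)) powr (1 / 2)) powr (1 / 2)"
    using assms by (simp add: powr_half_sqrt)
  also have "\<dots> = d powr (1 / 8)" by (simp add: powr_powr)
  also have "\<dots> \<le> d powr (1 / 12)" using assms by (intro powr_mono') auto
  finally show ?thesis .
qed

theorem theorem1p1:
  fixes R :: real
  assumes "R > 0"
  shows "\<exists>\<delta>0 C :: real. 0 < \<delta>0 \<and> \<delta>0 < 1 \<and> C > 0 \<and>
    (\<forall>(\<Omega>0 :: (real^2) set) w u \<phi> \<delta>.
       bounded \<Omega>0 \<longrightarrow> \<Omega>0 \<in> sets lebesgue \<longrightarrow> \<Omega>0 \<subseteq> ball 0 R \<longrightarrow>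
       \<delta> = measure lebesgue (sym_diff (ball 0 1) \<Omega>0) \<longrightarrow> \<delta> < \<delta>0 \<longrightarrow>
       vortex_patch_solution \<Omega>0 w u \<phi> \<longrightarrow>
         (\<forall>T>0. \<exists>H. H \<in> sets lebesgue \<and> H \<subseteq> \<Omega>0 \<and>
            measure lebesgue H \<ge> measure lebesgue \<Omega>0 - C * \<delta> powr (1 / 12) \<and>
            (\<forall>x\<in>H. (\<forall>t\<in>{0..T}. \<phi> x t \<noteq> 0) \<and>
               \<bar>winding_up_to u \<phi> x T / T - 1 / (4 * pi)\<bar> \<le> C * \<delta> powr (1 / 12))) \<and>
         (\<exists>H. H \<in> sets lebesgue \<and> H \<subseteq> \<Omega>0 \<and>
            measure lebesgue H \<ge> measure lebesgue \<Omega>0 - C * \<delta> powr (1 / 12) \<and>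
            (\<forall>x\<in>H. (\<forall>t\<ge>0. \<phi> x t \<noteq> 0) \<and>
               Liminf at_top (\<lambda>t::real. ereal \<bar>winding_up_to u \<phi> x t / t - 1 / (4 * pi)\<bar>)
                 \<le> ereal (C * \<delta> powr (1 / 12)))))"
proof -
  \<comment> \<open>The square root turns the bound of \<open>mean_error_le\<close>, of order \<open>\<delta> powr (1/4)\<close>, into order \<open>\<delta> powr (1/8)\<close>.\<close>
  define K where "K = 3 * sqrt (8 * sqrt (R\<^sup>2 + 1)) * ((1 + 4 * pi) * (2 * R)) + (6 * R + 1 / 2) * (8 * sqrt (R\<^sup>2 + 1))"
  have K: "K > 0" unfolding K_def using assms by (intro add_pos_pos mult_pos_pos) (auto simp: add_pos_nonneg add_nonneg_pos)
  show ?thesis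
  proof (rule exI[of _ "1 / 2 :: real"], rule exI[of _ "sqrt K"], intro conjI allI impI)
    show "0 < (1 / 2 :: real)" "(1 / 2 :: real) < 1" "0 < sqrt K" using K by simp_all
    fix \<Omega>0 :: "(real^2) set" and w u \<phi> \<delta>
    assume h: "bounded \<Omega>0" "\<Omega>0 \<in> sets lebesgue" "\<Omega>0 \<subseteq> ball 0 R"
      "\<delta> = measure lebesgue (sym_diff (ball 0 1) \<Omega>0)" "\<delta> < 1 / 2" "vortex_patch_solution \<Omega>0 w u \<phi>"
    interpret patch R \<Omega>0 w u \<phi> by unfold_locales (use assms h in auto)
    have d: "patch.\<delta> \<Omega>0 = \<delta>" using h(4) by (simp add: \<delta>_def)
    have d0: "0 \<le> \<delta>" "\<delta> \<le> 1" using h(4,5) by auto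
    have "mean_error \<le> K * sqrt (sqrt \<delta>)" unfolding K_def using mean_error_le d d0 by simp
    then have "sqrt mean_error \<le> sqrt (K * sqrt (sqrt \<delta>))" by (rule real_sqrt_le_mono)
    also have "\<dots> = sqrt K * sqrt (sqrt (sqrt \<delta>))" by (rule real_sqrt_mult)
    also have "\<dots> \<le> sqrt K * \<delta> powr (1 / 12)" using K d0 by (intro mult_left_mono eighth_root_le_powr) auto
    finally have q: "sqrt mean_error \<le> sqrt K * \<delta> powr (1 / 12)" .
    show "\<exists>H. H \<in> sets lebesgue \<and> H \<subseteq> \<Omega>0 \<and>
            measure lebesgue H \<ge> measure lebesgue \<Omega>0 - sqrt K * \<delta> powr (1 / 12) \<and>
            (\<forall>x\<in>H. (\<forall>t\<in>{0..T}. \<phi> x t \<noteq> 0) \<and>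
               \<bar>winding_up_to u \<phi> x T / T - 1 / (4 * pi)\<bar> \<le> sqrt K * \<delta> powr (1 / 12))" if "T > 0" for T
      by (rule most_particles_at_time[OF that q])
    show "\<exists>H. H \<in> sets lebesgue \<and> H \<subseteq> \<Omega>0 \<and>
            measure lebesgue H \<ge> measure lebesgue \<Omega>0 - sqrt K * \<delta> powr (1 / 12) \<and>
            (\<forall>x\<in>H. (\<forall>t\<ge>0. \<phi> x t \<noteq> 0) \<and>
               Liminf at_top (\<lambda>t::real. ereal \<bar>winding_up_to u \<phi> x t / t - 1 / (4 * pi)\<bar>)
                 \<le> ereal (sqrt K * \<delta> powr (1 / 12)))"
      by (rule most_particles_liminf[OF q])
  qed
qed

end
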